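(* Every finitely generated Coxeter group is accessible (with respect to splittings over finite groups).
   Context: A Coxeter group is a group $W$ having a presentation $\langle S : (st)^{m(s,t)}\ (s,t\in S,\ m(s,t)<\infty)\rangle$, where $m:S^2\to\{1,2,\ldots,\infty\}$, $m(s,t)=m(t,s)$, and $m(s,t)=1$ iff $s=t$. Accessible means: there is no infinite sequence $\Lambda_0,\Lambda_1,\Lambda_2,\ldots$ of finite graph of groups decompositions of $W$ with finite edge groups in which each $\Lambda_{i+1}$ results from $\Lambda_i$ by either (a) a reduction, i.e. collapsing an edge (that is not a loop) whose edge group equals, or has image equal to, one of its endpoint vertex groups; or (b) a splitting of a vertex group over a finite subgroup, i.e. replacing a vertex $V$ whose group splits as a nontrivial amalgamated product $\Lambda_i(V)=A*_CB$ ($A\ne C\ne B$) with $C$ finite by two vertices with groups $A$ and $B$ joined by an edge with group $C$, each edge formerly incident at $V$ being attached to one of the two new vertices (each finite edge group incident at $V$ lies in a conjugate, in $\Lambda_i(V)$, of $A$ or $B$, and edge maps are adjusted by conjugation accordingly). (Coxeter groups have no nontrivial homomorphism to $\mathbb Z$, so the graphs underlying such decompositions are trees and HNN splittings do not occur.) *)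

theory Defs
  imports
    "HOL-Algebra.Generated_Groups"
    "HOL-Library.Extended_Nat"
    "Graph_Theory.Digraph_Component"
begin

section \<open>Group presentations\<close>

text \<open>A letter \<open>(s, True)\<close> stands for the generator \<open>s\<close> and \<open>(s, False)\<close> for its formal inverse.\<close>

type_synonym 's word = "('s \<times> bool) list"

abbreviation words :: "'s set \<Rightarrow> 's word set" where
  "words S \<equiv> lists (S \<times> UNIV)"

text \<open>The congruence on words over \<open>S\<close> generated by free cancellation and by \<open>r = 1\<close> for \<open>r \<in> R\<close>.\<close>

inductive pres_eq :: "'s set \<Rightarrow> 's word set \<Rightarrow> 's word \<Rightarrow> 's word \<Rightarrow> bool"
  for S :: "'s set" and R :: "'s word set" where
  refl: "w \<in> words S \<Longrightarrow> pres_eq S R w w"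
| sym: "pres_eq S R v w \<Longrightarrow> pres_eq S R w v"
| trans: "pres_eq S R u v \<Longrightarrow> pres_eq S R v w \<Longrightarrow> pres_eq S R u w"
| cancel: "u \<in> words S \<Longrightarrow> v \<in> words S \<Longrightarrow> s \<in> S \<Longrightarrow>
    pres_eq S R (u @ [(s, b), (s, \<not> b)] @ v) (u @ v)"
| relator: "u \<in> words S \<Longrightarrow> v \<in> words S \<Longrightarrow> r \<in> R \<Longrightarrow> r \<in> words S \<Longrightarrow>
    pres_eq S R (u @ r @ v) (u @ v)"

definition pres_class :: "'s set \<Rightarrow> 's word set \<Rightarrow> 's word \<Rightarrow> 's word set" where
  "pres_class S R w = {v. pres_eq S R w v}"

definition presented_group :: "'s set \<Rightarrow> 's word set \<Rightarrow> 's word set monoid" where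
  "presented_group S R =
    \<lparr>carrier = pres_class S R ` words S,
     monoid.mult = (\<lambda>X Y. \<Union>x\<in>X. \<Union>y\<in>Y. pres_class S R (x @ y)),
     one = pres_class S R []\<rparr>"

lemma pres_eq_words: "pres_eq S R v w \<Longrightarrow> v \<in> words S \<and> w \<in> words S"
  by (induction rule: pres_eq.induct) auto

lemma pres_eq_context:
  assumes "pres_eq S R v w" "x \<in> words S" "y \<in> words S"
  shows "pres_eq S R (x @ v @ y) (x @ w @ y)"
  using assms(1)
proof (induction rule: pres_eq.induct)
  case (refl w)
  then show ?case using assms(2,3) by (intro pres_eq.refl) auto
next
  case (sym v w)
  then show ?case by (blast intro: pres_eq.sym)
next
  case (trans u v w)
  then show ?case by (blast intro: pres_eq.trans)
next
  case (cancel u v s b)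
  then show ?case
    using pres_eq.cancel[of "x @ u" S "v @ y" s R b] assms(2,3) by auto
next
  case (relator u v r)
  then show ?case
    using pres_eq.relator[of "x @ u" S "v @ y" r R] assms(2,3) by auto
qed

lemma pres_class_eq_iff:
  assumes "v \<in> words S" "w \<in> words S"
  shows "pres_class S R v = pres_class S R w \<longleftrightarrow> pres_eq S R v w"
  unfolding pres_class_def using assms
  by (blast intro: pres_eq.refl pres_eq.sym pres_eq.trans)

lemma presented_group_mult:
  assumes "v \<in> words S" "w \<in> words S"
  shows "pres_class S R v \<otimes>\<^bsub>presented_group S R\<^esub> pres_class S R w = pres_class S R (v @ w)"
proof -
  have *: "pres_class S R (x @ y) = pres_class S R (v @ w)"
    if "x \<in> pres_class S R v" "y \<in> pres_class S R w" for x y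
  proof -
    have vx: "pres_eq S R v x" and wy: "pres_eq S R w y"
      using that by (auto simp: pres_class_def)
    have x: "x \<in> words S" and y: "y \<in> words S"
      using vx wy by (blast dest: pres_eq_words)+
    have "pres_eq S R (v @ w) (x @ w)"
      using pres_eq_context[OF vx, of "[]" w] assms by simp
    moreover have "pres_eq S R (x @ w) (x @ y)"
      using pres_eq_context[OF wy x, of "[]"] by simp
    ultimately have "pres_eq S R (v @ w) (x @ y)" by (rule pres_eq.trans)
    then show ?thesis
      using pres_class_eq_iff[of "v @ w" S "x @ y" R] assms x y by auto
  qed
  have "v \<in> pres_class S R v" "w \<in> pres_class S R w"
    using assms by (auto simp: pres_class_def intro: pres_eq.refl)
  then have "(\<Union>x\<in>pres_class S R v. \<Union>y\<in>pres_class S R w. pres_class S R (x @ y))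
    = pres_class S R (v @ w)"
    using * by blast
  then show ?thesis by (simp add: presented_group_def)
qed

lemma pres_eq_inverse:
  assumes "w \<in> words S"
  shows "pres_eq S R (map (\<lambda>(s, b). (s, \<not> b)) (rev w) @ w) []"
  using assms
proof (induction w)
  case Nil
  then show ?case by (auto intro: pres_eq.refl)
next
  case (Cons a w)
  obtain s b where a: "a = (s, b)" by (cases a)
  let ?v = "map (\<lambda>(s, b). (s, \<not> b)) (rev w)"
  have s: "s \<in> S" and w: "w \<in> words S"
    using Cons.hyps a by auto
  have v: "?v \<in> words S" using w by (auto simp: in_lists_conv_set)
  have "pres_eq S R (?v @ [(s, \<not> b), (s, \<not> \<not> b)] @ w) (?v @ w)"
    by (rule pres_eq.cancel[OF v w s])
  moreover have "pres_eq S R (?v @ w) []" by (rule Cons.IH)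
  ultimately have "pres_eq S R (?v @ [(s, \<not> b), (s, \<not> \<not> b)] @ w) []"
    by (rule pres_eq.trans)
  then show ?case by (simp add: a)
qed

lemma group_presented_group: "group (presented_group S R)"
proof (rule groupI)
  fix X Y assume "X \<in> carrier (presented_group S R)" "Y \<in> carrier (presented_group S R)"
  then obtain v w where "v \<in> words S" "w \<in> words S" "X = pres_class S R v" "Y = pres_class S R w"
    by (auto simp: presented_group_def)
  then show "X \<otimes>\<^bsub>presented_group S R\<^esub> Y \<in> carrier (presented_group S R)"
    by (simp add: presented_group_mult) (auto simp: presented_group_def)
next
  show "\<one>\<^bsub>presented_group S R\<^esub> \<in> carrier (presented_group S R)"
    by (auto simp: presented_group_def)
next
  fix X Y Z
  assume "X \<in> carrier (presented_group S R)" "Y \<in> carrier (presented_group S R)"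
    "Z \<in> carrier (presented_group S R)"
  then obtain u v w where "u \<in> words S" "v \<in> words S" "w \<in> words S"
    "X = pres_class S R u" "Y = pres_class S R v" "Z = pres_class S R w"
    by (auto simp: presented_group_def)
  then show "X \<otimes>\<^bsub>presented_group S R\<^esub> Y \<otimes>\<^bsub>presented_group S R\<^esub> Z
    = X \<otimes>\<^bsub>presented_group S R\<^esub> (Y \<otimes>\<^bsub>presented_group S R\<^esub> Z)"
    by (simp add: presented_group_mult)
next
  fix X assume "X \<in> carrier (presented_group S R)"
  then obtain w where w: "w \<in> words S" "X = pres_class S R w"
    by (auto simp: presented_group_def)
  have one: "\<one>\<^bsub>presented_group S R\<^esub> = pres_class S R []"
    by (simp add: presented_group_def)
  show "\<one>\<^bsub>presented_group S R\<^esub> \<otimes>\<^bsub>presented_group S R\<^esub> X = X"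
    using w by (simp add: one presented_group_mult)
  let ?v = "map (\<lambda>(s, b). (s, \<not> b)) (rev w)"
  have v: "?v \<in> words S" using w by (auto simp: in_lists_conv_set)
  have "pres_class S R (?v @ w) = pres_class S R []"
    using pres_class_eq_iff[of "?v @ w" S "[]" R] pres_eq_inverse[OF w(1)] v w(1) by auto
  then have "pres_class S R ?v \<otimes>\<^bsub>presented_group S R\<^esub> X = \<one>\<^bsub>presented_group S R\<^esub>"
    using presented_group_mult[OF v w(1)] w(2) one by metis
  moreover have "pres_class S R ?v \<in> carrier (presented_group S R)"
    using v by (auto simp: presented_group_def)
  ultimately show "\<exists>Y\<in>carrier (presented_group S R).
      Y \<otimes>\<^bsub>presented_group S R\<^esub> X = \<one>\<^bsub>presented_group S R\<^esub>"
    by blast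
qed

section \<open>Coxeter groups\<close>

definition coxeter_matrix :: "'s set \<Rightarrow> ('s \<Rightarrow> 's \<Rightarrow> enat) \<Rightarrow> bool" where
  "coxeter_matrix S m \<longleftrightarrow>
    (\<forall>s\<in>S. \<forall>t\<in>S. 1 \<le> m s t \<and> m s t = m t s \<and> (m s t = 1 \<longleftrightarrow> s = t))"

definition coxeter_relators :: "'s set \<Rightarrow> ('s \<Rightarrow> 's \<Rightarrow> enat) \<Rightarrow> 's word set" where
  "coxeter_relators S m =
    {concat (replicate k [(s, True), (t, True)]) | k s t. s \<in> S \<and> t \<in> S \<and> m s t = enat k}"

definition coxeter_presentation ::
    "('a, 'm) monoid_scheme \<Rightarrow> 's set \<Rightarrow> ('s \<Rightarrow> 's \<Rightarrow> enat) \<Rightarrow> bool" where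
  "coxeter_presentation W S m \<longleftrightarrow>
    coxeter_matrix S m \<and> presented_group S (coxeter_relators S m) \<cong> W"

definition finitely_generated_group :: "('a, 'm) monoid_scheme \<Rightarrow> bool" where
  "finitely_generated_group G \<longleftrightarrow>
    (\<exists>X. finite X \<and> X \<subseteq> carrier G \<and> generate G X = carrier G)"

section \<open>Amalgamated products\<close>

definition amalgam_relators ::
    "('a, 'm) monoid_scheme \<Rightarrow> 'a set \<Rightarrow> 'a set \<Rightarrow> 'a set \<Rightarrow> ('a + 'a) word set" where
  "amalgam_relators G A B C =
    {[(Inl x, True), (Inl y, True), (Inl (x \<otimes>\<^bsub>G\<^esub> y), False)] | x y. x \<in> A \<and> y \<in> A} \<union>
    {[(Inr x, True), (Inr y, True), (Inr (x \<otimes>\<^bsub>G\<^esub> y), False)] | x y. x \<in> B \<and> y \<in> B} \<union>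
    {[(Inl c, True), (Inr c, False)] | c. c \<in> C}"

text \<open>\<open>G = A *\<^sub>C B\<close>: the homomorphism from the amalgamated product to \<open>G\<close> that is induced by the
  inclusions of the subgroups \<open>A\<close> and \<open>B\<close> is an isomorphism.\<close>

definition amalgamated_product ::
    "('a, 'm) monoid_scheme \<Rightarrow> 'a set \<Rightarrow> 'a set \<Rightarrow> 'a set \<Rightarrow> bool" where
  "amalgamated_product G A B C \<longleftrightarrow>
    subgroup A G \<and> subgroup B G \<and> subgroup C G \<and> C \<subseteq> A \<and> C \<subseteq> B \<and>
    (let S = A <+> B; R = amalgam_relators G A B C in
      \<exists>h\<in>iso (presented_group S R) G.
        (\<forall>x\<in>A. h (pres_class S R [(Inl x, True)]) = x) \<and>
        (\<forall>x\<in>B. h (pres_class S R [(Inr x, True)]) = x))"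

section \<open>Graphs of groups\<close>

text \<open>The arcs are the geometric edges of the underlying graph, each with an arbitrarily chosen
  orientation. Loops and multiple edges are allowed. The end \<open>(e, False)\<close> of an arc \<open>e\<close> is at its
  tail and the end \<open>(e, True)\<close> at its head; \<open>edge_map e d\<close> is the embedding of the edge group into
  the vertex group at the end \<open>(e, d)\<close>.\<close>

record ('v, 'e, 'g) graph_of_groups =
  graph :: "('v, 'e) pre_digraph"
  vertex_group :: "'v \<Rightarrow> 'g monoid"
  edge_group :: "'e \<Rightarrow> 'g monoid"
  edge_map :: "'e \<Rightarrow> bool \<Rightarrow> 'g \<Rightarrow> 'g"

definition endpoint :: "('v, 'e, 'g) graph_of_groups \<Rightarrow> 'e \<Rightarrow> bool \<Rightarrow> 'v" where
  "endpoint \<Lambda> e d = (if d then head (graph \<Lambda>) e else tail (graph \<Lambda>) e)"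

text \<open>\<open>connected\<close> ignores the orientation of the arcs and excludes the empty graph.\<close>

definition finite_graph_of_groups :: "('v, 'e, 'g) graph_of_groups \<Rightarrow> bool" where
  "finite_graph_of_groups \<Lambda> \<longleftrightarrow>
    fin_digraph (graph \<Lambda>) \<and> connected (graph \<Lambda>) \<and>
    (\<forall>v\<in>verts (graph \<Lambda>). group (vertex_group \<Lambda> v)) \<and>
    (\<forall>e\<in>arcs (graph \<Lambda>). group (edge_group \<Lambda> e) \<and>
      (\<forall>d. edge_map \<Lambda> e d \<in> mon (edge_group \<Lambda> e) (vertex_group \<Lambda> (endpoint \<Lambda> e d))))"

text \<open>The library's \<open>spanning_tree\<close> only excludes directed cycles, so it is not the notion for the
  undirected graph. Here no arc of \<open>T\<close> lies on an undirected circuit in \<open>T\<close>: its ends are not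
  joined by a path in \<open>T - {e}\<close>.\<close>

definition maximal_tree :: "('v, 'e) pre_digraph \<Rightarrow> 'e set \<Rightarrow> bool" where
  "maximal_tree \<Gamma> T \<longleftrightarrow>
    T \<subseteq> arcs \<Gamma> \<and> connected (\<Gamma>\<lparr>arcs := T\<rparr>) \<and>
    (\<forall>e\<in>T. \<not> tail \<Gamma> e \<rightarrow>\<^sup>*\<^bsub>with_proj (mk_symmetric (\<Gamma>\<lparr>arcs := T - {e}\<rparr>))\<^esub> head \<Gamma> e)"

text \<open>The fundamental group relative to a maximal tree \<open>T\<close> is generated by the vertex groups and
  one stable letter \<open>t\<^sub>e\<close> per edge, with \<open>t\<^sub>e \<omega>\<^sub>e(c) t\<^sub>e\<^sup>-\<^sup>1 = \<alpha>\<^sub>e(c)\<close> for \<open>c\<close> in the edge group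
  (\<open>\<omega>\<^sub>e\<close>, \<open>\<alpha>\<^sub>e\<close> the edge maps at the head and at the tail) and \<open>t\<^sub>e = 1\<close> for \<open>e\<close> in \<open>T\<close>.\<close>

definition pi1_generators :: "('v, 'e, 'g) graph_of_groups \<Rightarrow> ('v \<times> 'g + 'e) set" where
  "pi1_generators \<Lambda> =
    (SIGMA v:verts (graph \<Lambda>). carrier (vertex_group \<Lambda> v)) <+> arcs (graph \<Lambda>)"

definition pi1_relators :: "('v, 'e, 'g) graph_of_groups \<Rightarrow> 'e set \<Rightarrow> ('v \<times> 'g + 'e) word set" where
  "pi1_relators \<Lambda> T =
    {[(Inl (v, x), True), (Inl (v, y), True), (Inl (v, x \<otimes>\<^bsub>vertex_group \<Lambda> v\<^esub> y), False)] | v x y.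
      v \<in> verts (graph \<Lambda>) \<and> x \<in> carrier (vertex_group \<Lambda> v) \<and> y \<in> carrier (vertex_group \<Lambda> v)} \<union>
    {[(Inr e, True), (Inl (endpoint \<Lambda> e True, edge_map \<Lambda> e True c), True), (Inr e, False),
      (Inl (endpoint \<Lambda> e False, edge_map \<Lambda> e False c), False)] | e c.
      e \<in> arcs (graph \<Lambda>) \<and> c \<in> carrier (edge_group \<Lambda> e)} \<union>
    {[(Inr e, True)] | e. e \<in> T}"

definition fundamental_group ::
    "('v, 'e, 'g) graph_of_groups \<Rightarrow> 'e set \<Rightarrow> ('v \<times> 'g + 'e) word set monoid" where
  "fundamental_group \<Lambda> T = presented_group (pi1_generators \<Lambda>) (pi1_relators \<Lambda> T)"

text \<open>Up to isomorphism the fundamental group does not depend on the maximal tree.\<close>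

definition graph_of_groups_decomposition ::
    "('a, 'm) monoid_scheme \<Rightarrow> ('v, 'e, 'g) graph_of_groups \<Rightarrow> bool" where
  "graph_of_groups_decomposition W \<Lambda> \<longleftrightarrow>
    finite_graph_of_groups \<Lambda> \<and>
    (\<exists>T. maximal_tree (graph \<Lambda>) T \<and> fundamental_group \<Lambda> T \<cong> W)"

section \<open>Accessibility\<close>

text \<open>The non-loop \<open>e\<close> is collapsed onto its endpoint \<open>v\<close>. Its edge group maps onto the vertex group
  of the other endpoint \<open>u\<close>, which is thereby embedded in the vertex group of \<open>v\<close>. Values of
  \<open>\<Lambda>'\<close> outside the vertices, edges and edge groups of \<open>\<Lambda>'\<close> are irrelevant.\<close>

definition reduction ::
    "('v, 'e, 'g) graph_of_groups \<Rightarrow> ('v, 'e, 'g) graph_of_groups \<Rightarrow> bool" where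
  "reduction \<Lambda> \<Lambda>' \<longleftrightarrow>
    (\<exists>e\<in>arcs (graph \<Lambda>). \<exists>d u v.
      u = endpoint \<Lambda> e d \<and> v = endpoint \<Lambda> e (\<not> d) \<and> u \<noteq> v \<and>
      edge_map \<Lambda> e d ` carrier (edge_group \<Lambda> e) = carrier (vertex_group \<Lambda> u) \<and>
      verts (graph \<Lambda>') = verts (graph \<Lambda>) - {u} \<and>
      arcs (graph \<Lambda>') = arcs (graph \<Lambda>) - {e} \<and>
      (\<forall>w\<in>verts (graph \<Lambda>'). vertex_group \<Lambda>' w = vertex_group \<Lambda> w) \<and>
      (\<forall>f\<in>arcs (graph \<Lambda>'). edge_group \<Lambda>' f = edge_group \<Lambda> f \<and>
        (\<forall>d'. if endpoint \<Lambda> f d' = u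
          then endpoint \<Lambda>' f d' = v \<and>
            (\<forall>c\<in>carrier (edge_group \<Lambda> f). edge_map \<Lambda>' f d' c =
              edge_map \<Lambda> e (\<not> d)
                (inv_into (carrier (edge_group \<Lambda> e)) (edge_map \<Lambda> e d) (edge_map \<Lambda> f d' c)))
          else endpoint \<Lambda>' f d' = endpoint \<Lambda> f d' \<and>
            (\<forall>c\<in>carrier (edge_group \<Lambda> f). edge_map \<Lambda>' f d' c = edge_map \<Lambda> f d' c))))"

text \<open>The vertex \<open>v\<close> is replaced by \<open>a\<close> and \<open>b\<close> with vertex groups \<open>A\<close> and \<open>B\<close>, joined by the new
  edge \<open>e\<close> with group \<open>C\<close>. Every edge end at \<open>v\<close> is attached to \<open>a\<close> or to \<open>b\<close>, after conjugating
  the image of the edge group into \<open>A\<close> or \<open>B\<close>. The two ends of a loop at \<open>v\<close> are treated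
  separately.\<close>

definition finite_splitting ::
    "('v, 'e, 'g) graph_of_groups \<Rightarrow> ('v, 'e, 'g) graph_of_groups \<Rightarrow> bool" where
  "finite_splitting \<Lambda> \<Lambda>' \<longleftrightarrow>
    (\<exists>v\<in>verts (graph \<Lambda>). \<exists>G A B C a b e.
      G = vertex_group \<Lambda> v \<and>
      amalgamated_product G A B C \<and> A \<noteq> C \<and> B \<noteq> C \<and> finite C \<and>
      a \<noteq> b \<and> a \<notin> verts (graph \<Lambda>) - {v} \<and> b \<notin> verts (graph \<Lambda>) - {v} \<and>
      e \<notin> arcs (graph \<Lambda>) \<and>
      verts (graph \<Lambda>') = verts (graph \<Lambda>) - {v} \<union> {a, b} \<and>
      arcs (graph \<Lambda>') = insert e (arcs (graph \<Lambda>)) \<and>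
      vertex_group \<Lambda>' a = G\<lparr>carrier := A\<rparr> \<and> vertex_group \<Lambda>' b = G\<lparr>carrier := B\<rparr> \<and>
      (\<forall>w\<in>verts (graph \<Lambda>) - {v}. vertex_group \<Lambda>' w = vertex_group \<Lambda> w) \<and>
      edge_group \<Lambda>' e = G\<lparr>carrier := C\<rparr> \<and>
      endpoint \<Lambda>' e False = a \<and> endpoint \<Lambda>' e True = b \<and>
      (\<forall>d. \<forall>c\<in>C. edge_map \<Lambda>' e d c = c) \<and>
      (\<forall>f\<in>arcs (graph \<Lambda>). edge_group \<Lambda>' f = edge_group \<Lambda> f \<and>
        (\<forall>d. if endpoint \<Lambda> f d = v
          then (\<exists>(w, H)\<in>{(a, A), (b, B)}. \<exists>x\<in>carrier G.
            endpoint \<Lambda>' f d = w \<and>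
            (\<forall>c\<in>carrier (edge_group \<Lambda> f).
              edge_map \<Lambda>' f d c = x \<otimes>\<^bsub>G\<^esub> edge_map \<Lambda> f d c \<otimes>\<^bsub>G\<^esub> inv\<^bsub>G\<^esub> x \<and>
              edge_map \<Lambda>' f d c \<in> H))
          else endpoint \<Lambda>' f d = endpoint \<Lambda> f d \<and>
            (\<forall>c\<in>carrier (edge_group \<Lambda> f). edge_map \<Lambda>' f d c = edge_map \<Lambda> f d c))))"

text \<open>The first argument only names the types from which the vertices, the edges and the elements
  of the vertex and edge groups are taken.\<close>

definition accessible :: "('v \<times> 'e \<times> 'g) itself \<Rightarrow> ('a, 'm) monoid_scheme \<Rightarrow> bool" where
  "accessible _ W \<longleftrightarrow>
    \<not> (\<exists>\<Lambda> :: nat \<Rightarrow> ('v, 'e, 'g) graph_of_groups.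
        (\<forall>i. graph_of_groups_decomposition W (\<Lambda> i) \<and>
          (\<forall>e\<in>arcs (graph (\<Lambda> i)). finite (carrier (edge_group (\<Lambda> i) e)))) \<and>
        (\<forall>i. reduction (\<Lambda> i) (\<Lambda> (Suc i)) \<or> finite_splitting (\<Lambda> i) (\<Lambda> (Suc i))))"

end

theory Submission
  imports
    Defs
    Complex_Main
    "HOL-Algebra.Multiplicative_Group"
    "HOL-Computational_Algebra.Primes"
begin

text \<open>A finitely generated Coxeter group \<open>W\<close> acts faithfully on a lattice over the ring generated by
  the numbers \<open>2 cos (\<pi> / m)\<close> (Tits), so its congruence subgroups modulo \<open>3 ^ k\<close>, \<open>k \<ge> 2\<close>, are torsion-free,
  of finite index, and separate the elements of any finite set. Given a decomposition \<open>\<Lambda>\<close> of \<open>W\<close> and a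
  homomorphism \<open>\<rho>\<close> to a finite group \<open>Q\<close>, put
  \<open>\<chi>(\<Lambda>) = \<Sum>\<^sub>e 1 / |\<rho>(\<Lambda>\<^sub>e)| - \<Sum>\<^sub>v 1 / |\<rho>(\<Lambda>\<^sub>v)|\<close>. Counting the homomorphisms from \<open>W\<close> to the semidirect product of
  \<open>Pow Q\<close> with \<open>Q\<close> that are obtained by deforming \<open>\<rho>\<close> along the edges bounds \<open>\<chi>(\<Lambda>)\<close> by a constant that
  depends only on the number of generators of \<open>W\<close>, as in Linnell's accessibility theorem. A reduction
  does not change \<open>\<chi>\<close>, and a splitting \<open>A *\<^sub>C B\<close> of \<open>V\<close> adds
  \<open>1 / |\<rho>(C)| - 1 / |\<rho>(A)| - 1 / |\<rho>(B)| + 1 / |\<rho>(V)|\<close>. If \<open>\<rho>\<close> is injective on large finite subsets of the groups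
  involved in the first steps, this is bounded below by a positive constant, unless \<open>V\<close> is infinite
  and \<open>A\<close>, \<open>B\<close> are finite. So all but finitely many steps are reductions or replace an infinite vertex
  group by two finite ones, and such steps cannot go on forever.\<close>

section \<open>Presented groups\<close>

text \<open>The vertex groups may be infinite, so their orders carry no information; a finite
  quotient gives each of them an image of finite order. No single quotient serves the whole
  sequence, because the finite sets on which \<rho> must be injective grow with the number of steps.
  The order of quantifiers resolves this: the bounds on \<chi> and on the gain of a step do not
  involve \<rho>, so for each n a quotient is chosen that suits the first n steps, and the number of
  gaining steps among them is bounded independently of n.

  Torsion-free kernels make the gain uniform. They bound the orders of all finite subgroups by one
  number L, and the smallest possible gain is then \<open>1 / (6 * L)\<close>. The borderline case
  is C of index two in both A and B, as in the infinite dihedral group, where 1/c = 1/(2c) + 1/(2c).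

  To evaluate one \<rho> at every stage, all vertex and edge groups are carried along as images in
  W, determined up to conjugacy. This requires that the vertex groups of the initial decomposition
  embed in its fundamental group.\<close>

definition word_val :: "('a, 'm) monoid_scheme \<Rightarrow> ('s \<Rightarrow> 'a) \<Rightarrow> 's word \<Rightarrow> 'a" where
  "word_val K f w = foldr (\<lambda>(s, b) x. (if b then f s else inv\<^bsub>K\<^esub> f s) \<otimes>\<^bsub>K\<^esub> x) w \<one>\<^bsub>K\<^esub>"

lemma word_val_simps [simp]:
  "word_val K f [] = \<one>\<^bsub>K\<^esub>"
  "word_val K f ((s, True) # w) = f s \<otimes>\<^bsub>K\<^esub> word_val K f w"
  "word_val K f ((s, False) # w) = inv\<^bsub>K\<^esub> f s \<otimes>\<^bsub>K\<^esub> word_val K f w"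
  by (simp_all add: word_val_def)

context group begin

lemma word_val_closed:
  assumes "f \<in> S \<rightarrow> carrier G" "w \<in> words S"
  shows "word_val G f w \<in> carrier G"
  using assms(2)
proof (induction w)
  case (Cons a w)
  then show ?case using assms(1) by (cases a; cases "snd a") auto
qed simp

lemma word_val_append:
  assumes "f \<in> S \<rightarrow> carrier G" "v \<in> words S" "w \<in> words S"
  shows "word_val G f (v @ w) = word_val G f v \<otimes> word_val G f w"
  using assms(2)
proof (induction v)
  case Nil
  then show ?case using word_val_closed[OF assms(1,3)] by simp
next
  case (Cons a v)
  obtain s b where a: "a = (s, b)" by (cases a)
  have "f s \<in> carrier G" using Cons a assms(1) by auto
  then show ?case
    using Cons a word_val_closed[OF assms(1,3)] word_val_closed[OF assms(1), of v]
    by (cases b) (auto simp: m_assoc)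
qed

lemma word_val_pres_eq:
  assumes f: "f \<in> S \<rightarrow> carrier G"
    and R: "\<And>r. r \<in> R \<Longrightarrow> r \<in> words S \<Longrightarrow> word_val G f r = \<one>"
    and eq: "pres_eq S R v w"
  shows "word_val G f v = word_val G f w"
  using eq
proof (induction rule: pres_eq.induct)
  case (cancel u v s b)
  have s: "f s \<in> carrier G" using f cancel by auto
  have w: "[(s, b), (s, \<not> b)] \<in> words S" using cancel by auto
  have "word_val G f [(s, b), (s, \<not> b)] = \<one>" using s by (cases b) auto
  then show ?case
    using cancel w word_val_closed[OF f, of u] word_val_closed[OF f, of v]
    by (subst word_val_append[OF f], simp, simp, subst word_val_append[OF f])
       (auto simp: word_val_append[OF f])
next
  case (relator u v r)
  then show ?case
    using R[OF relator(3,4)] word_val_closed[OF f, of u] word_val_closed[OF f, of v]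
    by (simp add: word_val_append[OF f])
qed auto

text \<open>Von Dyck's theorem. The homomorphism evaluates a chosen representative of a class, and
  \<open>word_val_pres_eq\<close> makes the choice immaterial.\<close>

lemma presented_group_hom:
  assumes f: "f \<in> S \<rightarrow> carrier G"
    and R: "\<And>r. r \<in> R \<Longrightarrow> r \<in> words S \<Longrightarrow> word_val G f r = \<one>"
  obtains h where "h \<in> hom (presented_group S R) G"
    and "\<And>w. w \<in> words S \<Longrightarrow> h (pres_class S R w) = word_val G f w"
proof -
  define h where "h X = word_val G f (SOME w. w \<in> X)" for X
  have h: "h (pres_class S R w) = word_val G f w" if "w \<in> words S" for w
  proof -
    have "w \<in> pres_class S R w" using that by (auto simp: pres_class_def intro: pres_eq.refl)
    then have "(SOME v. v \<in> pres_class S R w) \<in> pres_class S R w" by (rule someI)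
    then show ?thesis
      using word_val_pres_eq[OF f R] by (simp add: h_def pres_class_def)
  qed
  moreover have "h \<in> hom (presented_group S R) G"
  proof (rule homI)
    fix X assume "X \<in> carrier (presented_group S R)"
    then obtain w where "w \<in> words S" "X = pres_class S R w"
      by (auto simp: presented_group_def)
    then show "h X \<in> carrier G"
      using h word_val_closed[OF f] by simp
  next
    fix X Y assume "X \<in> carrier (presented_group S R)" "Y \<in> carrier (presented_group S R)"
    then obtain v w where "v \<in> words S" "w \<in> words S"
      "X = pres_class S R v" "Y = pres_class S R w"
      by (auto simp: presented_group_def)
    then show "h (X \<otimes>\<^bsub>presented_group S R\<^esub> Y) = h X \<otimes> h Y"
      using h[of "v @ w"] h[of v] h[of w] by (auto simp: presented_group_mult word_val_append[OF f])
  qed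
  ultimately show ?thesis by (rule that[rotated])
qed

end

lemma pres_class_carrier: "w \<in> words S \<Longrightarrow> pres_class S R w \<in> carrier (presented_group S R)"
  by (simp add: presented_group_def)

lemma pres_class_Nil: "pres_class S R [] = \<one>\<^bsub>presented_group S R\<^esub>"
  by (simp add: presented_group_def)

lemma pres_class_inv:
  assumes "s \<in> S"
  shows "pres_class S R [(s, False)] = inv\<^bsub>presented_group S R\<^esub> pres_class S R [(s, True)]"
proof -
  interpret P: group "presented_group S R" by (rule group_presented_group)
  have "pres_class S R [(s, False)] \<otimes>\<^bsub>presented_group S R\<^esub> pres_class S R [(s, True)]
    = pres_class S R [(s, False), (s, True)]"
    using assms by (subst presented_group_mult) auto
  also have "\<dots> = \<one>\<^bsub>presented_group S R\<^esub>"
    using assms pres_eq.cancel[of "[]" S "[]" s R False]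
    by (subst pres_class_Nil[symmetric], subst pres_class_eq_iff) auto
  finally show ?thesis
    using assms by (intro P.inv_equality[symmetric]) (auto intro: pres_class_carrier)
qed

lemma hom_presented_group:
  assumes "group K" "h \<in> hom (presented_group S R) K" "w \<in> words S"
  shows "h (pres_class S R w) = word_val K (\<lambda>s. h (pres_class S R [(s, True)])) w"
  using assms(3)
proof (induction w)
  case Nil
  interpret group_hom "presented_group S R" K h
    using assms by (auto simp: group_hom_def group_hom_axioms_def group_presented_group)
  show ?case using hom_one by (simp add: pres_class_Nil)
next
  case (Cons a w)
  interpret group_hom "presented_group S R" K h
    using assms by (auto simp: group_hom_def group_hom_axioms_def group_presented_group)
  obtain s b where a: "a = (s, b)" by (cases a)
  then have s: "s \<in> S" using Cons by auto
  have "pres_class S R (a # w) = pres_class S R [a] \<otimes>\<^bsub>presented_group S R\<^esub> pres_class S R w"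
    using Cons by (subst presented_group_mult) auto
  then have "h (pres_class S R (a # w)) = h (pres_class S R [a]) \<otimes>\<^bsub>K\<^esub> h (pres_class S R w)"
    using Cons by (auto simp: pres_class_carrier intro!: hom_mult)
  then show ?case
    using Cons a s by (cases b) (auto simp: pres_class_inv pres_class_carrier)
qed

lemma relator_eq_one:
  assumes "r \<in> R" "r \<in> words S"
  shows "pres_class S R r = \<one>\<^bsub>presented_group S R\<^esub>"
  using assms pres_eq.relator[of "[]" S "[]" r R]
  by (subst pres_class_Nil[symmetric], subst pres_class_eq_iff) auto

text \<open>Bijections of a whole type suffice for both uses. The Tits representation permutes
  \<open>'s \<Rightarrow> real\<close>, leaving the values outside \<open>S\<close> untouched, and
  the vertex groups will permute \<open>'g \<times> nat\<close>.\<close>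

definition sym_group :: "('x \<Rightarrow> 'x) monoid" where
  "sym_group = \<lparr>carrier = {f. bij f}, monoid.mult = (\<circ>), one = id\<rparr>"

lemma sym_group_simps [simp]:
  "f \<in> carrier sym_group \<longleftrightarrow> bij f"
  "f \<otimes>\<^bsub>sym_group\<^esub> g = f \<circ> g"
  "\<one>\<^bsub>sym_group\<^esub> = id"
  by (simp_all add: sym_group_def)

lemma group_sym_group: "group (sym_group :: ('x \<Rightarrow> 'x) monoid)"
proof (rule groupI)
  fix f :: "'x \<Rightarrow> 'x" assume f: "f \<in> carrier sym_group"
  then show "\<exists>g\<in>carrier sym_group. g \<otimes>\<^bsub>sym_group\<^esub> f = \<one>\<^bsub>sym_group\<^esub>"
    by (intro bexI[of _ "inv_into UNIV f"]) (auto simp: bij_imp_bij_inv bij_is_inj)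
qed (auto simp: bij_comp comp_assoc)

lemma inv_sym_group: "bij f \<Longrightarrow> inv\<^bsub>sym_group\<^esub> f = inv_into UNIV f"
  by (rule group.inv_equality[OF group_sym_group]) (auto simp: bij_imp_bij_inv bij_is_inj)

section \<open>Integral spans of cosines\<close>

definition int_span :: "real set \<Rightarrow> real set" where
  "int_span B = range (\<lambda>a. \<Sum>b\<in>B. of_int (a b) * b)"

lemma int_spanI: "x = (\<Sum>b\<in>B. of_int (a b) * b) \<Longrightarrow> x \<in> int_span B"
  by (simp add: int_span_def)

lemma int_span_zero: "0 \<in> int_span B"
  by (rule int_spanI[where a = "\<lambda>_. 0"]) simp

lemma int_span_add:
  assumes "x \<in> int_span B" "y \<in> int_span B"
  shows "x + y \<in> int_span B"
proof -
  obtain a b where "x = (\<Sum>c\<in>B. of_int (a c) * c)" "y = (\<Sum>c\<in>B. of_int (b c) * c)"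
    using assms unfolding int_span_def by blast
  then have "x + y = (\<Sum>c\<in>B. of_int (a c + b c) * c)"
    by (simp add: sum.distrib algebra_simps)
  then show ?thesis by (rule int_spanI)
qed

lemma int_span_mult_int:
  assumes "x \<in> int_span B"
  shows "of_int n * x \<in> int_span B"
proof -
  obtain a where "x = (\<Sum>c\<in>B. of_int (a c) * c)" using assms unfolding int_span_def by blast
  then have "of_int n * x = (\<Sum>c\<in>B. of_int (n * a c) * c)"
    by (simp add: sum_distrib_left mult.assoc)
  then show ?thesis by (rule int_spanI)
qed

lemma int_span_base:
  assumes "finite B" "x \<in> B"
  shows "x \<in> int_span B"
proof -
  have "x = (\<Sum>b\<in>B. of_int (if b = x then 1 else 0) * b)"
    using assms by (simp add: if_distrib[of of_int] if_distrib[of "\<lambda>c. c * _"] cong: if_cong)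
  then show ?thesis by (rule int_spanI)
qed

lemma int_span_sum:
  assumes "\<And>i. i \<in> I \<Longrightarrow> f i \<in> int_span B"
  shows "sum f I \<in> int_span B"
  using assms by (induction I rule: infinite_finite_induct) (auto intro: int_span_zero int_span_add)

lemma int_span_mult:
  assumes "\<And>b. b \<in> B \<Longrightarrow> c * b \<in> int_span B" "x \<in> int_span B"
  shows "c * x \<in> int_span B"
proof -
  obtain a where "x = (\<Sum>b\<in>B. of_int (a b) * b)" using assms(2) unfolding int_span_def by blast
  then have "c * x = (\<Sum>b\<in>B. of_int (a b) * (c * b))"
    by (simp add: sum_distrib_left algebra_simps)
  then show ?thesis using assms(1) by (auto intro: int_span_sum int_span_mult_int)
qed

lemma int_span_residues:
  assumes "finite B" "n > 0"
  obtains F where "finite F"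
    "\<And>x. x \<in> int_span B \<Longrightarrow> \<exists>y\<in>F. \<exists>z\<in>int_span B. x = y + of_int n * z"
proof
  let ?F = "(\<lambda>a. \<Sum>b\<in>B. of_int (a b) * b) ` (B \<rightarrow>\<^sub>E {0..<n})"
  show "finite ?F" using assms(1) by (intro finite_imageI finite_PiE) auto
  fix x assume "x \<in> int_span B"
  then obtain a where x: "x = (\<Sum>b\<in>B. of_int (a b) * b)" unfolding int_span_def by blast
  have "x = (\<Sum>b\<in>B. of_int (a b mod n) * b) + of_int n * (\<Sum>b\<in>B. of_int (a b div n) * b)"
    unfolding x sum_distrib_left sum.distrib[symmetric]
  proof (rule sum.cong[OF HOL.refl])
    fix b :: real
    have "(of_int (a b) :: real) = of_int (a b mod n + n * (a b div n))" by simp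
    then show "of_int (a b) * b = of_int (a b mod n) * b + of_int n * (of_int (a b div n) * b)"
      by (simp only: of_int_add of_int_mult) (simp add: algebra_simps)
  qed
  moreover have "(\<Sum>b\<in>B. of_int (a b mod n) * b) \<in> ?F"
  proof (rule image_eqI)
    show "(\<Sum>b\<in>B. of_int (a b mod n) * b) = (\<Sum>b\<in>B. of_int ((\<lambda>b\<in>B. a b mod n) b) * b)"
      by (intro sum.cong) auto
    show "(\<lambda>b\<in>B. a b mod n) \<in> B \<rightarrow>\<^sub>E {0..<n}" using assms(2) by auto
  qed
  moreover have "(\<Sum>b\<in>B. of_int (a b div n) * b) \<in> int_span B"
    by (rule int_spanI[OF HOL.refl])
  ultimately show "\<exists>y\<in>?F. \<exists>z\<in>int_span B. x = y + of_int n * z" by blast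
qed

text \<open>The reals form a vector space over the rationals in which \<open>{y}\<close> is
  independent, so the assignment of 1 to y extends linearly.\<close>

lemma rat_functional:
  fixes y :: real
  assumes "y \<noteq> 0"
  obtains f :: "real \<Rightarrow> rat" where "f y = 1" "\<And>a b. f (a + b) = f a + f b"
proof -
  interpret V: vector_space_pair "\<lambda>(q::rat) (x::real). of_rat q * x" "(*) :: rat \<Rightarrow> rat \<Rightarrow> rat"
    by unfold_locales (auto simp: algebra_simps of_rat_add of_rat_mult)
  have "V.vs1.independent {y}" using assms by (simp add: V.vs1.dependent_single)
  from V.linear_independent_extend[OF this, of "\<lambda>_. 1"]
  obtain g where g: "Vector_Spaces.linear (\<lambda>(q::rat) (x::real). of_rat q * x) (*) g" "g y = 1" by auto
  then show ?thesis
    using that[of g] V.linear_add[OF g(1)] by blast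
qed

text \<open>A rational functional f with f y = 1 takes values with a common denominator D on the
  finitely generated span. If y were divisible by every power of 3 there, D would be a multiple of
  every power of 3.\<close>

lemma int_span_separated:
  assumes B: "finite B" and y: "\<And>k. \<exists>z\<in>int_span B. y = 3 ^ k * z"
  shows "y = 0"
proof (rule ccontr)
  assume "y \<noteq> 0"
  then obtain f :: "real \<Rightarrow> rat" where f: "f y = 1" and add: "\<And>a b. f (a + b) = f a + f b"
    using rat_functional by blast
  have f0: "f 0 = 0" using add[of 0 0] by simp
  have fnat: "f (of_nat n * x) = of_nat n * f x" for n x
    by (induction n) (auto simp: f0 add algebra_simps)
  have fneg: "f (- x) = - f x" for x using add[of x "- x"] f0 by (simp add: eq_neg_iff_add_eq_0 add.commute)
  have fint: "f (of_int n * x) = of_int n * f x" for n x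
  proof (cases "n \<ge> 0")
    case True
    then show ?thesis using fnat[of "nat n" x] by simp
  next
    case False
    then have "f (of_int (- n) * x) = of_int (- n) * f x" using fnat[of "nat (- n)" x] by simp
    then show ?thesis using fneg[of "of_int n * x"] by simp
  qed
  have fsum: "f (sum g I) = (\<Sum>i\<in>I. f (g i))" for g :: "real \<Rightarrow> real" and I
    by (induction I rule: infinite_finite_induct) (auto simp: f0 add)
  define D where "D = (\<Prod>b\<in>B. snd (quotient_of (f b)))"
  have Dpos: "D > 0" unfolding D_def by (intro prod_pos) (auto intro: quotient_of_denom_pos')
  have Db: "of_int D * f b \<in> \<int>" if b: "b \<in> B" for b
  proof -
    obtain e where e: "D = snd (quotient_of (f b)) * e"
      using dvd_prodI[OF B b, of "\<lambda>b. snd (quotient_of (f b))"] by (auto simp: D_def)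
    have "f b = of_int (fst (quotient_of (f b))) / of_int (snd (quotient_of (f b)))"
      by (simp add: quotient_of_div)
    moreover have "(of_int (snd (quotient_of (f b))) :: rat) \<noteq> 0"
      using quotient_of_denom_pos'[of "f b"] by simp
    ultimately have "of_int D * f b = of_int (e * fst (quotient_of (f b)))"
      unfolding e by (simp add: field_simps)
    then show ?thesis by (metis Ints_of_int)
  qed
  have Dz: "of_int D * f z \<in> \<int>" if z: "z \<in> int_span B" for z
  proof -
    obtain a where "z = (\<Sum>b\<in>B. of_int (a b) * b)" using z unfolding int_span_def by blast
    then have "of_int D * f z = (\<Sum>b\<in>B. of_int (a b) * (of_int D * f b))"
      by (simp only: fsum fint sum_distrib_left) (simp add: mult.left_commute)
    then show ?thesis using Db by (simp only:) (rule Ints_sum, rule Ints_mult[OF Ints_of_int], blast)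
  qed
  \<comment> \<open>Since k < 2^k \<le> 3^k, this power of 3 exceeds D and cannot divide it.\<close>
  define k where "k = nat D"
  have "k < 2 ^ k" by (rule less_exp)
  also have "(2::nat) ^ k \<le> 3 ^ k" by (rule power_mono) auto
  finally have "int k < int (3 ^ k)" by (simp only: of_nat_less_iff)
  then have k: "D < 3 ^ k" using Dpos by (simp add: k_def)
  obtain z where z: "z \<in> int_span B" "y = 3 ^ k * z" using y by blast
  obtain c where c: "of_int D * f z = of_int c" using Dz[OF z(1)] by (auto elim: Ints_cases)
  have 1: "of_int (3 ^ k) * f z = 1" using f z fint[of "3 ^ k" z] by simp
  have "of_int (3 ^ k) * (of_int D * f z) = of_int D * (of_int (3 ^ k) * f z)"
    by (rule mult.left_commute)
  then have "of_int D = of_int (3 ^ k) * (of_int D * f z)" unfolding 1 by simp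
  then have "(of_int D :: rat) = of_int (3 ^ k * c)" using c by simp
  then have "D = 3 ^ k * c" by (simp only: of_int_eq_iff)
  then have "3 ^ k dvd D" by simp
  then show False using k Dpos zdvd_imp_le by force
qed

lemma finite_image_factor:
  assumes "finite (key ` A)" "\<And>x y. x \<in> A \<Longrightarrow> y \<in> A \<Longrightarrow> key x = key y \<Longrightarrow> f x = f y"
  shows "finite (f ` A)"
proof -
  have "f ` A \<subseteq> (\<lambda>k. f (SOME x. x \<in> A \<and> key x = k)) ` key ` A"
  proof
    fix z assume "z \<in> f ` A"
    then obtain x where x: "x \<in> A" "z = f x" by blast
    define x' where "x' = (SOME x'. x' \<in> A \<and> key x' = key x)"
    have "x' \<in> A \<and> key x' = key x" unfolding x'_def by (rule someI[of _ x]) (simp add: x)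
    then have "z = f x'" using assms(2)[of x x'] x by simp
    then show "z \<in> (\<lambda>k. f (SOME x. x \<in> A \<and> key x = k)) ` key ` A"
      unfolding x'_def using x by blast
  qed
  then show ?thesis using assms(1) finite_subset by blast
qed

text \<open>The identity 2 cos a cos b = cos (a + b) + cos (a - b) makes the span stable under
  multiplication by the entries of \<open>cmat\<close>. Taking the cosines rather than their doubles
  keeps 1 = cos 0 in the span, which \<open>congruence_separates\<close> relies on.\<close>

definition cosines :: "nat \<Rightarrow> real set" where
  "cosines N = range (\<lambda>k::int. cos (of_int k * pi / real N))"

lemma finite_cosines:
  assumes "N > 0"
  shows "finite (cosines N)"
proof -
  have "cosines N
    \<subseteq> (\<lambda>k::int. cos (of_int k * pi / real N)) ` {0..<2 * int N}"
  proof
    fix x assume "x \<in> cosines N"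
    then obtain k :: int where k: "x = cos (of_int k * pi / real N)"
      unfolding cosines_def by blast
    let ?q = "k div (2 * int N)" and ?r = "k mod (2 * int N)"
    have "(of_int k :: real) = of_int (?r + 2 * int N * ?q)" by simp
    also have "\<dots> = of_int ?r + 2 * real N * of_int ?q" by (simp only: of_int_add of_int_mult of_int_of_nat_eq of_int_numeral)
    finally have "of_int k * pi / real N = of_int ?r * pi / real N + of_int ?q * (2 * pi)"
      using assms by (simp add: field_simps)
    then have "x = cos (of_int ?r * pi / real N)"
      unfolding k by (simp add: cos_add mult.commute[of _ "2 * pi"])
    moreover have "?r \<in> {0..<2 * int N}" using assms by simp
    ultimately show "x \<in> (\<lambda>k::int. cos (of_int k * pi / real N)) ` {0..<2 * int N}" by blast
  qed
  then show ?thesis using finite_subset by blast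
qed

lemma cosines_mult:
  fixes j :: int
  assumes N: "N > 0" and x: "x \<in> int_span (cosines N)"
  shows "2 * cos (of_int j * pi / real N) * x \<in> int_span (cosines N)"
proof (rule int_span_mult[OF _ x])
  fix b assume "b \<in> cosines N"
  then obtain k :: int where k: "b = cos (of_int k * pi / real N)"
    unfolding cosines_def by blast
  have "2 * cos (of_int j * pi / real N) * b
    = cos (of_int (j + k) * pi / real N) + cos (of_int (j - k) * pi / real N)"
    unfolding k using cos_times_cos[of "of_int j * pi / real N" "of_int k * pi / real N"]
    by (simp add: add_divide_distrib diff_divide_distrib algebra_simps)
  then show "2 * cos (of_int j * pi / real N) * b \<in> int_span (cosines N)"
    using finite_cosines[OF N] unfolding cosines_def
    by (simp only:) (intro int_span_add int_span_base rangeI)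
qed

section \<open>The Tits representation\<close>

fun alt :: "'s \<Rightarrow> 's \<Rightarrow> nat \<Rightarrow> 's list" where
  "alt s t 0 = []"
| "alt s t (Suc k) = s # alt t s k"

lemma length_alt [simp]: "length (alt s t k) = k"
  by (induction k arbitrary: s t) auto

lemma set_alt: "set (alt s t k) \<subseteq> {s, t}"
  by (induction k arbitrary: s t) auto

lemma take_alt: "j \<le> k \<Longrightarrow> take j (alt s t k) = alt s t j"
proof (induction k arbitrary: s t j)
  case (Suc k)
  then show ?case by (cases j) auto
qed simp

lemma alt_snoc: "alt s t (2 * k) @ [s] = alt s t (Suc (2 * k))"
  by (induction k) auto

text \<open>This turns the relator (s t)^k into the braid relation of
  \<open>cls_braid\<close>.\<close>

lemma alt_rev_alt: "alt s t k @ rev (alt t s k) = alt s t (2 * k)"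
proof (induction k arbitrary: s t)
  case (Suc k)
  have "alt s t (Suc k) @ rev (alt t s (Suc k)) = s # alt t s (2 * k) @ [t]"
    using Suc[of t s] by simp
  then show ?case using alt_snoc[of t s k] by simp
qed simp

lemma two_letter_word:
  assumes "u \<in> lists {s, t}"
  shows "u = alt s t (length u) \<or> u = alt t s (length u) \<or> (\<exists>x a y. u = x @ [a, a] @ y)"
  using assms
proof (induction u)
  case (Cons a u)
  then consider "u = alt s t (length u)" | "u = alt t s (length u)"
    | x b y where "u = x @ [b, b] @ y" by auto
  then show ?case
  proof cases
    case 3
    then have "a # u = (a # x) @ [b, b] @ y" by simp
    then show ?thesis by blast
  next
    case 1
    show ?thesis
    proof (cases "a = s \<and> u \<noteq> []")
      case True
      then obtain w where "u = s # w" using 1 by (cases u) auto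
      then have "a # u = [] @ [s, s] @ w" using True by simp
      then show ?thesis by blast
    next
      case False
      then show ?thesis using 1 Cons by (cases u) auto
    qed
  next
    case 2
    show ?thesis
    proof (cases "a = t \<and> u \<noteq> []")
      case True
      then obtain w where "u = t # w" using 2 by (cases u) auto
      then have "a # u = [] @ [t, t] @ w" using True by simp
      then show ?thesis by blast
    next
      case False
      then show ?thesis using 2 Cons by (cases u) auto
    qed
  qed
qed simp

text \<open>Chebyshev polynomials of the second kind: \<open>cheb c k\<close> is U of index k - 1 at
  c / 2. They are the matrix entries of alternating words in the geometric representation of a
  dihedral group; c = 2 belongs to an infinite entry of the Coxeter matrix.\<close>

fun cheb :: "real \<Rightarrow> nat \<Rightarrow> real" where
  "cheb c 0 = 0"
| "cheb c (Suc 0) = 1"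
| "cheb c (Suc (Suc k)) = c * cheb c (Suc k) - cheb c k"

lemma cheb_sin: "cheb (2 * cos x) k * sin x = sin (real k * x)"
proof (induction "2 * cos x" k rule: cheb.induct)
  case (3 k)
  have "sin (real (Suc (Suc k)) * x) = 2 * cos x * sin (real (Suc k) * x) - sin (real k * x)"
    using sin_add[of "real (Suc k) * x" x] sin_diff[of "real (Suc k) * x" x]
    by (simp add: algebra_simps)
  then show ?case using 3 by (simp add: algebra_simps)
qed auto

lemma cheb_2: "cheb 2 k = real k"
  by (induction "2::real" k rule: cheb.induct) auto

locale coxeter =
  fixes S :: "'s set" and m :: "'s \<Rightarrow> 's \<Rightarrow> enat"
  assumes coxeter_matrix: "coxeter_matrix S m"
begin

text \<open>\<open>cmat s t\<close> is \<open>- 2 B(\<alpha>\<^sub>s, \<alpha>\<^sub>t)\<close> for the Tits form \<open>B\<close>, and \<open>act\<close> is the dual of the geometric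
  representation: \<open>acts u \<phi> s > 0\<close> for all positive \<open>\<phi>\<close> says that the root \<open>u\<^sup>-\<^sup>1 \<alpha>\<^sub>s\<close> is positive.\<close>

definition cmat :: "'s \<Rightarrow> 's \<Rightarrow> real" where
  "cmat s t = (case m s t of enat k \<Rightarrow> 2 * cos (pi / real k) | \<infinity> \<Rightarrow> 2)"

lemma m_eq_1: "s \<in> S \<Longrightarrow> t \<in> S \<Longrightarrow> m s t = enat 1 \<longleftrightarrow> s = t"
  using coxeter_matrix unfolding coxeter_matrix_def one_enat_def by blast

lemma cmat_diag: "s \<in> S \<Longrightarrow> cmat s s = - 2"
  using m_eq_1[of s s] by (simp add: cmat_def)

lemma cmat_sym: "s \<in> S \<Longrightarrow> t \<in> S \<Longrightarrow> cmat s t = cmat t s"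
  using coxeter_matrix by (simp add: coxeter_matrix_def cmat_def)

lemma m_ge_2: "s \<in> S \<Longrightarrow> t \<in> S \<Longrightarrow> s \<noteq> t \<Longrightarrow> m s t = enat k \<Longrightarrow> 2 \<le> k"
proof -
  assume st: "s \<in> S" "t \<in> S" "s \<noteq> t" "m s t = enat k"
  then have "1 \<le> m s t" using coxeter_matrix unfolding coxeter_matrix_def by blast
  then have "1 \<le> k" using st by (simp add: one_enat_def)
  moreover have "k \<noteq> 1" using m_eq_1[OF st(1,2)] st by auto
  ultimately show "2 \<le> k" by simp
qed

definition act :: "'s \<Rightarrow> ('s \<Rightarrow> real) \<Rightarrow> 's \<Rightarrow> real" where
  "act s \<phi> = (\<lambda>t. if t \<in> S then \<phi> t + cmat s t * \<phi> s else \<phi> t)"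

definition acts :: "'s list \<Rightarrow> ('s \<Rightarrow> real) \<Rightarrow> 's \<Rightarrow> real" where
  "acts u = foldr act u"

lemma acts_simps [simp]: "acts [] = id" "acts (s # u) \<phi> = act s (acts u \<phi>)"
  "acts (u @ v) \<phi> = acts u (acts v \<phi>)"
  by (auto simp: acts_def)

lemma act_act: "s \<in> S \<Longrightarrow> act s (act s \<phi>) = \<phi>"
  by (rule ext) (simp add: act_def cmat_diag)

lemma act_same: "s \<in> S \<Longrightarrow> act s \<phi> s = - \<phi> s"
  by (simp add: act_def cmat_diag)

text \<open>The outermost letter t adds \<open>cmat s t\<close> times the t-coordinate to the
  s-coordinate, and the letter s below it has changed the sign of the s-coordinate. The resulting
  three-term recursion is that of \<open>cheb\<close>. The parity of k decides which coordinate gets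
  the coefficient of higher index.\<close>

lemma acts_alt:
  assumes "s \<in> S" "t \<in> S" "s \<noteq> t"
  shows "acts (alt t s k) \<phi> s =
    (if even k then cheb (cmat s t) (Suc k) * \<phi> s + cheb (cmat s t) k * \<phi> t
     else cheb (cmat s t) (Suc k) * \<phi> t + cheb (cmat s t) k * \<phi> s)"
  using assms
proof (induction k arbitrary: s t rule: less_induct)
  case (less k)
  consider "k = 0" | "k = 1" | j where "k = Suc (Suc j)" by (metis One_nat_def not0_implies_Suc)
  then show ?case
  proof cases
    case 1
    then show ?thesis by simp
  next
    case 2
    then show ?thesis using less.prems by (simp add: act_def cmat_sym)
  next
    case 3
    have 1: "acts (alt t s k) \<phi> s = cmat s t * acts (alt s t (Suc j)) \<phi> t - acts (alt t s j) \<phi> s"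
      using less.prems 3 by (simp add: act_def cmat_sym cmat_diag)
    have 2: "acts (alt s t (Suc j)) \<phi> t =
      (if odd j then cheb (cmat s t) k * \<phi> t + cheb (cmat s t) (Suc j) * \<phi> s
       else cheb (cmat s t) k * \<phi> s + cheb (cmat s t) (Suc j) * \<phi> t)"
      using less.IH[of "Suc j" t s] less.prems 3 by (simp add: cmat_sym[of t s] del: alt.simps cheb.simps)
    have 4: "cheb (cmat s t) (Suc k) = cmat s t * cheb (cmat s t) k - cheb (cmat s t) (Suc j)"
      "cheb (cmat s t) k = cmat s t * cheb (cmat s t) (Suc j) - cheb (cmat s t) j"
      by (simp_all add: 3)
    have "even k = even j" and jk: "j < k" by (simp_all add: 3)
    then show ?thesis
      unfolding 1 2 4(1) using less.IH[of j s t] less.prems jk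
      by (cases "even j") (simp_all add: 4(2) algebra_simps del: alt.simps cheb.simps)
  qed
qed

text \<open>Each letter only adds a multiple of its own row of \<open>cmat\<close>. A dihedral word
  is thus controlled by its effect on the coordinates s and t, as long as the 2 by 2 block of
  \<open>cmat\<close> is nonsingular.\<close>

lemma acts_dihedral_span:
  assumes "u \<in> lists {s, t}" "s \<in> S" "t \<in> S"
  obtains a b where "\<And>r. acts u \<phi> r = (if r \<in> S then \<phi> r + cmat s r * a + cmat t r * b else \<phi> r)"
proof -
  have "\<exists>a b. \<forall>r. acts u \<phi> r = (if r \<in> S then \<phi> r + cmat s r * a + cmat t r * b else \<phi> r)"
    using assms(1)
  proof (induction u)
    case Nil
    show ?case by (intro exI[of _ 0]) auto
  next
    case (Cons x u)
    then obtain a b where ab: "\<And>r. acts u \<phi> r =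
      (if r \<in> S then \<phi> r + cmat s r * a + cmat t r * b else \<phi> r)" by auto
    have "x = s \<or> x = t" using Cons by auto
    then show ?case
    proof
      assume x: "x = s"
      show ?thesis
        by (intro exI[of _ "a + acts u \<phi> s"] exI[of _ b]) (auto simp: act_def x ab algebra_simps)
    next
      assume x: "x = t"
      show ?thesis
        by (intro exI[of _ a] exI[of _ "b + acts u \<phi> t"]) (auto simp: act_def x ab algebra_simps)
    qed
  qed
  then show ?thesis using that by blast
qed

text \<open>For distinct s and t let \<theta> = \<pi> / k. The coefficients are sin (j \<theta>) /
  sin \<theta>, so the word of length 2 k fixes the coordinates s and t. The shift (a, b) provided
  by \<open>acts_dihedral_span\<close> then satisfies a = b cos \<theta> and b = a cos \<theta>, and
  it vanishes because cos \<theta> is not 1 or -1.\<close>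

lemma acts_relator:
  assumes st: "s \<in> S" "t \<in> S" and k: "m s t = enat k"
  shows "acts (alt s t (2 * k)) \<phi> = \<phi>"
proof (cases "s = t")
  case True
  then have "k = 1" using m_eq_1[of s t] st k by simp
  then show ?thesis using True st by (simp add: numeral_2_eq_2 act_act)
next
  case False
  define \<theta> where "\<theta> = pi / real k"
  have k2: "2 \<le> k" using m_ge_2[OF st False k] .
  have c: "cmat s t = 2 * cos \<theta>" by (simp add: cmat_def k \<theta>_def)
  have sin: "sin \<theta> > 0"
  proof (rule sin_gt_zero)
    show "0 < \<theta>" using k2 by (simp add: \<theta>_def)
    show "\<theta> < pi" using k2 by (simp add: \<theta>_def divide_less_eq)
  qed
  have k\<theta>: "real k * \<theta> = pi" using k2 by (simp add: \<theta>_def)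
  have U0: "cheb (cmat s t) (2 * k) = 0"
  proof -
    have "cheb (cmat s t) (2 * k) * sin \<theta> = sin (2 * (real k * \<theta>))"
      unfolding c cheb_sin by (simp add: algebra_simps)
    then show ?thesis using sin by (simp add: k\<theta>)
  qed
  have U1: "cheb (cmat s t) (Suc (2 * k)) = 1"
  proof -
    have "cheb (cmat s t) (Suc (2 * k)) * sin \<theta> = sin (\<theta> + 2 * (real k * \<theta>))"
      unfolding c cheb_sin by (simp add: algebra_simps)
    also have "\<dots> = sin \<theta>" by (simp add: k\<theta>)
    finally show ?thesis using sin by simp
  qed
  have Um: "cheb (cmat s t) (2 * k - 1) = - 1"
  proof -
    have "Suc (2 * k) = Suc (Suc (2 * k - 1))" "Suc (2 * k - 1) = 2 * k" using k2 by auto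
    then have "cheb (cmat s t) (Suc (2 * k)) = cmat s t * cheb (cmat s t) (2 * k) - cheb (cmat s t) (2 * k - 1)"
      using cheb.simps(3)[of "cmat s t" "2 * k - 1"] by simp
    then show ?thesis using U0 U1 by simp
  qed
  have t: "acts (alt s t (2 * k)) \<phi> t = \<phi> t"
    using acts_alt[of t s "2 * k" \<phi>] st False U0 U1 by (simp add: cmat_sym[of t s])
  have s: "acts (alt s t (2 * k)) \<phi> s = \<phi> s"
  proof -
    have "alt s t (2 * k) = s # alt t s (2 * k - 1)" using k2 by (cases k) auto
    then have "acts (alt s t (2 * k)) \<phi> s = - acts (alt t s (2 * k - 1)) \<phi> s"
      using st by (simp add: act_same)
    also have "\<dots> = - (cheb (cmat s t) (Suc (2 * k - 1)) * \<phi> t + cheb (cmat s t) (2 * k - 1) * \<phi> s)"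
      using acts_alt[of s t "2 * k - 1" \<phi>] st False k2 by (simp del: cheb.simps)
    also have "\<dots> = \<phi> s"
      using U0 Um k2 by (simp del: cheb.simps)
    finally show ?thesis .
  qed
  have "alt s t (2 * k) \<in> lists {s, t}" using set_alt[of s t "2 * k"] by auto
  then obtain a b where ab: "\<And>r. acts (alt s t (2 * k)) \<phi> r =
      (if r \<in> S then \<phi> r + cmat s r * a + cmat t r * b else \<phi> r)"
    using acts_dihedral_span st by metis
  have 1: "a = cos \<theta> * b"
    using ab[of s] s st by (simp add: cmat_diag cmat_sym[of t s] c)
  have 2: "b = cos \<theta> * a"
    using ab[of t] t st by (simp add: cmat_diag c)
  have "a * (1 - cos \<theta> * cos \<theta>) = a - cos \<theta> * (cos \<theta> * a)"
    "b * (1 - cos \<theta> * cos \<theta>) = b - cos \<theta> * (cos \<theta> * b)"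
    by (simp_all add: algebra_simps)
  then have "a * (1 - cos \<theta> * cos \<theta>) = 0" "b * (1 - cos \<theta> * cos \<theta>) = 0"
    unfolding 1[symmetric] 2[symmetric] by simp_all
  moreover have "1 - cos \<theta> * cos \<theta> \<noteq> 0"
    using sin sin_cos_squared_add[of \<theta>] by (auto simp: power2_eq_square)
  ultimately have "a = 0" "b = 0" unfolding mult_eq_0_iff by simp_all
  then show ?thesis using ab by auto
qed

section \<open>The Coxeter group as a quotient of words in involutions\<close>

abbreviation P where "P \<equiv> presented_group S (coxeter_relators S m)"

sublocale P: group P
  by (rule group_presented_group)

definition cls :: "'s list \<Rightarrow> 's word set" where
  "cls u = pres_class S (coxeter_relators S m) (map (\<lambda>s. (s, True)) u)"

lemma cls_closed [simp]: "u \<in> lists S \<Longrightarrow> cls u \<in> carrier P"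
  unfolding cls_def by (rule pres_class_carrier) auto

lemma cls_append: "u \<in> lists S \<Longrightarrow> v \<in> lists S \<Longrightarrow> cls (u @ v) = cls u \<otimes>\<^bsub>P\<^esub> cls v"
  unfolding cls_def by (subst presented_group_mult) auto

lemma cls_Nil: "cls [] = \<one>\<^bsub>P\<^esub>"
  by (simp add: cls_def pres_class_Nil)

lemma cls_relator:
  assumes "s \<in> S" "t \<in> S" "m s t = enat k"
  shows "cls (alt s t (2 * k)) = \<one>\<^bsub>P\<^esub>"
proof -
  have "map (\<lambda>s. (s, True)) (alt s t (2 * k)) = concat (replicate k [(s, True), (t, True)])"
    by (induction k) auto
  then show ?thesis
    unfolding cls_def using assms set_alt[of s t "2 * k"]
    by (intro relator_eq_one) (auto simp: coxeter_relators_def in_lists_conv_set)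
qed

lemma cls_square: "s \<in> S \<Longrightarrow> cls [s, s] = \<one>\<^bsub>P\<^esub>"
  using cls_relator[of s s 1] m_eq_1[of s s] by (simp add: numeral_2_eq_2)

lemma cls_cancel:
  assumes "x \<in> lists S" "y \<in> lists S" "s \<in> S"
  shows "cls (x @ [s, s] @ y) = cls (x @ y)"
proof -
  show ?thesis
    using assms cls_square[OF assms(3)] cls_append[of x "[s, s] @ y"] cls_append[of "[s, s]" y]
      cls_append[of x y] by simp
qed

lemma cls_rev:
  assumes "u \<in> lists S"
  shows "cls (rev u) = inv\<^bsub>P\<^esub> cls u"
proof -
  have "cls (rev u @ u) = \<one>\<^bsub>P\<^esub>"
    using assms
  proof (induction u)
    case (Cons s u)
    then have "cls (rev u @ [s, s] @ u) = \<one>\<^bsub>P\<^esub>"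
      using cls_cancel[of "rev u" u s] by (simp add: in_lists_conv_set)
    then show ?case by simp
  qed (simp add: cls_Nil)
  moreover have "rev u \<in> lists S" using assms by auto
  ultimately show ?thesis
    using assms by (intro P.inv_equality[symmetric]) (auto simp: cls_append)
qed

lemma cls_braid:
  assumes "s \<in> S" "t \<in> S" "m s t = enat k"
  shows "cls (alt s t k) = cls (alt t s k)"
proof -
  have l: "alt s t k \<in> lists S" "alt t s k \<in> lists S"
    using set_alt[of s t k] set_alt[of t s k] assms by auto
  have "cls (alt s t k) \<otimes>\<^bsub>P\<^esub> inv\<^bsub>P\<^esub> cls (alt t s k) = \<one>\<^bsub>P\<^esub>"
    using cls_relator[OF assms] l cls_append[of "alt s t k" "rev (alt t s k)"]
    by (simp add: alt_rev_alt cls_rev in_lists_conv_set)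
  then show ?thesis
    using l by (metis P.inv_closed P.inv_equality P.inv_inv cls_closed)
qed

text \<open>Generators are involutions, so formal inverses may be replaced by the generators. From
  here on elements are represented by plain lists over \<open>S\<close>.\<close>

lemma pres_class_cls:
  assumes "w \<in> words S"
  shows "pres_class S (coxeter_relators S m) w = cls (map fst w)"
  using assms
proof (induction w)
  case (Cons a w)
  obtain s b where a: "a = (s, b)" by (cases a)
  have s: "s \<in> S" and w: "w \<in> words S" using Cons a by auto
  have l: "map fst w \<in> lists S" using w by (fastforce simp: in_lists_conv_set)
  have "pres_class S (coxeter_relators S m) [a] = cls [s]"
  proof (cases b)
    case False
    have "cls [s] \<otimes>\<^bsub>P\<^esub> cls [s] = \<one>\<^bsub>P\<^esub>"
      using cls_square[OF s] cls_append[of "[s]" "[s]"] s by simp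
    then have "inv\<^bsub>P\<^esub> cls [s] = cls [s]"
      using s by (intro P.inv_equality) auto
    then show ?thesis using False a s by (simp add: pres_class_inv) (simp add: cls_def)
  qed (simp add: a cls_def)
  moreover have "pres_class S (coxeter_relators S m) (a # w)
      = pres_class S (coxeter_relators S m) [a] \<otimes>\<^bsub>P\<^esub> pres_class S (coxeter_relators S m) w"
    using s w a by (subst presented_group_mult) auto
  ultimately show ?case
    using Cons a cls_append[of "[s]" "map fst w"] l s by simp
qed (simp add: cls_def)

lemma carrier_P: "carrier P = cls ` lists S"
proof
  show "carrier P \<subseteq> cls ` lists S"
  proof
    fix g assume "g \<in> carrier P"
    then obtain w where w: "w \<in> words S" "g = pres_class S (coxeter_relators S m) w"
      by (auto simp: presented_group_def)
    then have "map fst w \<in> lists S" by (fastforce simp: in_lists_conv_set)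
    then show "g \<in> cls ` lists S" using pres_class_cls w by auto
  qed
qed (use cls_closed in blast)

lemma bij_act: "s \<in> S \<Longrightarrow> bij (act s)"
  using act_act by (intro o_bij[of "act s"]) (auto simp: fun_eq_iff)

lemma tits_hom:
  obtains \<Theta> where "\<Theta> \<in> hom P sym_group" "\<And>u. u \<in> lists S \<Longrightarrow> \<Theta> (cls u) = acts u"
proof -
  interpret Y: group "sym_group :: (('s \<Rightarrow> real) \<Rightarrow> ('s \<Rightarrow> real)) monoid" by (rule group_sym_group)
  have wv: "word_val sym_group act (map (\<lambda>s. (s, True)) u) = acts u" for u
    by (induction u) (simp_all add: acts_def)
  have "act \<in> S \<rightarrow> carrier sym_group" using bij_act by auto
  moreover have "word_val sym_group act r = \<one>\<^bsub>sym_group\<^esub>" if r: "r \<in> coxeter_relators S m" for r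
  proof -
    obtain k s t where k: "r = concat (replicate k [(s, True), (t, True)])"
      "s \<in> S" "t \<in> S" "m s t = enat k"
      using r unfolding coxeter_relators_def by blast
    have "r = map (\<lambda>s. (s, True)) (alt s t (2 * k))" unfolding k(1) by (induction k) auto
    then have "word_val sym_group act r = acts (alt s t (2 * k))" by (simp only: wv)
    then show ?thesis using acts_relator[OF k(2-4)] by (auto simp: fun_eq_iff)
  qed
  ultimately obtain h where h: "h \<in> hom P sym_group"
    "\<And>w. w \<in> words S \<Longrightarrow> h (pres_class S (coxeter_relators S m) w) = word_val sym_group act w"
    using Y.presented_group_hom[of act S "coxeter_relators S m"] by metis
  have "h (cls u) = acts u" if "u \<in> lists S" for u
    using h(2)[of "map (\<lambda>s. (s, True)) u"] that wv by (auto simp: cls_def in_lists_conv_set)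
  then show ?thesis using that h(1) by blast
qed

lemma acts_cong_cls:
  assumes "u \<in> lists S" "v \<in> lists S" "cls u = cls v"
  shows "acts u = acts v"
  using tits_hom assms by metis

section \<open>Word length and positivity\<close>

definition len :: "'s word set \<Rightarrow> nat" where
  "len g = (LEAST n. \<exists>u\<in>lists S. length u = n \<and> cls u = g)"

lemma len_le: "u \<in> lists S \<Longrightarrow> len (cls u) \<le> length u"
  unfolding len_def by (rule Least_le) auto

lemma len_attained:
  assumes "u \<in> lists S"
  obtains v where "v \<in> lists S" "length v = len (cls u)" "cls v = cls u"
  using LeastI[of "\<lambda>n. \<exists>v\<in>lists S. length v = n \<and> cls v = cls u" "length u"] assms
  unfolding len_def by blast

text \<open>For finite m s t = n the two coefficients are sin (j \<theta>) / sin \<theta> with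
  consecutive j \<le> n and \<theta> = \<pi> / n, hence nonnegative; for an infinite entry they are
  k + 1 and k.\<close>

lemma dihedral_positive:
  assumes "s \<in> S" "t \<in> S" "s \<noteq> t" "\<phi> s > 0" "\<phi> t > 0" "enat k < m s t"
  shows "acts (alt t s k) \<phi> s > 0"
proof -
  have "cheb (cmat s t) (Suc k) \<ge> 0 \<and> cheb (cmat s t) k \<ge> 0 \<and>
    (cheb (cmat s t) (Suc k) > 0 \<or> cheb (cmat s t) k > 0)"
  proof (cases "m s t")
    case (enat n)
    define \<theta> where "\<theta> = pi / real n"
    have n: "2 \<le> n" using m_ge_2 assms enat by blast
    have kn: "k < n" using assms enat by simp
    have c: "cmat s t = 2 * cos \<theta>" by (simp add: cmat_def enat \<theta>_def)
    have th: "0 < \<theta>" using n by (simp add: \<theta>_def)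
    have n\<theta>: "real n * \<theta> = pi" using n by (simp add: \<theta>_def)
    have pos: "0 < sin (real j * \<theta>)" if "0 < j" "j < n" for j
    proof (rule sin_gt_zero)
      show "0 < real j * \<theta>" using that th by simp
      have "real j * \<theta> < real n * \<theta>" using that th by (intro mult_strict_right_mono) auto
      then show "real j * \<theta> < pi" using n\<theta> by simp
    qed
    have sin: "sin \<theta> > 0" using pos[of 1] n by simp
    have cheb: "cheb (cmat s t) j = sin (real j * \<theta>) / sin \<theta>" for j
      using sin by (simp add: c eq_divide_eq cheb_sin)
    have nn: "cheb (cmat s t) j \<ge> 0" if "j \<le> n" for j
    proof (cases "j = 0 \<or> j = n")
      case True
      then show ?thesis using n\<theta> by (auto simp: cheb)
    next
      case False
      then have "0 < sin (real j * \<theta>)" using that by (intro pos) auto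
      then show ?thesis using sin by (simp add: cheb)
    qed
    \<comment> \<open>The coefficient of index k + 1 vanishes for k = n - 1, so strict positivity is
      taken from index k. For k = 0 it is the other one, equal to 1, that is positive.\<close>
    have "cheb (cmat s t) (Suc k) > 0 \<or> cheb (cmat s t) k > 0"
    proof (cases "k = 0")
      case False
      then have "0 < sin (real k * \<theta>)" using kn by (intro pos) auto
      then show ?thesis using sin by (simp add: cheb)
    qed simp
    then show ?thesis using nn[of "Suc k"] nn[of k] kn by simp
  next
    case infinity
    then show ?thesis by (simp add: cmat_def cheb_2)
  qed
  then have "0 < cheb (cmat s t) (Suc k) * a + cheb (cmat s t) k * b" if "a > 0" "b > 0" for a b
    using that by (metis add_nonneg_pos add_pos_nonneg less_imp_le mult_nonneg_nonneg mult_pos_pos)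
  then show ?thesis
    unfolding acts_alt[OF assms(1-3), of k \<phi>] using assms(4,5) by simp
qed


text \<open>Tits' argument: \<open>u\<close> is factored as \<open>x y\<close> with \<open>x\<close> in the dihedral subgroup generated by \<open>s\<close> and the
  first letter \<open>t\<close> of \<open>u\<close>, and \<open>y\<close> as short as possible, so that the induction hypothesis applies to
  \<open>y\<close> at both \<open>s\<close> and \<open>t\<close>.\<close>

lemma tits_positive:
  assumes "u \<in> lists S" "s \<in> S" "len (cls u) \<le> len (cls (s # u))" "\<And>r. r \<in> S \<Longrightarrow> \<phi> r > 0"
  shows "acts u \<phi> s > 0"
  using assms(1-3)
proof (induction "len (cls u)" arbitrary: u s rule: less_induct)
  case less
  obtain v0 where v0: "v0 \<in> lists S" "length v0 = len (cls u)" "cls v0 = cls u"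
    using len_attained[OF less.prems(1)] by blast
  show ?case
  proof (cases v0)
    case Nil
    then have "acts u = id" using acts_cong_cls[OF v0(1) less.prems(1) v0(3)] by simp
    then show ?thesis using assms(4) less.prems(2) by simp
  next
    case (Cons t w)
    have t: "t \<in> S" and w: "w \<in> lists S" using Cons v0 by auto
    have cls_s: "cls (s # u) = cls (s # v)" if "v \<in> lists S" "cls v = cls u" for v
      using that less.prems cls_append[of "[s]" u] cls_append[of "[s]" v] by simp
    \<comment> \<open>No shortest expression of u begins with s: cancelling that s would make
      \<open>s # u\<close> shorter than u, against the assumption.\<close>
    have no_s: False if x: "x \<in> lists S" "cls (s # x) = cls u" "length x < len (cls u)" for x
    proof -
      have "cls (s # u) = cls ([] @ [s, s] @ x)"
        using cls_s[of "s # x"] x less.prems by simp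
      also have "\<dots> = cls x" using cls_cancel[of "[]" x s] x less.prems by simp
      finally have "len (cls (s # u)) \<le> length x" using len_le[OF x(1)] by simp
      then show False using less.prems x by simp
    qed
    have ts: "t \<noteq> s" using no_s[of w] w Cons v0 by auto
    \<comment> \<open>The lengths add up to \<open>len (cls u)\<close>, so the factorization is
      reduced. The pair \<open>([t], w)\<close> guarantees that the minimal second factor is shorter
      than u, as the induction requires.\<close>
    define Q where "Q xy \<longleftrightarrow> fst xy \<in> lists {s, t} \<and> snd xy \<in> lists S \<and>
      cls (fst xy @ snd xy) = cls u \<and> length (fst xy) + length (snd xy) = len (cls u)" for xy
    have Q0: "Q ([t], w)" using Cons v0 w by (simp add: Q_def)
    then obtain xy where xy: "Q xy" "\<And>z. Q z \<Longrightarrow> length (snd xy) \<le> length (snd z)"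
      using ex_has_least_nat[of Q "([t], w)" "\<lambda>xy. length (snd xy)"] by blast
    obtain x y where xy_eq: "xy = (x, y)" by (cases xy)
    have x: "x \<in> lists {s, t}" "x \<in> lists S" and y: "y \<in> lists S"
      and xy_cls: "cls (x @ y) = cls u" and xy_len: "length x + length y = len (cls u)"
      using xy(1) t less.prems(2) by (auto simp: Q_def xy_eq in_lists_conv_set)
    have "length y \<le> length w" using xy(2)[OF Q0] by (simp add: xy_eq)
    then have y_less: "length y < len (cls u)" using v0 Cons by simp
    \<comment> \<open>If r shortened y, the letter r could be moved from the second factor to the
      first, against the minimality of y.\<close>
    have y_min: "len (cls y) \<le> len (cls (r # y))" if r: "r = s \<or> r = t" for r
    proof (rule ccontr)
      assume "\<not> ?thesis"
      then have less_y: "len (cls (r # y)) < length y" using len_le[OF y] by simp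
      have rS: "r \<in> S" using r t less.prems by auto
      then have "r # y \<in> lists S" using y by simp
      then obtain y' where y': "y' \<in> lists S" "length y' = len (cls (r # y))" "cls y' = cls (r # y)"
        using len_attained by metis
      have "cls ((x @ [r]) @ y') = cls (x @ [r]) \<otimes>\<^bsub>P\<^esub> cls (r # y)"
        using x y' rS by (subst cls_append) auto
      also have "\<dots> = cls (x @ [r, r] @ y)"
        using x y rS cls_append[of "x @ [r]" "r # y"] by simp
      also have "\<dots> = cls u" using cls_cancel[of x y r] x y rS xy_cls by simp
      finally have c: "cls ((x @ [r]) @ y') = cls u" .
      then have "len (cls u) \<le> length ((x @ [r]) @ y')"
        using len_le[of "(x @ [r]) @ y'"] x y' rS by simp
      then have "Q (x @ [r], y')"
        using c x y' r less_y xy_len by (auto simp: Q_def)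
      from xy(2)[OF this] show False using y' less_y by (simp add: xy_eq)
    qed
    have pos: "acts y \<phi> r > 0" if r: "r = s \<or> r = t" for r
      using less.hyps[OF _ y _ y_min[OF r]] r t less.prems(2) y_less len_le[OF y] by auto
    \<comment> \<open>Two equal neighbours in x would cancel and give an expression shorter than
      \<open>len (cls u)\<close>.\<close>
    have "x = alt s t (length x) \<or> x = alt t s (length x)"
    proof (rule ccontr)
      assume "\<not> ?thesis"
      then obtain p a q where x_eq: "x = p @ [a, a] @ q" using two_letter_word[OF x(1)] by blast
      then have "p \<in> lists S" "q \<in> lists S" "a \<in> S" using x by auto
      then have "cls u = cls (p @ q @ y)" and "p @ q @ y \<in> lists S"
        using cls_cancel[of p "q @ y" a] xy_cls x_eq y by auto
      then have "len (cls u) \<le> length (p @ q @ y)" using len_le by metis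
      then show False using xy_len x_eq by simp
    qed
    moreover have "x = []" if "x = alt s t (length x)"
    proof (rule ccontr)
      assume "x \<noteq> []"
      then obtain b x' where bx: "x = b # x'" by (cases x) auto
      have "b # x' = alt s t (length (b # x'))" using that unfolding bx .
      then have x': "x = s # x'" using bx by simp
      then show False using no_s[of "x' @ y"] x y xy_cls xy_len by auto
    qed
    ultimately obtain k where k: "k = length x" and x_alt: "x = alt t s k"
      by (metis alt.simps(1) list.size(3))
    \<comment> \<open>With m s t or more letters, x could be rewritten by the braid relation so as
      to begin with s, which \<open>no_s\<close> excludes.\<close>
    have "enat (length x) < m s t"
    proof (rule ccontr)
      assume "\<not> ?thesis"
      then obtain n where n: "m s t = enat n" "n \<le> length x"
        by (cases "m s t") auto
      have n2: "2 \<le> n" using m_ge_2[OF less.prems(2) t] ts n by auto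
      have take: "take n x = alt t s n" unfolding x_alt by (rule take_alt) (use n(2) k in simp)
      have d: "drop n x \<in> lists S" using x(2) by (auto simp: in_lists_conv_set dest: in_set_dropD)
      have l: "alt s t n \<in> lists S" "alt t s n \<in> lists S"
        using set_alt[of s t n] set_alt[of t s n] t less.prems(2) by auto
      have "cls (x @ y) = cls (alt t s n @ (drop n x @ y))"
        using take append_take_drop_id[of n x] by (metis append_assoc)
      also have "\<dots> = cls (alt s t n @ (drop n x @ y))"
        using l d y cls_braid[OF less.prems(2) t n(1)] by (simp add: cls_append[of _ "drop n x @ y"])
      also have "alt s t n @ (drop n x @ y) = s # (alt t s (n - 1) @ drop n x @ y)"
        using n2 by (cases n) auto
      finally have "cls (s # (alt t s (n - 1) @ drop n x @ y)) = cls u" using xy_cls by simp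
      moreover have "alt t s (n - 1) @ drop n x @ y \<in> lists S"
        using set_alt[of t s "n - 1"] t less.prems(2) d y by auto
      moreover have "length (alt t s (n - 1) @ drop n x @ y) < len (cls u)"
        using n n2 xy_len by simp
      ultimately show False using no_s by blast
    qed
    then have "acts (alt t s k) (acts y \<phi>) s > 0"
      using dihedral_positive[of s t "acts y \<phi>" k] k pos less.prems(2) t ts by auto
    then have "acts (x @ y) \<phi> s > 0" using x_alt by simp
    moreover have "acts (x @ y) = acts u"
      using acts_cong_cls[of "x @ y" u] x y less.prems xy_cls by simp
    ultimately show ?thesis by simp
  qed
qed

text \<open>A nontrivial element has a shortest expression, beginning with some s. What follows s
  makes the s-coordinate positive by \<open>tits_positive\<close>, and s itself changes the sign.
  One positive vector therefore detects every nontrivial element.\<close>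

lemma tits_faithful:
  assumes u: "u \<in> lists S" and \<phi>: "\<And>r. r \<in> S \<Longrightarrow> \<phi> r > 0"
    and fixed: "\<And>r. r \<in> S \<Longrightarrow> acts u \<phi> r = \<phi> r"
  shows "cls u = \<one>\<^bsub>P\<^esub>"
proof -
  obtain v where v: "v \<in> lists S" "length v = len (cls u)" "cls v = cls u"
    using len_attained[OF u] by blast
  show ?thesis
  proof (cases v)
    case Nil
    then show ?thesis using v cls_Nil by simp
  next
    case (Cons s w)
    then have s: "s \<in> S" and w: "w \<in> lists S" using v by auto
    have "len (cls w) \<le> len (cls (s # w))" using len_le[OF w] v Cons by simp
    then have "acts w \<phi> s > 0" using tits_positive[OF w s] \<phi> by blast
    then have "acts v \<phi> s < 0" using act_same[OF s] Cons by simp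
    moreover have "acts v \<phi> s = \<phi> s" using acts_cong_cls[OF v(1) u v(3)] fixed s by simp
    ultimately show ?thesis using \<phi>[OF s] by simp
  qed
qed

text \<open>Finitely many letters \<open>S0\<close> suffice to write the elements of X. Words over
  \<open>S0\<close> fix the indicator function \<delta> of a generator s outside \<open>S0\<close>,
  whereas s negates its s-coordinate, so s would not be generated.\<close>

lemma finite_generators:
  assumes X: "finite X" "X \<subseteq> carrier P" "generate P X = carrier P"
  shows "finite S"
proof -
  have "\<forall>x\<in>X. \<exists>u. u \<in> lists S \<and> cls u = x"
    using X(2) unfolding carrier_P by (auto simp: subset_iff image_iff)
  then obtain f where f: "\<And>x. x \<in> X \<Longrightarrow> f x \<in> lists S \<and> cls (f x) = x" by metis
  define S0 where "S0 = (\<Union>x\<in>X. set (f x))"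
  have fin: "finite S0" using X(1) by (auto simp: S0_def)
  have S0: "S0 \<subseteq> S" using f by (auto simp: S0_def)
  have "g \<in> cls ` lists S0" if "g \<in> generate P X" for g
    using that
  proof (induction rule: generate.induct)
    case one
    show ?case using cls_Nil by (metis image_eqI lists.Nil)
  next
    case (incl h)
    then have "f h \<in> lists S0" by (auto simp: S0_def)
    then show ?case using f[OF incl] by (metis image_eqI)
  next
    case (inv h)
    then have "f h \<in> lists S0" by (auto simp: S0_def)
    then have "rev (f h) \<in> lists S0" by auto
    moreover have "cls (rev (f h)) = inv\<^bsub>P\<^esub> h" using f[OF inv] cls_rev by metis
    ultimately show ?case by (metis image_eqI)
  next
    case (eng g h)
    then obtain u v where uv: "u \<in> lists S0" "v \<in> lists S0" "g = cls u" "h = cls v" by auto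
    then have "u \<in> lists S" "v \<in> lists S" using S0 lists_mono by blast+
    then have "cls (u @ v) = g \<otimes>\<^bsub>P\<^esub> h" using uv cls_append by simp
    moreover have "u @ v \<in> lists S0" using uv by simp
    ultimately show ?case by (metis image_eqI)
  qed
  then have gen: "carrier P \<subseteq> cls ` lists S0" using X(3) by blast
  have "s \<in> S0" if s: "s \<in> S" for s
  proof (rule ccontr)
    assume ns: "s \<notin> S0"
    define \<delta> where "\<delta> = (\<lambda>r. if r = s then 1 else 0 :: real)"
    have "cls [s] \<in> carrier P" using s by simp
    then obtain u where u: "u \<in> lists S0" "cls [s] = cls u" using gen by blast
    have "acts u \<delta> = \<delta>"
      using u(1)
    proof (induction u)
      case (Cons a u)
      then have "\<delta> a = 0" using ns by (auto simp: \<delta>_def)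
      then show ?case using Cons by (auto simp: act_def)
    qed simp
    moreover have "acts [s] = acts u" using acts_cong_cls[of "[s]" u] u s S0 by auto
    ultimately have "act s \<delta> s = \<delta> s" by (metis acts_simps(1,2) id_apply)
    then show False using act_same[OF s] by (simp add: \<delta>_def)
  qed
  then show ?thesis using fin by (meson finite_subset subsetI)
qed

end

section \<open>Congruence subgroups of a Coxeter group\<close>

text \<open>The interface between the two halves of the proof: apart from finite generation, the
  termination argument knows nothing else about Coxeter groups. Torsion is excluded for prime
  exponents, where Minkowski's argument applies directly.\<close>

definition residual_data :: "('a, 'm) monoid_scheme \<Rightarrow> (nat \<Rightarrow> 'a set) \<Rightarrow> bool" where
  "residual_data G N \<longleftrightarrow>
    (\<forall>k. N k \<lhd> G \<and> finite (rcosets\<^bsub>G\<^esub> (N k)) \<and>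
      (\<forall>x\<in>N k. \<forall>q::nat. prime q \<longrightarrow> x [^]\<^bsub>G\<^esub> q = \<one>\<^bsub>G\<^esub> \<longrightarrow> x = \<one>\<^bsub>G\<^esub>)) \<and>
    (\<forall>F. finite F \<and> F \<subseteq> carrier G \<longrightarrow> (\<exists>k. N k \<inter> F \<subseteq> {\<one>\<^bsub>G\<^esub>}))"

context coxeter begin

lemma acts_linear:
  "acts u (\<lambda>r. a * \<phi> r + b * \<psi> r) = (\<lambda>r. a * acts u \<phi> r + b * acts u \<psi> r)"
  by (induction u) (auto simp: act_def algebra_simps)

lemma acts_add: "acts u (\<lambda>r. \<phi> r + b * \<psi> r) = (\<lambda>r. acts u \<phi> r + b * acts u \<psi> r)"
  using acts_linear[of u 1 \<phi> b \<psi>] by simp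

end

locale finite_coxeter = coxeter S m for S :: "'s set" and m +
  assumes finite_S: "finite S"
begin

text \<open>A common multiple of the finite entries of the Coxeter matrix, so that all entries of
  \<open>cmat\<close> are doubled members of one finite set \<open>cosines denom\<close>; an
  infinite entry gives 2 = 2 cos 0.\<close>

definition denom :: nat where
  "denom = (\<Prod>(s, t)\<in>S \<times> S. case m s t of enat k \<Rightarrow> k | \<infinity> \<Rightarrow> 1)"

lemma m_pos: "s \<in> S \<Longrightarrow> t \<in> S \<Longrightarrow> m s t = enat k \<Longrightarrow> 0 < k"
  using m_eq_1[of s t] m_ge_2[of s t k] by (cases "s = t") auto

lemma denom_pos: "denom > 0"
  unfolding denom_def by (intro prod_pos) (auto split: enat.split intro: m_pos)

lemma dvd_denom:
  assumes "s \<in> S" "t \<in> S" "m s t = enat k"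
  shows "k dvd denom"
  using dvd_prodI[of "S \<times> S" "(s, t)" "\<lambda>(s, t). case m s t of enat k \<Rightarrow> k | \<infinity> \<Rightarrow> 1"] assms finite_S
  by (simp add: denom_def)

lemma cmat_cosine:
  assumes "s \<in> S" "t \<in> S"
  obtains j :: int where "cmat s t = 2 * cos (of_int j * pi / real denom)"
proof (cases "m s t")
  case (enat k)
  obtain d where d: "denom = k * d" using dvd_denom[OF assms enat] by blast
  then have "d > 0" "k > 0" using denom_pos by (auto intro: Nat.gr0I)
  then have "pi / real k = of_int (int d) * pi / real denom" by (simp add: d)
  then show ?thesis using that[of "int d"] enat by (simp add: cmat_def)
next
  case infinity
  then show ?thesis using that[of 0] by (simp add: cmat_def)
qed

text \<open>A lattice function is determined by its values on the finite set \<open>S\<close>, so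
  only finitely many residue classes modulo a positive integer remain.\<close>

definition lattice :: "('s \<Rightarrow> real) set" where
  "lattice = {\<phi>. (\<forall>s\<in>S. \<phi> s \<in> int_span (cosines denom)) \<and> (\<forall>s. s \<notin> S \<longrightarrow> \<phi> s = 0)}"

lemma lattice_add: "\<phi> \<in> lattice \<Longrightarrow> \<psi> \<in> lattice \<Longrightarrow> (\<lambda>r. \<phi> r + \<psi> r) \<in> lattice"
  by (auto simp: lattice_def intro: int_span_add)

lemma lattice_mult: "\<phi> \<in> lattice \<Longrightarrow> (\<lambda>r. of_int n * \<phi> r) \<in> lattice"
  by (auto simp: lattice_def intro: int_span_mult_int)

lemma act_lattice:
  assumes "\<phi> \<in> lattice" "s \<in> S"
  shows "act s \<phi> \<in> lattice"
proof -
  have "cmat s t * \<phi> s \<in> int_span (cosines denom)" if t: "t \<in> S" for t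
  proof -
    obtain j :: int where "cmat s t = 2 * cos (of_int j * pi / real denom)"
      using cmat_cosine assms(2) t by blast
    then show ?thesis
      using cosines_mult[OF denom_pos, of "\<phi> s" j] assms by (simp add: lattice_def)
  qed
  then show ?thesis
    using assms by (auto simp: lattice_def act_def intro: int_span_add)
qed

lemma acts_lattice: "u \<in> lists S \<Longrightarrow> \<phi> \<in> lattice \<Longrightarrow> acts u \<phi> \<in> lattice"
  by (induction u) (auto intro: act_lattice)

section \<open>Congruences of lattice vectors and their kernels\<close>

definition lcong :: "int \<Rightarrow> ('s \<Rightarrow> real) \<Rightarrow> ('s \<Rightarrow> real) \<Rightarrow> bool" where
  "lcong n \<phi> \<psi> \<longleftrightarrow> (\<exists>\<chi>\<in>lattice. \<phi> = (\<lambda>r. \<psi> r + of_int n * \<chi> r))"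

lemma lcong_refl: "lcong n \<phi> \<phi>"
  unfolding lcong_def by (intro bexI[of _ "\<lambda>_. 0"]) (auto simp: lattice_def int_span_zero)

lemma lcong_sym: "lcong n \<phi> \<psi> \<Longrightarrow> lcong n \<psi> \<phi>"
proof -
  assume "lcong n \<phi> \<psi>"
  then obtain \<chi> where "\<chi> \<in> lattice" "\<phi> = (\<lambda>r. \<psi> r + of_int n * \<chi> r)"
    unfolding lcong_def by blast
  then show "lcong n \<psi> \<phi>"
    unfolding lcong_def using lattice_mult[of \<chi> "-1"]
    by (intro bexI[of _ "\<lambda>r. of_int (-1) * \<chi> r"]) auto
qed

lemma lcong_trans: "lcong n \<phi> \<psi> \<Longrightarrow> lcong n \<psi> \<chi> \<Longrightarrow> lcong n \<phi> \<chi>"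
proof -
  assume "lcong n \<phi> \<psi>" "lcong n \<psi> \<chi>"
  then obtain \<alpha> \<beta> where "\<alpha> \<in> lattice" "\<beta> \<in> lattice"
    "\<phi> = (\<lambda>r. \<psi> r + of_int n * \<alpha> r)" "\<psi> = (\<lambda>r. \<chi> r + of_int n * \<beta> r)"
    unfolding lcong_def by blast
  then show "lcong n \<phi> \<chi>"
    unfolding lcong_def using lattice_add[of \<alpha> \<beta>]
    by (intro bexI[of _ "\<lambda>r. \<alpha> r + \<beta> r"]) (auto simp: algebra_simps)
qed

lemma lcong_acts:
  assumes "u \<in> lists S" "lcong n \<phi> \<psi>"
  shows "lcong n (acts u \<phi>) (acts u \<psi>)"
proof -
  obtain \<chi> where "\<chi> \<in> lattice" "\<phi> = (\<lambda>r. \<psi> r + of_int n * \<chi> r)"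
    using assms(2) unfolding lcong_def by blast
  then show ?thesis
    unfolding lcong_def using acts_lattice[OF assms(1)] acts_add by blast
qed

lemma lcong_dvd:
  assumes "lcong n \<phi> \<psi>" "d dvd n"
  shows "lcong d \<phi> \<psi>"
proof -
  obtain \<chi> c where "\<chi> \<in> lattice" "\<phi> = (\<lambda>r. \<psi> r + of_int n * \<chi> r)" "n = d * c"
    using assms unfolding lcong_def dvd_def by blast
  then show ?thesis
    unfolding lcong_def using lattice_mult[of \<chi> c]
    by (intro bexI[of _ "\<lambda>r. of_int c * \<chi> r"]) (auto simp: algebra_simps)
qed

lemma lattice_residues:
  assumes "n > 0"
  obtains F where "finite F" "F \<subseteq> lattice" "\<And>\<phi>. \<phi> \<in> lattice \<Longrightarrow> \<exists>\<psi>\<in>F. lcong n \<phi> \<psi>"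
proof -
  obtain E where E: "finite E"
    "\<And>x. x \<in> int_span (cosines denom) \<Longrightarrow> \<exists>y\<in>E. \<exists>z\<in>int_span (cosines denom). x = y + of_int n * z"
    using int_span_residues[OF finite_cosines[OF denom_pos] assms] by metis
  \<comment> \<open>A representative differs from the span element x by a multiple of n in the span,
    so the intersection loses none of the representatives that are used.\<close>
  define E' where "E' = E \<inter> int_span (cosines denom)"
  have E': "finite E'" using E(1) by (simp add: E'_def)
  have E'2: "\<exists>y\<in>E'. \<exists>z\<in>int_span (cosines denom). x = y + of_int n * z" if x: "x \<in> int_span (cosines denom)" for x
  proof -
    obtain y z where yz: "y \<in> E" "z \<in> int_span (cosines denom)" "x = y + of_int n * z" using E(2)[OF x] by blast
    have "x + of_int (- n) * z \<in> int_span (cosines denom)"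
      using x yz(2) by (intro int_span_add int_span_mult_int)
    then have "y \<in> E'" using yz by (simp add: E'_def)
    then show ?thesis using yz by blast
  qed
  define F where "F = {\<phi>. \<forall>s. (s \<in> S \<longrightarrow> \<phi> s \<in> E') \<and> (s \<notin> S \<longrightarrow> \<phi> s = 0)}"
  have "finite F" unfolding F_def by (rule finite_set_of_finite_funs[OF finite_S E'])
  moreover have "F \<subseteq> lattice" by (auto simp: F_def lattice_def E'_def)
  moreover have "\<exists>\<psi>\<in>F. lcong n \<phi> \<psi>" if \<phi>: "\<phi> \<in> lattice" for \<phi>
  proof -
    have "\<forall>s. \<exists>y z. s \<in> S \<longrightarrow> y \<in> E' \<and> z \<in> int_span (cosines denom) \<and> \<phi> s = y + of_int n * z"
      using E'2 \<phi> unfolding lattice_def by blast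
    then obtain y z where yz: "\<And>s. s \<in> S \<Longrightarrow> y s \<in> E' \<and> z s \<in> int_span (cosines denom) \<and> \<phi> s = y s + of_int n * z s"
      by metis
    show ?thesis
    proof (intro bexI)
      show "(\<lambda>s. if s \<in> S then y s else 0) \<in> F" using yz by (auto simp: F_def)
      show "lcong n \<phi> (\<lambda>s. if s \<in> S then y s else 0)"
        unfolding lcong_def
      proof (intro bexI)
        show "(\<lambda>s. if s \<in> S then z s else 0) \<in> lattice" using yz by (auto simp: lattice_def)
        show "\<phi> = (\<lambda>r. (if r \<in> S then y r else 0) + of_int n * (if r \<in> S then z r else 0))"
          using yz \<phi> by (auto simp: lattice_def)
      qed
    qed
  qed
  ultimately show ?thesis using that by blast
qed

definition cong_subgroup :: "int \<Rightarrow> 's word set set" where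
  "cong_subgroup n = {cls u | u. u \<in> lists S \<and> (\<forall>\<phi>\<in>lattice. lcong n (acts u \<phi>) \<phi>)}"

lemma cls_cong_subgroup:
  assumes "u \<in> lists S"
  shows "cls u \<in> cong_subgroup n \<longleftrightarrow> (\<forall>\<phi>\<in>lattice. lcong n (acts u \<phi>) \<phi>)"
proof
  assume "cls u \<in> cong_subgroup n"
  then obtain v where "cls u = cls v" "v \<in> lists S" "\<forall>\<phi>\<in>lattice. lcong n (acts v \<phi>) \<phi>"
    unfolding cong_subgroup_def by blast
  then show "\<forall>\<phi>\<in>lattice. lcong n (acts u \<phi>) \<phi>" using acts_cong_cls[OF assms] by metis
qed (use assms in \<open>auto simp: cong_subgroup_def\<close>)

lemma acts_rev:
  assumes "u \<in> lists S"
  shows "acts u (acts (rev u) \<phi>) = \<phi>"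
  using assms by (induction u arbitrary: \<phi>) (simp_all add: act_act)

lemma subgroup_congruence: "subgroup (cong_subgroup n) P"
proof -
  show ?thesis
  proof (rule P.subgroupI)
    show "cong_subgroup n \<subseteq> carrier P"
      unfolding cong_subgroup_def using cls_closed by blast
    have "cls [] \<in> cong_subgroup n" by (subst cls_cong_subgroup) (auto intro: lcong_refl)
    then show "cong_subgroup n \<noteq> {}" by blast
  next
    fix g assume "g \<in> cong_subgroup n"
    then obtain u where u: "g = cls u" "u \<in> lists S" "\<forall>\<phi>\<in>lattice. lcong n (acts u \<phi>) \<phi>"
      unfolding cong_subgroup_def by blast
    have r: "rev u \<in> lists S" using u by (simp add: in_lists_conv_set)
    have "lcong n (acts (rev u) \<phi>) \<phi>" if "\<phi> \<in> lattice" for \<phi>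
      using u(3) acts_lattice[OF r that] acts_rev[OF u(2), of \<phi>] lcong_sym by metis
    then show "inv\<^bsub>P\<^esub> g \<in> cong_subgroup n"
      unfolding u(1) cls_rev[OF u(2), symmetric] using cls_cong_subgroup[OF r] by blast
  next
    fix g h assume "g \<in> cong_subgroup n" "h \<in> cong_subgroup n"
    then obtain u v where u: "g = cls u" "u \<in> lists S" "\<forall>\<phi>\<in>lattice. lcong n (acts u \<phi>) \<phi>"
      and v: "h = cls v" "v \<in> lists S" "\<forall>\<phi>\<in>lattice. lcong n (acts v \<phi>) \<phi>"
      unfolding cong_subgroup_def by blast
    have "lcong n (acts (u @ v) \<phi>) \<phi>" if "\<phi> \<in> lattice" for \<phi>
      using lcong_trans[OF lcong_acts[OF u(2)]] u(3) v(3) that by auto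
    then show "g \<otimes>\<^bsub>P\<^esub> h \<in> cong_subgroup n"
      unfolding u(1) v(1) cls_append[OF u(2) v(2), symmetric]
      using cls_cong_subgroup[of "u @ v"] u(2) v(2) by simp
  qed
qed

lemma normal_congruence: "cong_subgroup n \<lhd> P"
proof -
  have "x \<otimes>\<^bsub>P\<^esub> h \<otimes>\<^bsub>P\<^esub> inv\<^bsub>P\<^esub> x \<in> cong_subgroup n"
    if xc: "x \<in> carrier P" and hc: "h \<in> cong_subgroup n" for x h
  proof -
    obtain u where u: "h = cls u" "u \<in> lists S" "\<forall>\<phi>\<in>lattice. lcong n (acts u \<phi>) \<phi>"
      using hc unfolding cong_subgroup_def by blast
    obtain v where v: "x = cls v" "v \<in> lists S" using xc unfolding carrier_P by blast
    have r: "rev v \<in> lists S" using v by (simp add: in_lists_conv_set)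
    have "lcong n (acts (v @ u @ rev v) \<phi>) \<phi>" if "\<phi> \<in> lattice" for \<phi>
    proof -
      have "lcong n (acts u (acts (rev v) \<phi>)) (acts (rev v) \<phi>)"
        using u(3) acts_lattice[OF r that] by blast
      then have "lcong n (acts v (acts u (acts (rev v) \<phi>))) (acts v (acts (rev v) \<phi>))"
        by (rule lcong_acts[OF v(2)])
      then show ?thesis using acts_rev[OF v(2)] by simp
    qed
    then have "cls (v @ u @ rev v) \<in> cong_subgroup n"
      using cls_cong_subgroup[of "v @ u @ rev v"] u(2) v(2) r by simp
    then show ?thesis
      using u v r by (simp add: cls_append cls_rev P.m_assoc)
  qed
  then show ?thesis using P.normal_inv_iff subgroup_congruence by blast
qed

text \<open>A word is recorded by its action on finitely many residue classes. Two words with the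
  same record act alike modulo n on the whole lattice and so lie in the same coset.\<close>

lemma finite_index_congruence:
  assumes "n > 0"
  shows "finite (rcosets\<^bsub>P\<^esub> (cong_subgroup n))"
proof -
  obtain F where F: "finite F" "F \<subseteq> lattice" "\<And>\<phi>. \<phi> \<in> lattice \<Longrightarrow> \<exists>\<psi>\<in>F. lcong n \<phi> \<psi>"
    using lattice_residues[OF assms] by metis
  define key where "key u = {(\<phi>, \<psi>) \<in> F \<times> F. lcong n (acts u \<phi>) \<psi>}" for u
  have "key ` lists S \<subseteq> Pow (F \<times> F)" by (auto simp: key_def)
  then have "finite (key ` lists S)" using F(1) by (meson finite_Pow_iff finite_SigmaI finite_subset)
  moreover have "cong_subgroup n #>\<^bsub>P\<^esub> cls u = cong_subgroup n #>\<^bsub>P\<^esub> cls v"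
    if uv: "u \<in> lists S" "v \<in> lists S" and k: "key u = key v" for u v
  proof -
    have same: "lcong n (acts u \<phi>) (acts v \<phi>)" if \<phi>: "\<phi> \<in> lattice" for \<phi>
    proof -
      obtain \<phi>0 where p: "\<phi>0 \<in> F" "lcong n \<phi> \<phi>0" using F(3)[OF \<phi>] by blast
      then have "acts u \<phi>0 \<in> lattice" using F(2) acts_lattice[OF uv(1)] by blast
      then obtain \<psi>0 where q: "\<psi>0 \<in> F" "lcong n (acts u \<phi>0) \<psi>0" using F(3) by blast
      then have "(\<phi>0, \<psi>0) \<in> key v" using p k by (auto simp: key_def)
      then have "lcong n (acts v \<phi>0) \<psi>0" by (auto simp: key_def)
      then have "lcong n (acts u \<phi>0) (acts v \<phi>0)" using q lcong_sym lcong_trans by blast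
      then show ?thesis
        using lcong_acts[OF uv(1) p(2)] lcong_acts[OF uv(2) p(2)] lcong_sym lcong_trans by blast
    qed
    have r: "rev v \<in> lists S" using uv by (simp add: in_lists_conv_set)
    have rr: "acts (rev v) (acts v \<phi>) = \<phi>" for \<phi> using acts_rev[OF r] by simp
    have "lcong n (acts (u @ rev v) \<phi>) \<phi>" if \<phi>: "\<phi> \<in> lattice" for \<phi>
      using same[OF acts_lattice[OF r \<phi>]] acts_rev[OF uv(2)] by simp
    then have "cls (u @ rev v) \<in> cong_subgroup n"
      using cls_cong_subgroup[of "u @ rev v"] uv r by simp
    then have "cls u \<otimes>\<^bsub>P\<^esub> inv\<^bsub>P\<^esub> cls v \<in> cong_subgroup n"
      using uv r by (simp add: cls_append cls_rev)
    then have "cls u \<in> cong_subgroup n #>\<^bsub>P\<^esub> cls v"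
      using subgroup.rcos_module_rev[OF subgroup_congruence P.is_group] uv by simp
    then show ?thesis
      using P.repr_independence[OF _ _ subgroup_congruence] uv by (metis cls_closed)
  qed
  ultimately have "finite ((\<lambda>u. cong_subgroup n #>\<^bsub>P\<^esub> cls u) ` lists S)"
    by (rule finite_image_factor)
  moreover have "rcosets\<^bsub>P\<^esub> (cong_subgroup n) = (\<lambda>u. cong_subgroup n #>\<^bsub>P\<^esub> cls u) ` lists S"
    unfolding RCOSETS_def carrier_P by auto
  ultimately show ?thesis by simp
qed

text \<open>The function that is 1 on \<open>S\<close> is a positive lattice vector. An element of
  all these subgroups changes it by vectors divisible by every power of 3, hence fixes it, and
  \<open>tits_faithful\<close> applies.\<close>

lemma congruence_separates:
  assumes g: "g \<in> carrier P" "g \<noteq> \<one>\<^bsub>P\<^esub>"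
  shows "\<exists>k. g \<notin> cong_subgroup (3 ^ k)"
proof (rule ccontr)
  assume no: "\<nexists>k. g \<notin> cong_subgroup (3 ^ k)"
  obtain u where u: "g = cls u" "u \<in> lists S" using g(1) unfolding carrier_P by blast
  define \<phi> :: "'s \<Rightarrow> real" where "\<phi> = (\<lambda>s. if s \<in> S then 1 else 0)"
  have "1 \<in> cosines denom" unfolding cosines_def by (rule image_eqI[of _ _ 0]) auto
  then have \<phi>: "\<phi> \<in> lattice"
    using int_span_base[OF finite_cosines[OF denom_pos]] by (auto simp: lattice_def \<phi>_def)
  have "acts u \<phi> r = \<phi> r" if r: "r \<in> S" for r
  proof -
    have "\<exists>z\<in>int_span (cosines denom). acts u \<phi> r - \<phi> r = 3 ^ k * z" for k
    proof -
      have "g \<in> cong_subgroup (3 ^ k)" using no by blast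
      then have "lcong (3 ^ k) (acts u \<phi>) \<phi>" using cls_cong_subgroup[OF u(2)] u(1) \<phi> by blast
      then obtain \<chi> where "\<chi> \<in> lattice" "acts u \<phi> = (\<lambda>r. \<phi> r + of_int (3 ^ k) * \<chi> r)"
        unfolding lcong_def by blast
      then show ?thesis using r by (intro bexI[of _ "\<chi> r"]) (auto simp: lattice_def)
    qed
    then have "acts u \<phi> r - \<phi> r = 0" by (rule int_span_separated[OF finite_cosines[OF denom_pos]])
    then show ?thesis by simp
  qed
  moreover have "\<phi> r > 0" if "r \<in> S" for r using that by (simp add: \<phi>_def)
  ultimately have "cls u = \<one>\<^bsub>P\<^esub>" using tits_faithful[OF u(2)] by blast
  then show False using g u by simp
qed

text \<open>Minkowski's argument. The assumption \<open>k \<ge> 2\<close> is needed for \<open>q = 3\<close>.\<close>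

lemma congruence_torsion_step:
  assumes u: "u \<in> lists S" and q: "prime (q::nat)" and tor: "\<And>\<phi>. (acts u ^^ q) \<phi> = \<phi>"
    and k: "2 \<le> k" and triv: "\<And>\<phi>. \<phi> \<in> lattice \<Longrightarrow> lcong (3 ^ k) (acts u \<phi>) \<phi>"
    and \<phi>: "\<phi> \<in> lattice"
  shows "lcong (3 ^ Suc k) (acts u \<phi>) \<phi>"
proof -
  obtain X where X: "X \<in> lattice" "acts u \<phi> = (\<lambda>r. \<phi> r + 3 ^ k * X r)"
    using triv[OF \<phi>] by (auto simp: lcong_def)
  obtain Y where Y: "Y \<in> lattice" "acts u X = (\<lambda>r. X r + 3 ^ k * Y r)"
    using triv[OF X(1)] by (auto simp: lcong_def)
  \<comment> \<open>The binomial expansion of the j-th power of 1 + 3^k D, where D is (u - 1) / 3^k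
    on the lattice, up to terms divisible by 3^(2 k).\<close>
  have pow: "\<exists>l\<in>lattice. (acts u ^^ j) \<phi> = (\<lambda>r. \<phi> r + real j * 3 ^ k * X r + (3 ^ k * 3 ^ k) * l r)" for j
  proof (induction j)
    case 0
    show ?case by (intro bexI[of _ "\<lambda>_. 0"]) (auto simp: lattice_def int_span_zero)
  next
    case (Suc j)
    then obtain l where l: "l \<in> lattice"
      "(acts u ^^ j) \<phi> = (\<lambda>r. \<phi> r + real j * 3 ^ k * X r + (3 ^ k * 3 ^ k) * l r)" by blast
    have "(acts u ^^ Suc j) \<phi> = acts u (\<lambda>r. (\<phi> r + (real j * 3 ^ k) * X r) + (3 ^ k * 3 ^ k) * l r)"
      using l(2) by simp
    also have "\<dots> = (\<lambda>r. (acts u \<phi> r + (real j * 3 ^ k) * acts u X r) + (3 ^ k * 3 ^ k) * acts u l r)"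
      by (simp only: acts_add)
    also have "\<dots> = (\<lambda>r. \<phi> r + real (Suc j) * 3 ^ k * X r + (3 ^ k * 3 ^ k) * (of_int (int j) * Y r + acts u l r))"
      unfolding X(2) Y(2) by (rule ext) (simp add: algebra_simps)
    finally show ?case
      by (rule bexI[OF _ lattice_add[OF lattice_mult[OF Y(1)] acts_lattice[OF u l(1)]]])
  qed
  obtain l where l: "l \<in> lattice"
    "(acts u ^^ q) \<phi> = (\<lambda>r. \<phi> r + real q * 3 ^ k * X r + (3 ^ k * 3 ^ k) * l r)" using pow by blast
  have qX: "real q * X r = - (3 ^ k * l r)" for r
  proof -
    have "3 ^ k * (real q * X r + 3 ^ k * l r) = 0"
      using fun_cong[OF l(2), of r] tor by (simp add: algebra_simps)
    then show ?thesis by simp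
  qed
  obtain i where i: "k = Suc (Suc i)" using k by (metis add_2_eq_Suc less_eqE)
  \<comment> \<open>By \<open>qX\<close>, q X is divisible by 3^k. For q = 3 one factor 3 is used up
    by q, and k \<ge> 2 leaves another; for any other prime, q is inverted modulo 3 by
    Bezout.\<close>
  have "\<exists>Z\<in>lattice. X = (\<lambda>r. 3 * Z r)"
  proof (cases "q = 3")
    case True
    have "X = (\<lambda>r. 3 * (of_int (- (3 ^ i)) * l r))"
    proof
      fix r
      show "X r = 3 * (of_int (- (3 ^ i)) * l r)" using qX[of r] by (simp add: True i)
    qed
    then show ?thesis by (rule bexI[OF _ lattice_mult[OF l(1)]])
  next
    case False
    then have "coprime (int q) (int 3)"
      using q by (simp add: primes_coprime del: of_nat_numeral)
    then obtain a b where ab: "a * int q + b * 3 = 1"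
      using bezout_int[of "int q" 3] by (auto simp: coprime_iff_gcd_eq_1)
    have "X = (\<lambda>r. 3 * (of_int (- a * 3 ^ Suc i) * l r + of_int b * X r))"
    proof
      fix r
      have "X r = of_int (a * int q + b * 3) * X r" using ab by simp
      also have "\<dots> = of_int a * (real q * X r) + 3 * of_int b * X r" by (simp add: algebra_simps)
      also have "\<dots> = 3 * (of_int (- a * 3 ^ Suc i) * l r + of_int b * X r)"
        unfolding qX by (simp add: i algebra_simps)
      finally show "X r = 3 * (of_int (- a * 3 ^ Suc i) * l r + of_int b * X r)" .
    qed
    then show ?thesis by (rule bexI[OF _ lattice_add[OF lattice_mult[OF l(1)] lattice_mult[OF X(1)]]])
  qed
  then obtain Z where "Z \<in> lattice" "X = (\<lambda>r. 3 * Z r)" by blast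
  then show ?thesis unfolding lcong_def X(2) by (intro bexI[of _ Z]) auto
qed

text \<open>The previous lemma raises the exponent of 3 by one as often as desired, so g lies in
  every congruence subgroup and is trivial by \<open>congruence_separates\<close>.\<close>

lemma congruence_torsion_free:
  assumes g: "g \<in> cong_subgroup (3 ^ n)" "2 \<le> n" and q: "prime (q::nat)" "g [^]\<^bsub>P\<^esub> q = \<one>\<^bsub>P\<^esub>"
  shows "g = \<one>\<^bsub>P\<^esub>"
proof (rule ccontr)
  assume ne: "g \<noteq> \<one>\<^bsub>P\<^esub>"
  obtain u where u: "g = cls u" "u \<in> lists S" "\<forall>\<phi>\<in>lattice. lcong (3 ^ n) (acts u \<phi>) \<phi>"
    using g(1) unfolding cong_subgroup_def by blast
  have pow: "concat (replicate j u) \<in> lists S \<and> cls (concat (replicate j u)) = cls u [^]\<^bsub>P\<^esub> j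
    \<and> acts (concat (replicate j u)) = acts u ^^ j" for j :: nat
  proof (induction j)
    case (Suc j)
    then have "cls (concat (replicate (Suc j) u)) = cls u \<otimes>\<^bsub>P\<^esub> cls u [^]\<^bsub>P\<^esub> j"
      using u(2) by (simp add: cls_append)
    moreover have "acts (concat (replicate (Suc j) u)) = acts u \<circ> acts (concat (replicate j u))"
      by (rule ext) simp
    ultimately show ?case using Suc u(2) P.nat_pow_Suc2[of "cls u" j] by simp
  qed (simp add: cls_Nil)
  have "acts (concat (replicate q u)) = acts []"
    using pow[of q] q(2) u(1) by (intro acts_cong_cls) (auto simp: cls_Nil)
  then have tor: "(acts u ^^ q) \<phi> = \<phi>" for \<phi> using pow[of q] by simp
  have "\<forall>\<phi>\<in>lattice. lcong (3 ^ (n + j)) (acts u \<phi>) \<phi>" for j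
  proof (induction j)
    case (Suc j)
    then show ?case
      using congruence_torsion_step[OF u(2) q(1) tor, of "n + j"] g(2) by auto
  qed (use u in simp)
  then have "\<forall>\<phi>\<in>lattice. lcong (3 ^ k) (acts u \<phi>) \<phi>" for k
    using lcong_dvd le_imp_power_dvd[of k "n + k" "3::int"] by (metis le_add2)
  then have "g \<in> cong_subgroup (3 ^ k)" for k
    using cls_cong_subgroup[OF u(2)] u(1) by blast
  moreover have "g \<in> carrier P" using u by simp
  ultimately show False using congruence_separates ne by blast
qed

lemma cong_subgroup_antimono:
  assumes "d dvd n"
  shows "cong_subgroup n \<subseteq> cong_subgroup d"
  using lcong_dvd[OF _ assms] unfolding cong_subgroup_def by blast

text \<open>The shift by 2 meets the bound of the torsion argument. The subgroups shrink as the
  exponent grows, so the largest exponent needed for a single element of F works for all of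
  F.\<close>

theorem residual_data_congruence: "residual_data P (\<lambda>k. cong_subgroup (3 ^ (k + 2)))"
proof -
  have "\<exists>k. cong_subgroup (3 ^ (k + 2)) \<inter> F \<subseteq> {\<one>\<^bsub>P\<^esub>}" if F: "finite F" "F \<subseteq> carrier P" for F
  proof -
    have "\<forall>g. \<exists>k. g \<in> F - {\<one>\<^bsub>P\<^esub>} \<longrightarrow> g \<notin> cong_subgroup (3 ^ k)"
      using congruence_separates F(2) by (metis DiffE insertI1 subsetD)
    then obtain f where f: "\<And>g. g \<in> F - {\<one>\<^bsub>P\<^esub>} \<Longrightarrow> g \<notin> cong_subgroup (3 ^ f g)" by metis
    define k where "k = Max (insert 0 (f ` F))"
    have "g \<notin> cong_subgroup (3 ^ (k + 2))" if g: "g \<in> F - {\<one>\<^bsub>P\<^esub>}" for g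
    proof -
      have "f g \<le> k" using g F(1) by (auto simp: k_def)
      then have "(3::int) ^ f g dvd 3 ^ (k + 2)" by (intro le_imp_power_dvd) simp
      then show ?thesis using cong_subgroup_antimono f[OF g] by blast
    qed
    then show ?thesis by blast
  qed
  then show ?thesis
    unfolding residual_data_def
    using normal_congruence finite_index_congruence congruence_torsion_free[OF _ le_add2]
    by (meson zero_less_numeral zero_less_power)
qed

end

section \<open>Representations of graphs of groups\<close>

context group begin

lemma inv_cancel [simp]:
  assumes "a \<in> carrier G" "x \<in> carrier G"
  shows "inv a \<otimes> (a \<otimes> x) = x" "a \<otimes> (inv a \<otimes> x) = x"
  using assms by (simp_all flip: m_assoc)

text \<open>Used to compare two deformations with equal values on a vertex group: the quotient of
  their conjugators centralizes its image.\<close>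

lemma conj_commute_iff:
  assumes "a \<in> carrier G" "b \<in> carrier G" "c \<in> carrier G"
  shows "a \<otimes> c \<otimes> inv a = b \<otimes> c \<otimes> inv b \<longleftrightarrow> (inv b \<otimes> a) \<otimes> c = c \<otimes> (inv b \<otimes> a)"
proof
  assume *: "a \<otimes> c \<otimes> inv a = b \<otimes> c \<otimes> inv b"
  have "(inv b \<otimes> a) \<otimes> c = inv b \<otimes> (a \<otimes> c \<otimes> inv a) \<otimes> a" using assms by (simp add: m_assoc)
  also have "\<dots> = c \<otimes> (inv b \<otimes> a)" unfolding * using assms by (simp add: m_assoc)
  finally show "(inv b \<otimes> a) \<otimes> c = c \<otimes> (inv b \<otimes> a)" .
next
  assume *: "(inv b \<otimes> a) \<otimes> c = c \<otimes> (inv b \<otimes> a)"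
  have "a \<otimes> c \<otimes> inv a = b \<otimes> ((inv b \<otimes> a) \<otimes> c) \<otimes> inv a" using assms by (simp add: m_assoc)
  also have "\<dots> = b \<otimes> c \<otimes> inv b" unfolding * using assms by (simp add: m_assoc)
  finally show "a \<otimes> c \<otimes> inv a = b \<otimes> c \<otimes> inv b" .
qed

end

lemma hom_eq_on_generate:
  assumes "group G" "group H" "f \<in> hom G H" "g \<in> hom G H" "X \<subseteq> carrier G"
    and eq: "\<And>x. x \<in> X \<Longrightarrow> f x = g x" and x: "x \<in> generate G X"
  shows "f x = g x"
proof -
  interpret G: group G by fact
  interpret f: group_hom G H f using assms by (simp add: group_hom_def group_hom_axioms_def)
  interpret g: group_hom G H g using assms by (simp add: group_hom_def group_hom_axioms_def)
  show ?thesis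
    using x
  proof (induction rule: generate.induct)
    case (inv h)
    then have "h \<in> carrier G" using assms(5) by blast
    then show ?case using eq[OF inv] by simp
  next
    case (eng h1 h2)
    then have "h1 \<in> carrier G" "h2 \<in> carrier G"
      using G.generate_in_carrier[OF assms(5)] by blast+
    then show ?case using eng by simp
  qed (use eq in auto)
qed

section \<open>Potentials on maximal trees\<close>

definition arc_rel :: "('v, 'e) pre_digraph \<Rightarrow> 'e set \<Rightarrow> 'v rel" where
  "arc_rel \<Gamma> T = (\<Union>e\<in>T. {(tail \<Gamma> e, head \<Gamma> e), (head \<Gamma> e, tail \<Gamma> e)})"

lemma sym_arc_rel: "sym (arc_rel \<Gamma> T)"
  by (auto simp: arc_rel_def sym_def)

text \<open>The tree condition in terms of a plain transitive closure, and for any part U of the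
  rest of the tree, because the tree is built up edge by edge in
  \<open>tree_potential\<close>.\<close>

lemma maximal_tree_acyclic:
  assumes "wf_digraph \<Gamma>" "maximal_tree \<Gamma> T" "e \<in> T" "U \<subseteq> T - {e}"
  shows "(tail \<Gamma> e, head \<Gamma> e) \<notin> (arc_rel \<Gamma> U)\<^sup>*"
proof
  interpret wf_digraph \<Gamma> by fact
  have T: "T \<subseteq> arcs \<Gamma>" using assms(2) by (simp add: maximal_tree_def)
  define H where "H = mk_symmetric (\<Gamma>\<lparr>arcs := T - {e}\<rparr>)"
  assume "(tail \<Gamma> e, head \<Gamma> e) \<in> (arc_rel \<Gamma> U)\<^sup>*"
  then have "(tail \<Gamma> e, head \<Gamma> e) \<in> rtrancl_on (verts (with_proj H)) (arcs_ends (with_proj H))"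
  proof (induction rule: rtrancl_induct)
    case base
    show ?case using T assms(3) by (auto simp: H_def)
  next
    case (step y z)
    then obtain f where f: "f \<in> U" "(y, z) = (tail \<Gamma> f, head \<Gamma> f) \<or> (y, z) = (head \<Gamma> f, tail \<Gamma> f)"
      by (auto simp: arc_rel_def)
    then have "(y, z) \<in> arcs_ends (with_proj H)"
      using assms(4) by (auto simp: H_def parcs_mk_symmetric)
    moreover have "z \<in> verts (with_proj H)" using f assms(4) T by (auto simp: H_def)
    ultimately show ?case using step.IH by (rule rtrancl_on_into_rtrancl_on[rotated])
  qed
  then have "tail \<Gamma> e \<rightarrow>\<^sup>*\<^bsub>with_proj H\<^esub> head \<Gamma> e" by (simp add: reachable_def)
  then show False using assms(2,3) by (auto simp: maximal_tree_def H_def)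
qed

text \<open>Edges are added one at a time; a new edge of the tree joins two different components, and
  the values on one of them may be translated.\<close>

lemma tree_potential:
  fixes K (structure)
  assumes "group K" "wf_digraph \<Gamma>" "maximal_tree \<Gamma> T" "finite T" "z \<in> T \<rightarrow> carrier K"
  obtains \<omega> where "\<And>v. \<omega> v \<in> carrier K"
    "\<And>e. e \<in> T \<Longrightarrow> \<omega> (head \<Gamma> e) = \<omega> (tail \<Gamma> e) \<otimes> z e"
proof -
  interpret group K by fact
  have "\<exists>\<omega>. (\<forall>v. \<omega> v \<in> carrier K) \<and> (\<forall>e\<in>T. \<omega> (head \<Gamma> e) = \<omega> (tail \<Gamma> e) \<otimes> z e)"
    using assms(4)
  proof (rule finite_subset_induct'[OF _ subset_refl])
    show "\<exists>\<omega>. (\<forall>v. \<omega> v \<in> carrier K) \<and> (\<forall>e\<in>{}. \<omega> (head \<Gamma> e) = \<omega> (tail \<Gamma> e) \<otimes> z e)"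
      by (intro exI[of _ "\<lambda>_. \<one>"]) simp
  next
    fix e U assume e: "e \<in> T" "U \<subseteq> T" "e \<notin> U"
      and "\<exists>\<omega>. (\<forall>v. \<omega> v \<in> carrier K) \<and> (\<forall>e\<in>U. \<omega> (head \<Gamma> e) = \<omega> (tail \<Gamma> e) \<otimes> z e)"
    then obtain \<omega> where \<omega>: "\<And>v. \<omega> v \<in> carrier K"
      "\<And>e. e \<in> U \<Longrightarrow> \<omega> (head \<Gamma> e) = \<omega> (tail \<Gamma> e) \<otimes> z e" by blast
    \<comment> \<open>Left translation by g respects the equations inside a component, since z
      multiplies on the right. This g makes the equation at e hold once the component of its head is
      translated.\<close>
    define g where "g = \<omega> (tail \<Gamma> e) \<otimes> z e \<otimes> inv (\<omega> (head \<Gamma> e))"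
    define C where "C = (arc_rel \<Gamma> U)\<^sup>* `` {head \<Gamma> e}"
    define \<omega>' where "\<omega>' v = (if v \<in> C then g \<otimes> \<omega> v else \<omega> v)" for v
    have ze: "z e \<in> carrier K" using e assms(5) by blast
    have g: "g \<in> carrier K" using \<omega>(1) ze by (simp add: g_def)
    have tC: "tail \<Gamma> e \<notin> C"
    proof
      assume "tail \<Gamma> e \<in> C"
      then have "(tail \<Gamma> e, head \<Gamma> e) \<in> (arc_rel \<Gamma> U)\<^sup>*"
        using symD[OF sym_rtrancl[OF sym_arc_rel]] by (simp add: C_def)
      then show False using maximal_tree_acyclic[OF assms(2,3) e(1), of U] e by blast
    qed
    have "\<omega>' (head \<Gamma> f) = \<omega>' (tail \<Gamma> f) \<otimes> z f" if f: "f \<in> U" for f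
    proof -
      have ends: "(tail \<Gamma> f, head \<Gamma> f) \<in> arc_rel \<Gamma> U" "(head \<Gamma> f, tail \<Gamma> f) \<in> arc_rel \<Gamma> U"
        using f by (auto simp: arc_rel_def)
      then have "head \<Gamma> f \<in> C \<longleftrightarrow> tail \<Gamma> f \<in> C"
        unfolding C_def by (meson Image_singleton_iff rtrancl.rtrancl_into_rtrancl)
      moreover have "z f \<in> carrier K" using f e assms(5) by blast
      ultimately show ?thesis using \<omega>(2)[OF f] \<omega>(1) g by (simp add: \<omega>'_def m_assoc)
    qed
    moreover have "\<omega>' (head \<Gamma> e) = \<omega>' (tail \<Gamma> e) \<otimes> z e"
    proof -
      have "head \<Gamma> e \<in> C" by (simp add: C_def)
      then show ?thesis using tC \<omega>(1) ze by (simp add: \<omega>'_def g_def m_assoc)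
    qed
    moreover have "\<omega>' v \<in> carrier K" for v using \<omega>(1) g by (simp add: \<omega>'_def)
    ultimately show "\<exists>\<omega>. (\<forall>v. \<omega> v \<in> carrier K) \<and>
        (\<forall>e\<in>insert e U. \<omega> (head \<Gamma> e) = \<omega> (tail \<Gamma> e) \<otimes> z e)"
      by blast
  qed
  then show ?thesis using that by blast
qed

text \<open>Only the conjugacy class of the two restrictions to an edge group matters, so \<open>(\<sigma>, h)\<close> survives
  the conjugation of edge maps in a splitting.\<close>

definition gog_rep :: "('k, 'm) monoid_scheme \<Rightarrow> ('v, 'e, 'g) graph_of_groups \<Rightarrow>
    ('v \<Rightarrow> 'g \<Rightarrow> 'k) \<Rightarrow> ('e \<Rightarrow> 'g \<Rightarrow> 'k) \<Rightarrow> bool" where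
  "gog_rep K \<Lambda> \<sigma> h \<longleftrightarrow>
    (\<forall>v\<in>verts (graph \<Lambda>). \<sigma> v \<in> hom (vertex_group \<Lambda> v) K) \<and>
    (\<forall>e\<in>arcs (graph \<Lambda>). h e \<in> carrier (edge_group \<Lambda> e) \<rightarrow> carrier K \<and>
      (\<forall>d. \<exists>y\<in>carrier K. \<forall>c\<in>carrier (edge_group \<Lambda> e).
        \<sigma> (endpoint \<Lambda> e d) (edge_map \<Lambda> e d c) = y \<otimes>\<^bsub>K\<^esub> h e c \<otimes>\<^bsub>K\<^esub> inv\<^bsub>K\<^esub> y))"

locale finite_gog =
  fixes \<Lambda> :: "('v, 'e, 'g) graph_of_groups"
  assumes finite_gog: "finite_graph_of_groups \<Lambda>"
begin

abbreviation "VS \<equiv> verts (graph \<Lambda>)"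
abbreviation "ES \<equiv> arcs (graph \<Lambda>)"
abbreviation "VG v \<equiv> carrier (vertex_group \<Lambda> v)"
abbreviation "EG e \<equiv> carrier (edge_group \<Lambda> e)"
abbreviation "endp \<equiv> endpoint \<Lambda>"
abbreviation "emap \<equiv> edge_map \<Lambda>"

sublocale fin_digraph "graph \<Lambda>"
  using finite_gog by (simp add: finite_graph_of_groups_def)

lemma group_vertex: "v \<in> VS \<Longrightarrow> group (vertex_group \<Lambda> v)"
  using finite_gog by (simp add: finite_graph_of_groups_def)

lemma group_edge: "e \<in> ES \<Longrightarrow> group (edge_group \<Lambda> e)"
  using finite_gog by (simp add: finite_graph_of_groups_def)

lemma emap_mon: "e \<in> ES \<Longrightarrow> emap e d \<in> mon (edge_group \<Lambda> e) (vertex_group \<Lambda> (endp e d))"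
  using finite_gog unfolding finite_graph_of_groups_def by blast

lemma edge_map_closed: "e \<in> ES \<Longrightarrow> c \<in> EG e \<Longrightarrow> emap e d c \<in> VG (endp e d)"
  using emap_mon unfolding mon_def hom_def by blast

lemma endpoint_in_verts: "e \<in> ES \<Longrightarrow> endp e d \<in> VS"
  by (simp add: endpoint_def)

end

section \<open>Homomorphisms out of the fundamental group\<close>

locale finite_gog_tree = finite_gog \<Lambda> for \<Lambda> :: "('v, 'e, 'g) graph_of_groups" +
  fixes T :: "'e set"
  assumes tree: "maximal_tree (graph \<Lambda>) T"
begin

abbreviation "gens \<equiv> pi1_generators \<Lambda>"
abbreviation "rels \<equiv> pi1_relators \<Lambda> T"
abbreviation "pi1 \<equiv> fundamental_group \<Lambda> T"

lemma group_pi1: "group pi1"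
  by (simp add: fundamental_group_def group_presented_group)

sublocale P: group pi1
  by (rule group_pi1)

lemma tree_arcs: "T \<subseteq> ES"
  using tree by (simp add: maximal_tree_def)

definition vcls :: "'v \<Rightarrow> 'g \<Rightarrow> ('v \<times> 'g + 'e) word set" where
  "vcls v x = pres_class gens rels [(Inl (v, x), True)]"

definition ecls :: "'e \<Rightarrow> ('v \<times> 'g + 'e) word set" where
  "ecls e = pres_class gens rels [(Inr e, True)]"

lemma vcls_closed:
  "v \<in> VS \<Longrightarrow> x \<in> VG v \<Longrightarrow> vcls v x \<in> carrier pi1"
  unfolding vcls_def fundamental_group_def by (rule pres_class_carrier) (auto simp: pi1_generators_def)

lemma ecls_closed: "e \<in> ES \<Longrightarrow> ecls e \<in> carrier pi1"
  unfolding ecls_def fundamental_group_def by (rule pres_class_carrier) (auto simp: pi1_generators_def)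

text \<open>The identity map is a homomorphism, so evaluating a relator at the classes of its
  letters yields the class of the relator, which is trivial. In this form the relators become
  equations between \<open>vcls\<close> and \<open>ecls\<close>.\<close>

lemma pi1_relator:
  assumes "r \<in> rels" "r \<in> words gens"
  shows "word_val pi1 (case_sum (\<lambda>(v, x). vcls v x) ecls) r
    = \<one>\<^bsub>pi1\<^esub>"
proof -
  have "(\<lambda>s. pres_class gens rels [(s, True)])
    = case_sum (\<lambda>(v, x). vcls v x) ecls"
    by (rule ext) (auto simp: vcls_def ecls_def split: sum.split)
  moreover have "(\<lambda>x. x) (pres_class gens rels r)
    = word_val pi1
        (\<lambda>s. (\<lambda>x. x) (pres_class gens rels [(s, True)])) r"
    unfolding fundamental_group_def
    by (rule hom_presented_group[where h = "\<lambda>x. x", OF group_presented_group _ assms(2)])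
       (simp add: hom_def)
  ultimately show ?thesis
    using relator_eq_one[OF assms] by (simp add: fundamental_group_def)
qed

lemma vcls_hom:
  assumes "v \<in> VS"
  shows "vcls v \<in> hom (vertex_group \<Lambda> v) pi1"
proof (rule homI)
  interpret V: group "vertex_group \<Lambda> v" by (rule group_vertex[OF assms])
  fix x y assume xy: "x \<in> VG v" "y \<in> VG v"
  show "vcls v x \<in> carrier pi1" using vcls_closed[OF assms xy(1)] .
  let ?r = "[(Inl (v, x), True), (Inl (v, y), True), (Inl (v, x \<otimes>\<^bsub>vertex_group \<Lambda> v\<^esub> y), False)]"
  have "word_val pi1 (case_sum (\<lambda>(v, x). vcls v x) ecls) ?r
    = \<one>\<^bsub>pi1\<^esub>"
    using assms xy by (intro pi1_relator) (auto simp: pi1_relators_def pi1_generators_def)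
  then have "vcls v x \<otimes>\<^bsub>pi1\<^esub> vcls v y \<otimes>\<^bsub>pi1\<^esub>
      inv\<^bsub>pi1\<^esub> vcls v (x \<otimes>\<^bsub>vertex_group \<Lambda> v\<^esub> y) = \<one>\<^bsub>pi1\<^esub>"
    using xy assms by (simp add: vcls_closed P.m_assoc)
  then show "vcls v (x \<otimes>\<^bsub>vertex_group \<Lambda> v\<^esub> y)
    = vcls v x \<otimes>\<^bsub>pi1\<^esub> vcls v y"
    using xy assms by (metis P.inv_closed P.inv_equality P.inv_inv P.m_closed V.m_closed vcls_closed)
qed

lemma ecls_conj:
  assumes "e \<in> ES" "c \<in> EG e"
  shows "ecls e \<otimes>\<^bsub>pi1\<^esub> vcls (endp e True) (emap e True c)
      \<otimes>\<^bsub>pi1\<^esub> inv\<^bsub>pi1\<^esub> ecls e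
    = vcls (endp e False) (emap e False c)"
proof -
  let ?r = "[(Inr e, True), (Inl (endp e True, emap e True c), True), (Inr e, False),
      (Inl (endp e False, emap e False c), False)]"
  have cl: "vcls (endp e d) (emap e d c) \<in> carrier pi1" for d
    using vcls_closed endpoint_in_verts edge_map_closed assms by metis
  have "word_val pi1 (case_sum (\<lambda>(v, x). vcls v x) ecls) ?r
    = \<one>\<^bsub>pi1\<^esub>"
    using assms edge_map_closed[OF assms] endpoint_in_verts[OF assms(1)]
    by (intro pi1_relator) (auto simp: pi1_relators_def pi1_generators_def)
  then have "ecls e \<otimes>\<^bsub>pi1\<^esub> vcls (endp e True) (emap e True c)
      \<otimes>\<^bsub>pi1\<^esub> inv\<^bsub>pi1\<^esub> ecls e \<otimes>\<^bsub>pi1\<^esub>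
      inv\<^bsub>pi1\<^esub> vcls (endp e False) (emap e False c)
      = \<one>\<^bsub>pi1\<^esub>"
    using cl ecls_closed[OF assms(1)] by (simp add: P.m_assoc)
  then show ?thesis
    using cl ecls_closed[OF assms(1)] by (metis P.inv_closed P.inv_equality P.inv_inv P.m_closed)
qed

lemma ecls_tree:
  assumes "e \<in> T"
  shows "ecls e = \<one>\<^bsub>pi1\<^esub>"
proof -
  have "word_val pi1 (case_sum (\<lambda>(v, x). vcls v x) ecls) [(Inr e, True)]
    = \<one>\<^bsub>pi1\<^esub>"
    using assms tree_arcs by (intro pi1_relator) (auto simp: pi1_relators_def pi1_generators_def)
  then show ?thesis using ecls_closed[of e] assms tree_arcs by auto
qed

lemma pi1_hom:
  fixes K (structure)
  assumes "group K" and \<sigma>: "\<And>v. v \<in> VS \<Longrightarrow> \<sigma> v \<in> hom (vertex_group \<Lambda> v) K"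
    and \<tau>: "\<And>e. e \<in> ES \<Longrightarrow> \<tau> e \<in> carrier K"
    and conj: "\<And>e c. e \<in> ES \<Longrightarrow> c \<in> EG e \<Longrightarrow>
      \<tau> e \<otimes> \<sigma> (endp e True) (emap e True c) \<otimes> inv (\<tau> e)
        = \<sigma> (endp e False) (emap e False c)"
    and one: "\<And>e. e \<in> T \<Longrightarrow> \<tau> e = \<one>"
  obtains \<Psi> where "\<Psi> \<in> hom pi1 K"
    "\<And>v x. v \<in> VS \<Longrightarrow> x \<in> VG v \<Longrightarrow> \<Psi> (vcls v x) = \<sigma> v x"
    "\<And>e. e \<in> ES \<Longrightarrow> \<Psi> (ecls e) = \<tau> e"
proof -
  interpret group K by fact
  define f where "f = case_sum (\<lambda>(v, x). \<sigma> v x) \<tau>"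
  have \<sigma>cl: "\<sigma> v x \<in> carrier K" if "v \<in> VS" "x \<in> VG v" for v x
    using \<sigma>[OF that(1)] that(2) by (rule hom_in_carrier)
  have f: "f \<in> gens \<rightarrow> carrier K"
    using \<sigma>cl \<tau> by (auto simp: pi1_generators_def f_def)
  have R: "word_val K f r = \<one>" if r: "r \<in> rels" for r
    using r unfolding pi1_relators_def
  proof (elim UnE)
    assume "r \<in> {[(Inl (v, x), True), (Inl (v, y), True), (Inl (v, x \<otimes>\<^bsub>vertex_group \<Lambda> v\<^esub> y), False)] | v x y.
      v \<in> VS \<and> x \<in> VG v \<and> y \<in> VG v}"
    then obtain v x y where *: "v \<in> VS" "x \<in> VG v" "y \<in> VG v"
      "r = [(Inl (v, x), True), (Inl (v, y), True), (Inl (v, x \<otimes>\<^bsub>vertex_group \<Lambda> v\<^esub> y), False)]" by blast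
    have "\<sigma> v (x \<otimes>\<^bsub>vertex_group \<Lambda> v\<^esub> y) = \<sigma> v x \<otimes> \<sigma> v y" using hom_mult[OF \<sigma>] * by blast
    then show ?thesis using * \<sigma>cl[of v x] \<sigma>cl[of v y] by (simp add: f_def m_assoc inv_mult_group)
  next
    assume "r \<in> {[(Inr e, True), (Inl (endp e True, emap e True c), True), (Inr e, False),
      (Inl (endp e False, emap e False c), False)] | e c.
      e \<in> ES \<and> c \<in> EG e}"
    then obtain e c where *: "e \<in> ES" "c \<in> EG e"
      "r = [(Inr e, True), (Inl (endp e True, emap e True c), True), (Inr e, False),
      (Inl (endp e False, emap e False c), False)]" by blast
    have cl: "\<sigma> (endp e d) (emap e d c) \<in> carrier K" for d
      using \<sigma>cl endpoint_in_verts edge_map_closed * by metis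
    have "word_val K f r = (\<tau> e \<otimes> \<sigma> (endp e True) (emap e True c) \<otimes> inv (\<tau> e))
      \<otimes> inv (\<sigma> (endp e False) (emap e False c))"
      using * cl \<tau>[of e] by (simp add: f_def m_assoc)
    then show ?thesis using conj[of e c] * cl[of False] by simp
  next
    assume "r \<in> {[(Inr e, True)] | e. e \<in> T}"
    then show ?thesis using one by (auto simp: f_def)
  qed
  obtain \<Psi> where \<Psi>: "\<Psi> \<in> hom (presented_group gens rels) K"
    "\<And>w. w \<in> words gens \<Longrightarrow>
      \<Psi> (pres_class gens rels w) = word_val K f w"
    using presented_group_hom[OF f R] by metis
  have "\<Psi> (vcls v x) = \<sigma> v x" if "v \<in> VS" "x \<in> VG v" for v x
  proof -
    have "Inl (v, x) \<in> gens" using that by (auto simp: pi1_generators_def)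
    then show ?thesis
      using \<Psi>(2)[of "[(Inl (v, x), True)]"] \<sigma>cl[OF that] by (simp add: vcls_def f_def)
  qed
  moreover have "\<Psi> (ecls e) = \<tau> e" if "e \<in> ES" for e
  proof -
    have "Inr e \<in> gens" using that by (auto simp: pi1_generators_def)
    then show ?thesis
      using \<Psi>(2)[of "[(Inr e, True)]"] \<tau>[OF that] by (simp add: ecls_def f_def)
  qed
  ultimately show ?thesis using that \<Psi>(1) by (simp add: fundamental_group_def)
qed

text \<open>The conjugators at the two ends of e prescribe a value \<open>z e\<close> for the stable
  letter. Conjugating the vertex maps by a potential \<omega> for z makes the stable letters along
  the tree trivial, as the presentation demands.\<close>

lemma pi1_hom_of_rep:
  fixes K (structure)
  assumes "group K" and rep: "gog_rep K \<Lambda> \<sigma> h"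
  shows "\<exists>\<Psi> \<omega>. \<Psi> \<in> hom pi1 K \<and> (\<forall>v. \<omega> v \<in> carrier K) \<and>
    (\<forall>v\<in>VS. \<forall>x\<in>VG v.
      \<Psi> (vcls v x) = \<omega> v \<otimes> \<sigma> v x \<otimes> inv (\<omega> v))"
proof -
  interpret group K by fact
  have "\<forall>e d. \<exists>y. e \<in> ES \<longrightarrow> y \<in> carrier K \<and> (\<forall>c\<in>EG e.
        \<sigma> (endp e d) (emap e d c) = y \<otimes> h e c \<otimes> inv y)"
    using rep unfolding gog_rep_def by blast
  then obtain y where y: "\<And>e d. e \<in> ES \<Longrightarrow> y e d \<in> carrier K"
    "\<And>e d c. e \<in> ES \<Longrightarrow> c \<in> EG e \<Longrightarrow>
        \<sigma> (endp e d) (emap e d c) = y e d \<otimes> h e c \<otimes> inv (y e d)"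
    by metis
  define z where "z e = y e False \<otimes> inv (y e True)" for e
  have "z \<in> T \<rightarrow> carrier K" using y(1) tree_arcs by (auto simp: z_def)
  then obtain \<omega> where \<omega>: "\<And>v. \<omega> v \<in> carrier K"
    "\<And>e. e \<in> T \<Longrightarrow> \<omega> (head (graph \<Lambda>) e) = \<omega> (tail (graph \<Lambda>) e) \<otimes> z e"
    using tree_potential[OF assms(1) wf_digraph tree] finite_subset[OF tree_arcs] by auto
  define \<tau> where "\<tau> e = \<omega> (tail (graph \<Lambda>) e) \<otimes> z e \<otimes> inv (\<omega> (head (graph \<Lambda>) e))" for e
  define \<sigma>' where "\<sigma>' v x = \<omega> v \<otimes> \<sigma> v x \<otimes> inv (\<omega> v)" for v x
  have zc: "z e \<in> carrier K" if "e \<in> ES" for e using y(1) that by (simp add: z_def)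
  have \<sigma>h: "\<sigma> v \<in> hom (vertex_group \<Lambda> v) K" if "v \<in> VS" for v
    using rep that by (simp add: gog_rep_def)
  have 1: "\<sigma>' v \<in> hom (vertex_group \<Lambda> v) K" if v: "v \<in> VS" for v
  proof (rule homI)
    fix x x' assume x: "x \<in> VG v" "x' \<in> VG v"
    have "\<sigma> v x \<in> carrier K" "\<sigma> v x' \<in> carrier K" using hom_in_carrier[OF \<sigma>h[OF v]] x by auto
    then show "\<sigma>' v x \<in> carrier K" "\<sigma>' v (x \<otimes>\<^bsub>vertex_group \<Lambda> v\<^esub> x') = \<sigma>' v x \<otimes> \<sigma>' v x'"
      using \<omega>(1)[of v] hom_mult[OF \<sigma>h[OF v] x] by (simp_all add: \<sigma>'_def m_assoc)
  qed
  have 2: "\<tau> e \<in> carrier K" if "e \<in> ES" for e using \<omega>(1) zc[OF that] by (simp add: \<tau>_def)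
  have 3: "\<tau> e \<otimes> \<sigma>' (endp e True) (emap e True c) \<otimes> inv (\<tau> e)
        = \<sigma>' (endp e False) (emap e False c)"
    if e: "e \<in> ES" and c: "c \<in> EG e" for e c
  proof -
    have hc: "h e c \<in> carrier K" using rep e c unfolding gog_rep_def by blast
    note y1 = y(1)[OF e, of True] y(1)[OF e, of False]
    show ?thesis
      unfolding \<sigma>'_def y(2)[OF e c]
      using y1 hc \<omega>(1) by (simp add: \<tau>_def z_def endpoint_def m_assoc inv_mult_group)
  qed
  have 4: "\<tau> e = \<one>" if e: "e \<in> T" for e
    using \<omega>(2)[OF e] \<omega>(1) zc tree_arcs e unfolding \<tau>_def by (metis r_inv)
  show ?thesis
  proof (rule pi1_hom[where \<sigma> = \<sigma>' and \<tau> = \<tau>, OF assms(1) 1 2 3 4])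
    fix \<Psi> assume "\<Psi> \<in> hom pi1 K"
      "\<And>v x. v \<in> VS \<Longrightarrow> x \<in> VG v \<Longrightarrow> \<Psi> (vcls v x) = \<sigma>' v x"
    then show ?thesis using \<omega>(1) by (intro exI[of _ \<Psi>] exI[of _ \<omega>]) (simp add: \<sigma>'_def)
  qed
qed

text \<open>Edge groups are mapped through their tail. At the head, \<open>ecls_conj\<close>
  supplies the inverse of the stable letter as conjugator.\<close>

lemma rep_of_pi1_hom:
  fixes K (structure)
  assumes "group K" and \<phi>: "\<phi> \<in> hom pi1 K"
  shows "gog_rep K \<Lambda> (\<lambda>v x. \<phi> (vcls v x))
    (\<lambda>e c. \<phi> (vcls (endp e False) (emap e False c)))"
proof -
  interpret group K by fact
  interpret \<phi>: group_hom "pi1" K \<phi>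
    using \<phi> by (simp add: group_hom_def group_hom_axioms_def)
  show ?thesis
    unfolding gog_rep_def
  proof (intro conjI ballI allI)
    fix v assume v: "v \<in> VS"
    show "(\<lambda>x. \<phi> (vcls v x)) \<in> hom (vertex_group \<Lambda> v) K"
      using hom_mult[OF vcls_hom[OF v]] vcls_closed[OF v] by (intro homI) simp_all
  next
    fix e assume e: "e \<in> ES"
    have cl: "vcls (endp e d) (emap e d c) \<in> carrier pi1"
      if "c \<in> EG e" for c d
      using vcls_closed endpoint_in_verts edge_map_closed e that by metis
    then show "(\<lambda>c. \<phi> (vcls (endp e False) (emap e False c)))
      \<in> EG e \<rightarrow> carrier K" by auto
    fix d
    define y where "y = (if d then inv (\<phi> (ecls e)) else \<one>)"
    have ec: "\<phi> (ecls e) \<in> carrier K" using ecls_closed[OF e] by simp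
    show "\<exists>y\<in>carrier K. \<forall>c\<in>EG e.
      \<phi> (vcls (endp e d) (emap e d c))
        = y \<otimes> \<phi> (vcls (endp e False) (emap e False c)) \<otimes> inv y"
    proof (intro bexI ballI)
      show "y \<in> carrier K" using ec by (simp add: y_def)
      fix c assume c: "c \<in> EG e"
      have t: "\<phi> (vcls (endp e False) (emap e False c))
        = \<phi> (ecls e) \<otimes> \<phi> (vcls (endp e True) (emap e True c)) \<otimes> inv (\<phi> (ecls e))"
        unfolding ecls_conj[OF e c, symmetric] using cl[OF c] ecls_closed[OF e] by simp
      show "\<phi> (vcls (endp e d) (emap e d c))
        = y \<otimes> \<phi> (vcls (endp e False) (emap e False c)) \<otimes> inv y"
      proof (cases d)
        case True
        then show ?thesis unfolding t using cl[OF c, of True] ec by (simp add: y_def m_assoc)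
      next
        case False
        then show ?thesis using cl[OF c, of False] by (simp add: y_def)
      qed
    qed
  qed
qed

end

section \<open>Counting deformed homomorphisms\<close>

lemma card_fibers_le:
  assumes "finite A" "\<And>y. y \<in> f ` A \<Longrightarrow> card {x \<in> A. f x = y} \<le> n"
  shows "card A \<le> card (f ` A) * n"
proof -
  have "A = (\<Union>y\<in>f ` A. {x \<in> A. f x = y})" by blast
  then have "card A \<le> (\<Sum>y\<in>f ` A. card {x \<in> A. f x = y})"
    using card_UN_le[of "f ` A" "\<lambda>y. {x \<in> A. f x = y}"] assms(1) by simp
  also have "\<dots> \<le> card (f ` A) * n" using sum_bounded_above[of "f ` A" _ n] assms(2) by simp
  finally show ?thesis .
qed

context finite_gog_tree begin

text \<open>A family \<open>z\<close> of elements of \<open>N\<close> centralizing the edge groups deforms \<open>\<phi>\<close> into another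
  homomorphism, and the deformation determines \<open>z\<close> up to elements centralizing the vertex groups.\<close>

lemma deformation_count:
  fixes K (structure) and \<phi>
  assumes "group K" and finK: "finite (carrier K)" and N: "subgroup N K"
    and \<phi>: "\<phi> \<in> hom pi1 K"
    and X: "finite X" "X \<subseteq> carrier pi1"
      "generate pi1 X = carrier pi1"
  defines "ZV \<equiv> \<lambda>v. {n \<in> N. \<forall>x\<in>VG v. n \<otimes> \<phi> (vcls v x) = \<phi> (vcls v x) \<otimes> n}"
    and "ZE \<equiv> \<lambda>e. {n \<in> N. \<forall>c\<in>EG e.
      n \<otimes> \<phi> (vcls (endp e True) (emap e True c))
        = \<phi> (vcls (endp e True) (emap e True c)) \<otimes> n}"
  shows "(\<Prod>e\<in>ES. card (ZE e))
    \<le> card (carrier K) ^ card X * (\<Prod>v\<in>VS. card (ZV v))"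
proof -
  interpret group K by fact
  interpret \<phi>: group_hom "pi1" K \<phi>
    using \<phi> by (simp add: group_hom_def group_hom_axioms_def)
  interpret N: subgroup N K by fact
  have finN: "finite N" using finite_subset[OF N.subset finK] .
  have fins: "finite (ZE e)" "finite (ZV v)" for e v using finN by (auto simp: ZE_def ZV_def)
  define Z where "Z = (\<Pi>\<^sub>E e\<in>ES. ZE e)"
  have vc: "\<phi> (vcls v x) \<in> carrier K" if "v \<in> VS" "x \<in> VG v" for v x
    using vcls_closed[OF that] by simp
  have ec: "\<phi> (ecls e) \<in> carrier K" if "e \<in> ES" for e
    using ecls_closed[OF that] by simp
  \<comment> \<open>The stable letter is multiplied by \<open>z e\<close>, which centralizes the
    edge group at the head, and is then adjusted by the potential so that it stays trivial on the
    tree.\<close>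
  define \<tau> where "\<tau> z \<omega> e = \<omega> (tail (graph \<Lambda>) e) \<otimes> \<phi> (ecls e) \<otimes> z e \<otimes> inv (\<omega> (head (graph \<Lambda>) e))"
    for z \<omega> e
  have "\<exists>\<Psi> \<omega>. \<Psi> \<in> hom pi1 K \<and> (\<forall>v. \<omega> v \<in> N) \<and>
      (\<forall>v\<in>VS. \<forall>x\<in>VG v.
        \<Psi> (vcls v x) = \<omega> v \<otimes> \<phi> (vcls v x) \<otimes> inv (\<omega> v)) \<and>
      (\<forall>e\<in>ES. \<Psi> (ecls e) = \<tau> z \<omega> e)" if z: "z \<in> Z" for z
  proof -
    have zN: "z e \<in> N" if "e \<in> ES" for e using z that by (auto simp: Z_def ZE_def)
    then have zK: "z e \<in> carrier K" if "e \<in> ES" for e using that by auto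
    \<comment> \<open>The potential is formed in N rather than in K, so that quotients of its values
      can be counted by \<open>ZV\<close>.\<close>
    have "z \<in> T \<rightarrow> carrier (K\<lparr>carrier := N\<rparr>)" using zN tree_arcs by auto
    then obtain \<omega> where \<omega>: "\<And>v. \<omega> v \<in> N"
      "\<And>e. e \<in> T \<Longrightarrow> \<omega> (head (graph \<Lambda>) e) = \<omega> (tail (graph \<Lambda>) e) \<otimes> z e"
      using tree_potential[OF subgroup_imp_group[OF N] wf_digraph tree] finite_subset[OF tree_arcs] by auto
    have \<omega>K: "\<omega> v \<in> carrier K" for v using \<omega>(1) by auto
    define \<sigma>' where "\<sigma>' v x = \<omega> v \<otimes> \<phi> (vcls v x) \<otimes> inv (\<omega> v)" for v x
    have 1: "\<sigma>' v \<in> hom (vertex_group \<Lambda> v) K" if v: "v \<in> VS" for v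
    proof (rule homI)
      fix x x' assume x: "x \<in> VG v" "x' \<in> VG v"
      show "\<sigma>' v x \<in> carrier K" using vc[OF v] x \<omega>K by (simp add: \<sigma>'_def)
      show "\<sigma>' v (x \<otimes>\<^bsub>vertex_group \<Lambda> v\<^esub> x') = \<sigma>' v x \<otimes> \<sigma>' v x'"
        using vc[OF v] x \<omega>K[of v] hom_mult[OF vcls_hom[OF v] x]
          vcls_closed[OF v]
        by (simp add: \<sigma>'_def m_assoc)
    qed
    have 2: "\<tau> z \<omega> e \<in> carrier K" if "e \<in> ES" for e
      using \<omega>K zK[OF that] ec[OF that] by (simp add: \<tau>_def)
    have 3: "\<tau> z \<omega> e \<otimes> \<sigma>' (endp e True) (emap e True c) \<otimes> inv (\<tau> z \<omega> e)
        = \<sigma>' (endp e False) (emap e False c)"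
      if e: "e \<in> ES" and c: "c \<in> EG e" for e c
    proof -
      let ?h = "\<lambda>d. vcls (endp e d) (emap e d c)"
      have hP: "?h d \<in> carrier pi1" for d
        by (rule vcls_closed[OF endpoint_in_verts[OF e] edge_map_closed[OF e c]])
      then have h: "\<phi> (?h d) \<in> carrier K" for d by simp
      have "z e \<in> ZE e" using z e by (auto simp: Z_def)
      then have comm: "z e \<otimes> \<phi> (?h True) = \<phi> (?h True) \<otimes> z e" using c by (simp add: ZE_def)
      have t: "\<phi> (?h False) = \<phi> (ecls e) \<otimes> \<phi> (?h True) \<otimes> inv (\<phi> (ecls e))"
        unfolding ecls_conj[OF e c, symmetric] using hP ecls_closed[OF e] by simp
      have "\<tau> z \<omega> e \<otimes> \<sigma>' (endp e True) (emap e True c) \<otimes> inv (\<tau> z \<omega> e)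
        = \<omega> (tail (graph \<Lambda>) e) \<otimes> \<phi> (ecls e) \<otimes> (z e \<otimes> \<phi> (?h True)) \<otimes> inv (z e)
          \<otimes> inv (\<phi> (ecls e)) \<otimes> inv (\<omega> (tail (graph \<Lambda>) e))"
        using \<omega>K zK[OF e] ec[OF e] h[of True]
        by (simp add: \<tau>_def \<sigma>'_def endpoint_def m_assoc inv_mult_group)
      also have "\<dots> = \<omega> (tail (graph \<Lambda>) e) \<otimes> \<phi> (?h False) \<otimes> inv (\<omega> (tail (graph \<Lambda>) e))"
        unfolding comm t using \<omega>K zK[OF e] ec[OF e] h[of True] by (simp add: m_assoc)
      finally show ?thesis by (simp add: \<sigma>'_def endpoint_def)
    qed
    have 4: "\<tau> z \<omega> e = \<one>" if e: "e \<in> T" for e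
    proof -
      have "\<phi> (ecls e) = \<one>" using ecls_tree[OF e] by simp
      then show ?thesis using \<omega>(2)[OF e] \<omega>K[of "tail (graph \<Lambda>) e"] zK[of e] e tree_arcs
        unfolding \<tau>_def by (auto simp: subset_iff)
    qed
    show ?thesis
    proof (rule pi1_hom[where \<sigma> = \<sigma>' and \<tau> = "\<tau> z \<omega>", OF assms(1) 1 2 3 4])
      fix \<Psi> assume "\<Psi> \<in> hom pi1 K"
        "\<And>v x. v \<in> VS \<Longrightarrow> x \<in> VG v \<Longrightarrow> \<Psi> (vcls v x) = \<sigma>' v x"
        "\<And>e. e \<in> ES \<Longrightarrow> \<Psi> (ecls e) = \<tau> z \<omega> e"
      then show ?thesis using \<omega>(1) by (intro exI[of _ \<Psi>] exI[of _ \<omega>]) (simp add: \<sigma>'_def)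
    qed
  qed
  then obtain \<Psi> \<omega> where \<Psi>: "\<And>z. z \<in> Z \<Longrightarrow> \<Psi> z \<in> hom pi1 K"
    and \<omega>: "\<And>z v. z \<in> Z \<Longrightarrow> \<omega> z v \<in> N"
    and \<Psi>v: "\<And>z v x. z \<in> Z \<Longrightarrow> v \<in> VS \<Longrightarrow> x \<in> VG v \<Longrightarrow>
        \<Psi> z (vcls v x) = \<omega> z v \<otimes> \<phi> (vcls v x) \<otimes> inv (\<omega> z v)"
    and \<Psi>e: "\<And>z e. z \<in> Z \<Longrightarrow> e \<in> ES \<Longrightarrow> \<Psi> z (ecls e) = \<tau> z (\<omega> z) e"
    by metis
  have \<omega>K: "\<omega> z v \<in> carrier K" if "z \<in> Z" for z v using \<omega>[OF that] by auto
  \<comment> \<open>A homomorphism is determined by its values on X, which leaves at most |K|^|X|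
    possibilities.\<close>
  define key where "key z = (\<lambda>x\<in>X. \<Psi> z x)" for z
  have fib: "card {z \<in> Z. key z = f} \<le> (\<Prod>v\<in>VS. card (ZV v))" if f: "f \<in> key ` Z" for f
  proof -
    obtain z0 where z0: "z0 \<in> Z" "f = key z0" using f by blast
    have same: "\<Psi> z g = \<Psi> z0 g" if z: "z \<in> Z" "key z = f" and g: "g \<in> carrier pi1" for z g
    proof (rule hom_eq_on_generate[OF P.is_group assms(1) \<Psi>[OF z(1)] \<Psi>[OF z0(1)] X(2)])
      fix x assume x: "x \<in> X"
      have "key z x = key z0 x" using z(2) z0(2) by simp
      then show "\<Psi> z x = \<Psi> z0 x" using x by (simp add: key_def)
    qed (use g X(3) in simp)
    \<comment> \<open>Relative to a fixed \<open>z0\<close> of the fibre, the conjugators differ by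
      elements centralizing the images of the vertex groups. These elements recover \<omega>, and
      the common value of the stable letters then recovers z.\<close>
    define F where "F z = (\<lambda>v\<in>VS. inv (\<omega> z0 v) \<otimes> \<omega> z v)" for z
    have "inj_on F {z \<in> Z. key z = f}"
    proof (rule inj_onI)
      fix z z' assume "z \<in> {z \<in> Z. key z = f}" "z' \<in> {z \<in> Z. key z = f}" and F: "F z = F z'"
      then have z: "z \<in> Z" "key z = f" and z': "z' \<in> Z" "key z' = f" by auto
      have \<omega>eq: "\<omega> z v = \<omega> z' v" if v: "v \<in> VS" for v
      proof -
        have "inv (\<omega> z0 v) \<otimes> \<omega> z v = inv (\<omega> z0 v) \<otimes> \<omega> z' v"
          using fun_cong[OF F, of v] v by (simp add: F_def)
        then show ?thesis using \<omega>K[OF z0(1)] \<omega>K[OF z(1)] \<omega>K[OF z'(1)] by simp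
      qed
      show "z = z'"
      proof (rule PiE_ext)
        show "z \<in> (\<Pi>\<^sub>E e\<in>ES. ZE e)" "z' \<in> (\<Pi>\<^sub>E e\<in>ES. ZE e)"
          using z z' by (simp_all add: Z_def)
        fix e assume e: "e \<in> ES"
        have zK: "z e \<in> carrier K" "z' e \<in> carrier K"
          using z(1) z'(1) e PiE_mem[of _ "ES" ZE e] N.mem_carrier
          unfolding Z_def ZE_def by blast+
        have "\<tau> z (\<omega> z) e = \<tau> z' (\<omega> z') e"
          using \<Psi>e[OF z(1) e] \<Psi>e[OF z'(1) e] same[OF z ecls_closed[OF e]] same[OF z' ecls_closed[OF e]]
          by simp
        then show "z e = z' e"
          using \<omega>eq[of "tail (graph \<Lambda>) e"] \<omega>eq[of "head (graph \<Lambda>) e"] e zK ec[OF e]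
            \<omega>K[OF z'(1)]
          by (simp add: \<tau>_def m_assoc)
      qed
    qed
    moreover have "F ` {z \<in> Z. key z = f} \<subseteq> (\<Pi>\<^sub>E v\<in>VS. ZV v)"
    proof (clarify)
      fix z assume z: "z \<in> Z" "f = key z"
      show "F z \<in> (\<Pi>\<^sub>E v\<in>VS. ZV v)"
        unfolding F_def
      proof (rule restrict_PiE_iff[THEN iffD2], rule ballI)
        fix v assume v: "v \<in> VS"
        have "inv (\<omega> z0 v) \<otimes> \<omega> z v \<in> N" using \<omega>[OF z0(1)] \<omega>[OF z(1)] by simp
        moreover have "inv (\<omega> z0 v) \<otimes> \<omega> z v \<otimes> \<phi> (vcls v x) = \<phi> (vcls v x) \<otimes> (inv (\<omega> z0 v) \<otimes> \<omega> z v)"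
          if x: "x \<in> VG v" for x
          using same[OF z(1) z(2)[symmetric] vcls_closed[OF v x]]
          by (simp add: \<Psi>v[OF z(1) v x] \<Psi>v[OF z0(1) v x]
              conj_commute_iff[OF \<omega>K[OF z(1)] \<omega>K[OF z0(1)] vc[OF v x]])
        ultimately show "inv (\<omega> z0 v) \<otimes> \<omega> z v \<in> ZV v" by (simp add: ZV_def)
      qed
    qed
    moreover have "finite (\<Pi>\<^sub>E v\<in>VS. ZV v)" using fins by (intro finite_PiE) auto
    ultimately have "card {z \<in> Z. key z = f} \<le> card (\<Pi>\<^sub>E v\<in>VS. ZV v)"
      by (rule card_inj_on_le)
    then show ?thesis by (simp add: card_PiE)
  qed
  have finZ: "finite Z" unfolding Z_def using fins by (intro finite_PiE) auto
  have "card Z \<le> card (key ` Z) * (\<Prod>v\<in>VS. card (ZV v))"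
    using card_fibers_le[OF finZ] fib by blast
  moreover have "card (key ` Z) \<le> card (carrier K) ^ card X"
  proof -
    have "\<Psi> z x \<in> carrier K" if "z \<in> Z" "x \<in> X" for z x
      using hom_in_carrier[OF \<Psi>[OF that(1)]] X(2) that(2) by blast
    then have "key ` Z \<subseteq> (\<Pi>\<^sub>E x\<in>X. carrier K)" by (auto simp: key_def)
    then have "card (key ` Z) \<le> card (\<Pi>\<^sub>E x\<in>X. carrier K)"
      using finK X(1) by (intro card_mono finite_PiE) auto
    then show ?thesis using X(1) by (simp add: card_PiE)
  qed
  ultimately have "card Z \<le> card (carrier K) ^ card X * (\<Prod>v\<in>VS. card (ZV v))"
    using mult_le_mono1 order_trans by blast
  then show ?thesis by (simp add: Z_def card_PiE)
qed

end

section \<open>Vertex groups embed in the fundamental group\<close>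

text \<open>An infinite cardinal absorbs a nonempty factor that is not larger. The factor
  \<open>nat\<close> makes the set infinite even when \<open>'g\<close> is a finite type.\<close>

lemma absorb_product:
  includes cardinal_syntax
  assumes "A \<noteq> ({} :: 'g set)"
  obtains \<beta> where "bij_betw \<beta> (A \<times> (UNIV :: ('g \<times> nat) set)) (UNIV :: ('g \<times> nat) set)"
proof -
  have inf: "infinite (UNIV :: ('g \<times> nat) set)" by (simp add: finite_prod)
  have "\<exists>f. inj_on f A \<and> f ` A \<subseteq> (UNIV :: ('g \<times> nat) set)"
    by (intro exI[of _ "\<lambda>a. (a, 0)"]) (auto simp: inj_on_def)
  then have "|A| \<le>o |UNIV :: ('g \<times> nat) set|" by (simp only: card_of_ordLeq)
  then have "|A \<times> (UNIV :: ('g \<times> nat) set)| =o |UNIV :: ('g \<times> nat) set|"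
    using card_of_Times_infinite[OF inf assms] by blast
  then show ?thesis using that by (auto simp flip: card_of_ordIso)
qed

text \<open>Left translation of G on the first factor of G \<times> UNIV, transported along \<beta>.
  In this way different groups act freely on one and the same set, with orbits indexed by that
  set.\<close>

definition free_perm :: "'g monoid \<Rightarrow> ('g \<times> 'k \<Rightarrow> 'k) \<Rightarrow> 'g \<Rightarrow> 'k \<Rightarrow> 'k" where
  "free_perm G \<beta> x p = (case inv_into (carrier G \<times> UNIV) \<beta> p of (g, k) \<Rightarrow> \<beta> (x \<otimes>\<^bsub>G\<^esub> g, k))"

lemma free_perm_apply:
  assumes "bij_betw \<beta> (carrier G \<times> UNIV) UNIV" "g \<in> carrier G"
  shows "free_perm G \<beta> x (\<beta> (g, k)) = \<beta> (x \<otimes>\<^bsub>G\<^esub> g, k)"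
  using bij_betw_inv_into_left[OF assms(1), of "(g, k)"] assms(2) by (simp add: free_perm_def)

lemma bij_cases:
  assumes "bij_betw \<beta> (A \<times> UNIV) UNIV"
  obtains g k where "g \<in> A" "p = \<beta> (g, k)"
proof -
  have "p \<in> \<beta> ` (A \<times> UNIV)" using assms by (simp add: bij_betw_def)
  then show ?thesis using that by auto
qed

lemma free_perm_hom:
  assumes "group G" and \<beta>: "bij_betw \<beta> (carrier G \<times> UNIV) UNIV"
  shows "free_perm G \<beta> \<in> hom G sym_group" "inj_on (free_perm G \<beta>) (carrier G)"
proof -
  interpret group G by fact
  have comp: "free_perm G \<beta> (x \<otimes>\<^bsub>G\<^esub> y) = free_perm G \<beta> x \<circ> free_perm G \<beta> y"
    if "x \<in> carrier G" "y \<in> carrier G" for x y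
  proof
    fix p
    obtain g k where "g \<in> carrier G" "p = \<beta> (g, k)" using bij_cases[OF \<beta>] .
    then show "free_perm G \<beta> (x \<otimes>\<^bsub>G\<^esub> y) p = (free_perm G \<beta> x \<circ> free_perm G \<beta> y) p"
      using that by (simp add: free_perm_apply[OF \<beta>] m_assoc)
  qed
  have one: "free_perm G \<beta> \<one>\<^bsub>G\<^esub> = id"
  proof
    fix p
    obtain g k where "g \<in> carrier G" "p = \<beta> (g, k)" using bij_cases[OF \<beta>] .
    then show "free_perm G \<beta> \<one>\<^bsub>G\<^esub> p = id p" by (simp add: free_perm_apply[OF \<beta>])
  qed
  have "bij (free_perm G \<beta> x)" if "x \<in> carrier G" for x
    using comp[of x "inv\<^bsub>G\<^esub> x"] comp[of "inv\<^bsub>G\<^esub> x" x] that one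
    by (intro o_bij[of "free_perm G \<beta> (inv\<^bsub>G\<^esub> x)"]) simp_all
  then show "free_perm G \<beta> \<in> hom G sym_group" using comp by (auto intro!: homI)
  show "inj_on (free_perm G \<beta>) (carrier G)"
  proof (rule inj_onI)
    fix x y assume xy: "x \<in> carrier G" "y \<in> carrier G" "free_perm G \<beta> x = free_perm G \<beta> y"
    fix k
    have "\<beta> (x, undefined) = \<beta> (y, undefined)"
      using fun_cong[OF xy(3), of "\<beta> (\<one>\<^bsub>G\<^esub>, undefined)"] xy(1,2) by (simp add: free_perm_apply[OF \<beta>])
    then show "x = y"
      using bij_betw_imp_inj_on[OF \<beta>] xy(1,2) by (auto dest: inj_onD)
  qed
qed

lemma (in group) right_transversal:
  assumes I: "subgroup I G"
  obtains R where "R \<subseteq> carrier G" "R \<noteq> {}" "bij_betw (\<lambda>(c, r). c \<otimes> r) (I \<times> R) (carrier G)"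
proof
  interpret I: subgroup I G by fact
  define rep where "rep C = (SOME x. x \<in> C)" for C :: "'a set"
  define R where "R = rep ` (rcosets I)"
  have rep: "rep (I #> g) \<in> I #> g" if "g \<in> carrier G" for g
    unfolding rep_def using rcos_self[OF that I] by (rule someI)
  have same: "I #> rep (I #> g) = I #> g" if "g \<in> carrier G" for g
    using repr_independence[OF rep[OF that] that I] by simp
  show R: "R \<subseteq> carrier G"
    using rep r_coset_subset_G[OF I.subset] by (auto simp: R_def RCOSETS_def)
  show "R \<noteq> {}" by (auto simp: R_def RCOSETS_def)
  have RC: "rep (I #> r) = r" if "r \<in> R" for r
    using that same by (auto simp: R_def RCOSETS_def)
  show "bij_betw (\<lambda>(c, r). c \<otimes> r) (I \<times> R) (carrier G)"
  proof (rule bij_betwI')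
    fix p q assume "p \<in> I \<times> R" "q \<in> I \<times> R"
    then obtain c r c' r' where pq: "p = (c, r)" "q = (c', r')" "c \<in> I" "c' \<in> I" "r \<in> R" "r' \<in> R"
      by auto
    have cl: "c \<in> carrier G" "c' \<in> carrier G" "r \<in> carrier G" "r' \<in> carrier G" using pq R by auto
    have "r = r' \<and> c = c'" if eq: "c \<otimes> r = c' \<otimes> r'"
    proof -
      have "I #> r = I #> (c \<otimes> r)" using cl pq I by (metis coset_mult_assoc I.rcos_const is_group I.subset)
      moreover have "I #> r' = I #> (c' \<otimes> r')" using cl pq I by (metis coset_mult_assoc I.rcos_const is_group I.subset)
      ultimately have "r = r'" using eq RC pq by metis
      then show ?thesis using eq cl by simp
    qed
    then show "((case p of (c, r) \<Rightarrow> c \<otimes> r) = (case q of (c, r) \<Rightarrow> c \<otimes> r)) = (p = q)"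
      using pq by auto
  next
    fix p assume "p \<in> I \<times> R"
    then show "(case p of (c, r) \<Rightarrow> c \<otimes> r) \<in> carrier G" using R by auto
  next
    fix g assume g: "g \<in> carrier G"
    have "g \<in> I #> rep (I #> g)" using same[OF g] rcos_self[OF g I] by simp
    then obtain c where "c \<in> I" "g = c \<otimes> rep (I #> g)" by (auto simp: r_coset_def)
    moreover have "rep (I #> g) \<in> R" using g by (auto simp: R_def RCOSETS_def)
    ultimately show "\<exists>p\<in>I \<times> R. g = (case p of (c, r) \<Rightarrow> c \<otimes> r)"
      by (intro bexI[of _ "(c, rep (I #> g))"]) auto
  qed
qed

text \<open>Restricted along i, the free action of G is still free, with orbits indexed by a
  transversal R times the old index set. The factor R is absorbed by \<gamma>, so the restriction is
  isomorphic to the chosen action of E; y is the isomorphism.\<close>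

lemma free_perm_equivariant:
  fixes \<beta> \<delta> :: "'g \<times> ('g \<times> nat) \<Rightarrow> 'g \<times> nat"
  assumes G: "group G" and E: "group E" and i: "i \<in> mon E G"
    and \<beta>: "bij_betw \<beta> (carrier G \<times> UNIV) UNIV" and \<delta>: "bij_betw \<delta> (carrier E \<times> UNIV) UNIV"
  obtains y where "bij y"
    "\<And>c. c \<in> carrier E \<Longrightarrow> free_perm G \<beta> (i c) = y \<circ> free_perm E \<delta> c \<circ> inv_into UNIV y"
proof -
  interpret G: group G by fact
  interpret E: group E by fact
  have ih: "i \<in> hom E G" and inj: "inj_on i (carrier E)" using i by (auto simp: mon_def)
  interpret i: group_hom E G i using ih by (simp add: group_hom_def group_hom_axioms_def G E)
  obtain R where R: "R \<subseteq> carrier G" "R \<noteq> {}" and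
    bijR: "bij_betw (\<lambda>(c, r). c \<otimes>\<^bsub>G\<^esub> r) (i ` carrier E \<times> R) (carrier G)"
    using G.right_transversal[OF i.img_is_subgroup] by metis
  obtain \<gamma> :: "'g \<times> ('g \<times> nat) \<Rightarrow> 'g \<times> nat" where \<gamma>: "bij_betw \<gamma> (R \<times> UNIV) UNIV"
    using absorb_product[OF R(2)] .
  define \<theta> where "\<theta> = (\<lambda>(c, r, k). (i c \<otimes>\<^bsub>G\<^esub> r, k :: 'g \<times> nat))"
  have "bij_betw \<theta> (carrier E \<times> R \<times> UNIV) (carrier G \<times> UNIV)"
  proof (rule bij_betwI')
    fix p q assume "p \<in> carrier E \<times> R \<times> (UNIV :: ('g \<times> nat) set)" "q \<in> carrier E \<times> R \<times> (UNIV :: ('g \<times> nat) set)"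
    then obtain c r k c' r' k' where pq: "p = (c, r, k)" "q = (c', r', k')"
      "c \<in> carrier E" "c' \<in> carrier E" "r \<in> R" "r' \<in> R" by auto
    have "c = c' \<and> r = r'" if "i c \<otimes>\<^bsub>G\<^esub> r = i c' \<otimes>\<^bsub>G\<^esub> r'"
      using inj_onD[OF bij_betw_imp_inj_on[OF bijR], of "(i c, r)" "(i c', r')"] that pq
        inj_onD[OF inj, of c c'] by auto
    then show "(\<theta> p = \<theta> q) = (p = q)" using pq by (auto simp: \<theta>_def)
  next
    fix p assume "p \<in> carrier E \<times> R \<times> (UNIV :: ('g \<times> nat) set)"
    then show "\<theta> p \<in> carrier G \<times> UNIV" using R by (auto simp: \<theta>_def)
  next
    fix q assume "q \<in> carrier G \<times> (UNIV :: ('g \<times> nat) set)"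
    then obtain g k where q: "q = (g, k)" "g \<in> carrier G" by auto
    have "g \<in> (\<lambda>(c, r). c \<otimes>\<^bsub>G\<^esub> r) ` (i ` carrier E \<times> R)" using bijR q by (simp add: bij_betw_def)
    then obtain c r where "c \<in> carrier E" "r \<in> R" "g = i c \<otimes>\<^bsub>G\<^esub> r" by auto
    then show "\<exists>p\<in>carrier E \<times> R \<times> UNIV. q = \<theta> p"
      using q by (intro bexI[of _ "(c, r, k)"]) (auto simp: \<theta>_def)
  qed
  then have b1: "bij_betw (\<beta> \<circ> \<theta>) (carrier E \<times> R \<times> UNIV) UNIV" by (rule bij_betw_trans[OF _ \<beta>])
  have "bij_betw (\<lambda>(c, p). (c, \<gamma> p)) (carrier E \<times> R \<times> UNIV) (carrier E \<times> UNIV)"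
    using bij_betw_map_prod[OF bij_betw_id[of "carrier E"] \<gamma>] by (simp add: map_prod_def id_def)
  then have b2: "bij_betw (\<delta> \<circ> (\<lambda>(c, p). (c, \<gamma> p))) (carrier E \<times> R \<times> UNIV) UNIV"
    by (rule bij_betw_trans[OF _ \<delta>])
  let ?b = "\<delta> \<circ> (\<lambda>(c, p). (c, \<gamma> p))"
  define y where "y = (\<beta> \<circ> \<theta>) \<circ> inv_into (carrier E \<times> R \<times> UNIV) ?b"
  have y: "bij y" unfolding y_def by (rule bij_betw_trans[OF bij_betw_inv_into[OF b2] b1])
  have y_apply: "y (\<delta> (c, \<gamma> (r, k))) = \<beta> (i c \<otimes>\<^bsub>G\<^esub> r, k)" if "c \<in> carrier E" "r \<in> R" for c r k
    using bij_betw_inv_into_left[OF b2, of "(c, r, k)"] that by (simp add: y_def \<theta>_def)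
  have "free_perm G \<beta> (i c) = y \<circ> free_perm E \<delta> c \<circ> inv_into UNIV y" if c: "c \<in> carrier E" for c
  proof
    fix p
    define p' where "p' = inv_into UNIV y p"
    have p: "p = y p'" using y by (simp add: p'_def bij_is_surj surj_f_inv_f)
    obtain c' l where l: "c' \<in> carrier E" "p' = \<delta> (c', l)" using bij_cases[OF \<delta>] .
    obtain r k where r: "r \<in> R" "l = \<gamma> (r, k)" using bij_cases[OF \<gamma>] .
    have "p = \<beta> (i c' \<otimes>\<^bsub>G\<^esub> r, k)" using p l r y_apply by simp
    then have "free_perm G \<beta> (i c) p = \<beta> (i (c \<otimes>\<^bsub>E\<^esub> c') \<otimes>\<^bsub>G\<^esub> r, k)"
      using free_perm_apply[OF \<beta>, of "i c' \<otimes>\<^bsub>G\<^esub> r" "i c" k] c l r R by (auto simp: G.m_assoc)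
    also have "\<dots> = y (\<delta> (c \<otimes>\<^bsub>E\<^esub> c', l))" using y_apply[of "c \<otimes>\<^bsub>E\<^esub> c'" r k] c l r by simp
    also have "\<dots> = y (free_perm E \<delta> c p')" using free_perm_apply[OF \<delta> l(1), of c l] l by simp
    finally show "free_perm G \<beta> (i c) p = (y \<circ> free_perm E \<delta> c \<circ> inv_into UNIV y) p"
      by (simp add: p'_def)
  qed
  then show ?thesis using that y by blast
qed

context finite_gog_tree begin

text \<open>All vertex groups act freely on the same set, and the two restrictions to an edge group
  are conjugate by \<open>free_perm_equivariant\<close>. The actions therefore assemble into a
  homomorphism from the fundamental group that is injective on every vertex group; no normal form of
  words is involved.\<close>

lemma inj_vcls:
  assumes v: "v \<in> VS"
  shows "inj_on (vcls v) (VG v)"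
proof -
  have "\<exists>\<beta> :: 'g \<times> ('g \<times> nat) \<Rightarrow> 'g \<times> nat. group G \<longrightarrow> bij_betw \<beta> (carrier G \<times> UNIV) UNIV"
    for G :: "'g monoid"
    using absorb_product[of "carrier G"] monoid.one_closed[OF group.is_monoid] by (metis empty_iff)
  then obtain b :: "'g monoid \<Rightarrow> 'g \<times> ('g \<times> nat) \<Rightarrow> 'g \<times> nat"
    where b: "\<And>G. group G \<Longrightarrow> bij_betw (b G) (carrier G \<times> UNIV) UNIV" by metis
  define \<sigma> where "\<sigma> v = free_perm (vertex_group \<Lambda> v) (b (vertex_group \<Lambda> v))" for v
  define h where "h e = free_perm (edge_group \<Lambda> e) (b (edge_group \<Lambda> e))" for e
  have "gog_rep sym_group \<Lambda> \<sigma> h"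
    unfolding gog_rep_def
  proof (intro conjI ballI allI)
    fix v assume "v \<in> VS"
    then show "\<sigma> v \<in> hom (vertex_group \<Lambda> v) sym_group"
      unfolding \<sigma>_def using free_perm_hom(1) group_vertex b by blast
  next
    fix e assume e: "e \<in> ES"
    have he: "h e \<in> hom (edge_group \<Lambda> e) sym_group"
      unfolding h_def using free_perm_hom(1) group_edge[OF e] b by blast
    then show "h e \<in> EG e \<rightarrow> carrier sym_group" by (simp add: hom_def)
    fix d
    from free_perm_equivariant[OF group_vertex[OF endpoint_in_verts[OF e]] group_edge[OF e] emap_mon[OF e]
        b[OF group_vertex[OF endpoint_in_verts[OF e]]] b[OF group_edge[OF e]]]
    obtain y where y: "bij y" "\<And>c. c \<in> EG e \<Longrightarrow>
      \<sigma> (endp e d) (emap e d c) = y \<circ> h e c \<circ> inv_into UNIV y"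
      unfolding \<sigma>_def h_def by metis
    then show "\<exists>y\<in>carrier sym_group. \<forall>c\<in>EG e.
      \<sigma> (endp e d) (emap e d c)
        = y \<otimes>\<^bsub>sym_group\<^esub> h e c \<otimes>\<^bsub>sym_group\<^esub> inv\<^bsub>sym_group\<^esub> y"
      by (intro bexI[of _ y]) (simp_all add: inv_sym_group)
  qed
  then obtain \<Psi> \<omega> where "\<Psi> \<in> hom pi1 sym_group"
    and \<Psi>: "\<And>v. \<omega> v \<in> carrier (sym_group :: ('g \<times> nat \<Rightarrow> 'g \<times> nat) monoid)"
    "\<And>v x. v \<in> VS \<Longrightarrow> x \<in> VG v \<Longrightarrow>
      \<Psi> (vcls v x) = \<omega> v \<otimes>\<^bsub>sym_group\<^esub> \<sigma> v x \<otimes>\<^bsub>sym_group\<^esub> inv\<^bsub>sym_group\<^esub> \<omega> v"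
    using pi1_hom_of_rep[OF group_sym_group] by metis
  show ?thesis
  proof (rule inj_onI)
    interpret Y: group "sym_group :: ('g \<times> nat \<Rightarrow> 'g \<times> nat) monoid" by (rule group_sym_group)
    fix x x' assume x: "x \<in> VG v" "x' \<in> VG v"
      and eq: "vcls v x = vcls v x'"
    have s: "\<sigma> v x \<in> carrier sym_group" "\<sigma> v x' \<in> carrier sym_group"
      using hom_in_carrier[OF free_perm_hom(1)[OF group_vertex[OF v] b[OF group_vertex[OF v]]]] x by (auto simp: \<sigma>_def)
    have "\<omega> v \<otimes>\<^bsub>sym_group\<^esub> \<sigma> v x \<otimes>\<^bsub>sym_group\<^esub> inv\<^bsub>sym_group\<^esub> \<omega> v
      = \<omega> v \<otimes>\<^bsub>sym_group\<^esub> \<sigma> v x' \<otimes>\<^bsub>sym_group\<^esub> inv\<^bsub>sym_group\<^esub> \<omega> v"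
      using \<Psi>(2)[OF v x(1)] \<Psi>(2)[OF v x(2)] eq by simp
    then have "\<sigma> v x = \<sigma> v x'"
      using s \<Psi>(1)[of v] by (simp del: sym_group_simps)
    then show "x = x'"
      using free_perm_hom(2)[OF group_vertex[OF v] b[OF group_vertex[OF v]]] x by (auto simp: \<sigma>_def dest: inj_onD)
  qed
qed

end

section \<open>The counting inequality\<close>

text \<open>The semidirect product of the group of subsets of \<open>Q\<close> (under symmetric difference) with \<open>Q\<close>.\<close>

definition flip_group :: "('q, 'm) monoid_scheme \<Rightarrow> ('q set \<times> 'q) monoid" where
  "flip_group Q = \<lparr>carrier = Pow (carrier Q) \<times> carrier Q,
    monoid.mult = (\<lambda>(A, p) (B, q). ({x \<in> carrier Q. (x \<in> A) \<noteq> (inv\<^bsub>Q\<^esub> p \<otimes>\<^bsub>Q\<^esub> x \<in> B)}, p \<otimes>\<^bsub>Q\<^esub> q)),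
    one = ({}, \<one>\<^bsub>Q\<^esub>)\<rparr>"

lemma flip_group_simps [simp]:
  "carrier (flip_group Q) = Pow (carrier Q) \<times> carrier Q"
  "(A, p) \<otimes>\<^bsub>flip_group Q\<^esub> (B, q)
    = ({x \<in> carrier Q. (x \<in> A) \<noteq> (inv\<^bsub>Q\<^esub> p \<otimes>\<^bsub>Q\<^esub> x \<in> B)}, p \<otimes>\<^bsub>Q\<^esub> q)"
  "\<one>\<^bsub>flip_group Q\<^esub> = ({}, \<one>\<^bsub>Q\<^esub>)"
  by (simp_all add: flip_group_def)

context group begin

lemma group_flip_group: "group (flip_group G)"
proof (rule groupI)
  fix a b assume "a \<in> carrier (flip_group G)" "b \<in> carrier (flip_group G)"
  then show "a \<otimes>\<^bsub>flip_group G\<^esub> b \<in> carrier (flip_group G)" by (cases a; cases b) auto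
next
  fix a b c assume abc: "a \<in> carrier (flip_group G)" "b \<in> carrier (flip_group G)" "c \<in> carrier (flip_group G)"
  obtain A p B q C r where "a = (A, p)" "b = (B, q)" "c = (C, r)" by (cases a; cases b; cases c)
  then show "a \<otimes>\<^bsub>flip_group G\<^esub> b \<otimes>\<^bsub>flip_group G\<^esub> c = a \<otimes>\<^bsub>flip_group G\<^esub> (b \<otimes>\<^bsub>flip_group G\<^esub> c)"
    using abc by (auto simp: inv_mult_group m_assoc)
next
  fix a assume a: "a \<in> carrier (flip_group G)"
  obtain A p where A: "a = (A, p)" by (cases a)
  show "\<one>\<^bsub>flip_group G\<^esub> \<otimes>\<^bsub>flip_group G\<^esub> a = a" using a A by auto
  have "({x \<in> carrier G. p \<otimes> x \<in> A}, inv p) \<otimes>\<^bsub>flip_group G\<^esub> a = \<one>\<^bsub>flip_group G\<^esub>"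
    using a A by auto
  then show "\<exists>b\<in>carrier (flip_group G). b \<otimes>\<^bsub>flip_group G\<^esub> a = \<one>\<^bsub>flip_group G\<^esub>"
    using a A by (intro bexI[of _ "({x \<in> carrier G. p \<otimes> x \<in> A}, inv p)"]) auto
qed auto

definition flips :: "('a set \<times> 'a) set" where
  "flips = Pow (carrier G) \<times> {\<one>}"

lemma subgroup_flips: "subgroup flips (flip_group G)"
proof -
  interpret F: group "flip_group G" by (rule group_flip_group)
  show ?thesis
  proof (rule F.subgroupI)
    fix a assume a: "a \<in> flips"
    then have "a \<otimes>\<^bsub>flip_group G\<^esub> a = \<one>\<^bsub>flip_group G\<^esub>" by (auto simp: flips_def)
    then have "inv\<^bsub>flip_group G\<^esub> a = a" using a by (intro F.inv_equality) (auto simp: flips_def)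
    then show "inv\<^bsub>flip_group G\<^esub> a \<in> flips" using a by simp
  qed (auto simp: flips_def)
qed

text \<open>Conjugation by q carries the flip of A to the flip of the left translate q A.\<close>

lemma flip_commute_iff:
  assumes "A \<subseteq> carrier G" "q \<in> carrier G"
  shows "(A, \<one>) \<otimes>\<^bsub>flip_group G\<^esub> ({}, q) = ({}, q) \<otimes>\<^bsub>flip_group G\<^esub> (A, \<one>)
    \<longleftrightarrow> (\<forall>x\<in>carrier G. x \<in> A \<longleftrightarrow> inv q \<otimes> x \<in> A)"
  using assms by auto

text \<open>The sets invariant under left multiplication by H are exactly the unions of right cosets
  of H.\<close>

lemma card_invariant_sets:
  assumes "finite (carrier G)" and H: "subgroup H G"
  shows "card {A. A \<subseteq> carrier G \<and> (\<forall>q\<in>H. \<forall>x\<in>carrier G. x \<in> A \<longleftrightarrow> inv q \<otimes> x \<in> A)} = 2 ^ card (rcosets H)"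
proof -
  interpret H: subgroup H G by fact
  let ?I = "{A. A \<subseteq> carrier G \<and> (\<forall>q\<in>H. \<forall>x\<in>carrier G. x \<in> A \<longleftrightarrow> inv q \<otimes> x \<in> A)}"
  have coset: "inv q \<otimes> x \<in> C" if "C \<in> rcosets H" "q \<in> H" "x \<in> C" for q x C
  proof -
    obtain g where g: "g \<in> carrier G" "C = H #> g" using \<open>C \<in> rcosets H\<close> by (auto simp: RCOSETS_def)
    then obtain h where h: "h \<in> H" "x = h \<otimes> g" using \<open>x \<in> C\<close> by (auto simp: r_coset_def)
    have "inv q \<otimes> x = (inv q \<otimes> h) \<otimes> g" using g h \<open>q \<in> H\<close> by (simp add: m_assoc)
    then show ?thesis using g h \<open>q \<in> H\<close> by (auto simp: r_coset_def)
  qed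
  have sub: "C \<subseteq> carrier G" if "C \<in> rcosets H" for C
    using that r_coset_subset_G[OF H.subset] by (auto simp: RCOSETS_def)
  have "bij_betw \<Union> (Pow (rcosets H)) ?I"
  proof (rule bij_betwI[where g = "\<lambda>A. {C \<in> rcosets H. C \<subseteq> A}"])
    show "\<Union> \<in> Pow (rcosets H) \<rightarrow> ?I"
    proof
      fix \<C> assume \<C>: "\<C> \<in> Pow (rcosets H)"
      have "x \<in> \<Union>\<C> \<longleftrightarrow> inv q \<otimes> x \<in> \<Union>\<C>" if q: "q \<in> H" and x: "x \<in> carrier G" for q x
      proof
        show "inv q \<otimes> x \<in> \<Union>\<C>" if "x \<in> \<Union>\<C>" using that \<C> coset[OF _ q] by blast
        assume "inv q \<otimes> x \<in> \<Union>\<C>"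
        then have "inv (inv q) \<otimes> (inv q \<otimes> x) \<in> \<Union>\<C>" using \<C> coset[of _ "inv q"] q by blast
        then show "x \<in> \<Union>\<C>" using q x by simp
      qed
      then show "\<Union>\<C> \<in> ?I" using \<C> sub by blast
    qed
    show "(\<lambda>A. {C \<in> rcosets H. C \<subseteq> A}) \<in> ?I \<rightarrow> Pow (rcosets H)" by auto
    fix \<C> assume \<C>: "\<C> \<in> Pow (rcosets H)"
    show "{C \<in> rcosets H. C \<subseteq> \<Union>\<C>} = \<C>"
    proof
      show "{C \<in> rcosets H. C \<subseteq> \<Union>\<C>} \<subseteq> \<C>"
      proof clarify
        fix C assume C: "C \<in> rcosets H" "C \<subseteq> \<Union>\<C>"
        then obtain x where "x \<in> C" using rcos_self[OF _ H] by (auto simp: RCOSETS_def)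
        then obtain D where "D \<in> \<C>" "x \<in> D" using C by blast
        then have "C = D" using rcos_disjoint[OF H] C(1) \<C> \<open>x \<in> C\<close>
          unfolding pairwise_def disjnt_def by blast
        then show "C \<in> \<C>" using \<open>D \<in> \<C>\<close> by simp
      qed
    qed (use \<C> in auto)
  next
    fix A assume A: "A \<in> ?I"
    show "\<Union>{C \<in> rcosets H. C \<subseteq> A} = A"
    proof
      show "A \<subseteq> \<Union>{C \<in> rcosets H. C \<subseteq> A}"
      proof
        fix x assume x: "x \<in> A"
        then have xc: "x \<in> carrier G" using A by blast
        have "H #> x \<subseteq> A"
        proof
          fix y assume "y \<in> H #> x"
          then obtain h where h: "h \<in> H" "y = h \<otimes> x" by (auto simp: r_coset_def)
          have "inv h \<otimes> y = x" using h xc by simp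
          then show "y \<in> A" using A h x xc by (metis (mono_tags, lifting) H.mem_carrier m_closed mem_Collect_eq)
        qed
        moreover have "H #> x \<in> rcosets H" using xc by (auto simp: RCOSETS_def)
        ultimately show "x \<in> \<Union>{C \<in> rcosets H. C \<subseteq> A}" using rcos_self[OF xc H] by blast
      qed
    qed blast
  qed
  then have "card (Pow (rcosets H)) = card ?I" by (rule bij_betw_same_card)
  moreover have "finite (rcosets H)"
    by (rule finite_subset[of _ "Pow (carrier G)"]) (use sub assms(1) in auto)
  ultimately show ?thesis by (simp add: card_Pow)
qed

end

context finite_gog_tree begin

text \<open>The centralizer of a subgroup \<open>H\<close> of \<open>Q\<close> among the flips has \<open>2 ^ (|Q| / |H|)\<close> elements.\<close>

lemma orbit_count_inequality:
  fixes Q (structure)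
  assumes Q: "group Q" and finQ: "finite (carrier Q)"
    and \<phi>: "\<phi> \<in> hom pi1 Q"
    and X: "finite X" "X \<subseteq> carrier pi1"
      "generate pi1 X = carrier pi1"
  defines "HV \<equiv> \<lambda>v. (\<lambda>x. \<phi> (vcls v x)) ` VG v"
    and "HE \<equiv> \<lambda>e. (\<lambda>c. \<phi> (vcls (endp e True) (emap e True c))) ` EG e"
  shows "(\<Sum>e\<in>ES. 1 / real (card (HE e)))
    \<le> 2 * real (card X) + (\<Sum>v\<in>VS. 1 / real (card (HV v)))"
proof -
  interpret Q: group Q by fact
  interpret F: group "flip_group Q" by (rule Q.group_flip_group)
  let ?\<phi> = "\<lambda>g. ({}, \<phi> g)"
  have \<phi>F: "?\<phi> \<in> hom pi1 (flip_group Q)"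
    using \<phi> by (auto simp: hom_def)
  have HV: "subgroup (HV v) Q" if v: "v \<in> VS" for v
  proof -
    have "(\<lambda>x. \<phi> (vcls v x)) \<in> hom (vertex_group \<Lambda> v) Q"
      using hom_mult[OF vcls_hom[OF v]] hom_mult[OF \<phi>] hom_in_carrier[OF \<phi>]
        vcls_closed[OF v] by (intro homI) simp_all
    then have "group_hom (vertex_group \<Lambda> v) Q (\<lambda>x. \<phi> (vcls v x))"
      using group_vertex[OF v] Q by (simp add: group_hom_def group_hom_axioms_def)
    then show ?thesis unfolding HV_def by (rule group_hom.img_is_subgroup)
  qed
  have HE: "subgroup (HE e) Q" if e: "e \<in> ES" for e
  proof -
    let ?v = "endp e True"
    have v: "?v \<in> VS" by (rule endpoint_in_verts[OF e])
    have em: "emap e True \<in> hom (edge_group \<Lambda> e) (vertex_group \<Lambda> ?v)"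
      using emap_mon[OF e] by (simp add: mon_def)
    have "(\<lambda>c. \<phi> (vcls ?v (emap e True c))) \<in> hom (edge_group \<Lambda> e) Q"
      using hom_mult[OF vcls_hom[OF v]] hom_mult[OF \<phi>] hom_in_carrier[OF \<phi>]
        vcls_closed[OF v] hom_mult[OF em] hom_in_carrier[OF em] by (intro homI) simp_all
    then have "group_hom (edge_group \<Lambda> e) Q (\<lambda>c. \<phi> (vcls ?v (emap e True c)))"
      using group_edge[OF e] Q by (simp add: group_hom_def group_hom_axioms_def)
    then show ?thesis unfolding HE_def by (rule group_hom.img_is_subgroup)
  qed
  have cent: "card {n \<in> group.flips Q. \<forall>x\<in>D. n \<otimes>\<^bsub>flip_group Q\<^esub> ({}, f x) = ({}, f x) \<otimes>\<^bsub>flip_group Q\<^esub> n}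
      = 2 ^ card (rcosets (f ` D))" if sub: "subgroup (f ` D) Q" for f D
  proof -
    have "f x \<in> carrier Q" if "x \<in> D" for x using subgroup.subset[OF sub] that by blast
    then have "{n \<in> group.flips Q. \<forall>x\<in>D. n \<otimes>\<^bsub>flip_group Q\<^esub> ({}, f x) = ({}, f x) \<otimes>\<^bsub>flip_group Q\<^esub> n}
      = (\<lambda>A. (A, \<one>)) ` {A. A \<subseteq> carrier Q \<and> (\<forall>q\<in>f ` D. \<forall>x\<in>carrier Q. x \<in> A \<longleftrightarrow> inv q \<otimes> x \<in> A)}"
      using Q.flip_commute_iff unfolding Q.flips_def by (auto simp del: flip_group_simps)
    then show ?thesis
      using Q.card_invariant_sets[OF finQ sub] by (simp add: card_image inj_on_def)
  qed
  have le: "(\<Prod>e\<in>ES. 2 ^ card (rcosets (HE e)))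
    \<le> card (carrier (flip_group Q)) ^ card X * (\<Prod>v\<in>VS. 2 ^ card (rcosets (HV v)) :: nat)"
  proof -
    have "finite (carrier (flip_group Q))" using finQ by simp
    from deformation_count[OF Q.group_flip_group this Q.subgroup_flips \<phi>F X]
    show ?thesis
      using cent[OF HV[unfolded HV_def]] cent[OF HE[unfolded HE_def]]
      by (simp add: HV_def HE_def del: flip_group_simps cong: prod.cong)
  qed
  let ?q = "card (carrier Q)"
  \<comment> \<open>Origin of the constant 2: a group of order 2^q q has at most 2^(2 q)
    elements.\<close>
  have "card (carrier (flip_group Q)) = 2 ^ ?q * ?q" using finQ by (simp add: card_Pow card_cartesian_product)
  also have "\<dots> \<le> 2 ^ (2 * ?q)"
    using less_exp[of ?q] by (simp add: mult_2 power_add)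
  finally have "card (carrier (flip_group Q)) ^ card X \<le> (2 ^ (2 * ?q)) ^ card X" by (rule power_mono) simp
  then have "(\<Prod>e\<in>ES. 2 ^ card (rcosets (HE e)))
    \<le> (2 ^ (2 * ?q)) ^ card X * (\<Prod>v\<in>VS. 2 ^ card (rcosets (HV v)) :: nat)"
    using le by (meson mult_le_mono1 order_trans)
  then have "(2::nat) ^ (\<Sum>e\<in>ES. card (rcosets (HE e)))
    \<le> 2 ^ (2 * ?q * card X + (\<Sum>v\<in>VS. card (rcosets (HV v))))"
    by (simp only: power_sum power_add power_mult)
  then have "(\<Sum>e\<in>ES. card (rcosets (HE e)))
    \<le> 2 * ?q * card X + (\<Sum>v\<in>VS. card (rcosets (HV v)))"
    by simp
  then have "real (\<Sum>e\<in>ES. card (rcosets (HE e)))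
    \<le> real (2 * ?q * card X + (\<Sum>v\<in>VS. card (rcosets (HV v))))"
    by (simp only: of_nat_le_iff)
  moreover have qpos: "real ?q > 0" using finQ Q.one_closed by (auto simp: card_gt_0_iff)
  \<comment> \<open>By Lagrange, a coset count is |Q| / |H|. Every term of the inequality then has
    the factor |Q|, and dividing by it leaves a bound independent of Q.\<close>
  moreover have lag: "real (card (rcosets H)) = real ?q * (1 / real (card H))" if H: "subgroup H Q" for H
  proof -
    have "card (rcosets H) * card H = ?q" using Q.lagrange[OF H] by (simp add: order_def)
    then have "real (card (rcosets H)) * real (card H) = real ?q" by (metis of_nat_mult)
    moreover have "card H > 0" using H finQ by (metis subgroup.finite_imp_card_positive)
    ultimately show ?thesis by (simp add: field_simps)
  qed
  ultimately have "real ?q * (\<Sum>e\<in>ES. 1 / real (card (HE e)))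
    \<le> real ?q * (2 * real (card X) + (\<Sum>v\<in>VS. 1 / real (card (HV v))))"
    using HE HV by (simp add: sum_distrib_left lag algebra_simps del: times_divide_eq_right)
  then show ?thesis using qpos by simp
qed

text \<open>Passing from the representation to a homomorphism of the fundamental group only
  conjugates the images of vertex and edge groups, which keeps their orders.\<close>

lemma rep_inequality:
  fixes Q (structure)
  assumes Q: "group Q" "finite (carrier Q)"
    and X: "finite X" "X \<subseteq> carrier pi1"
      "generate pi1 X = carrier pi1"
    and rep: "gog_rep Q \<Lambda> \<sigma> h"
  shows "(\<Sum>e\<in>ES. 1 / real (card (h e ` EG e)))
    \<le> 2 * real (card X) + (\<Sum>v\<in>VS. 1 / real (card (\<sigma> v ` VG v)))"
proof -
  interpret Q: group Q by fact
  obtain \<phi> \<omega> where \<phi>: "\<phi> \<in> hom pi1 Q" and \<omega>: "\<And>v. \<omega> v \<in> carrier Q"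
    and \<phi>v: "\<And>v x. v \<in> VS \<Longrightarrow> x \<in> VG v \<Longrightarrow>
      \<phi> (vcls v x) = \<omega> v \<otimes> \<sigma> v x \<otimes> inv (\<omega> v)"
    using pi1_hom_of_rep[OF Q(1) rep] by metis
  have conj_card: "card ((\<lambda>x. a \<otimes> f x \<otimes> inv a) ` D) = card (f ` D)"
    if "a \<in> carrier Q" "f ` D \<subseteq> carrier Q" for a f D
  proof -
    have "(\<lambda>x. a \<otimes> f x \<otimes> inv a) ` D = (\<lambda>y. a \<otimes> y \<otimes> inv a) ` f ` D" by (simp add: image_image)
    moreover have "inj_on (\<lambda>y. a \<otimes> y \<otimes> inv a) (f ` D)"
      using that by (intro inj_onI) (auto simp: subset_iff)
    ultimately show ?thesis by (simp add: card_image)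
  qed
  have V: "card ((\<lambda>x. \<phi> (vcls v x)) ` VG v) = card (\<sigma> v ` VG v)"
    if v: "v \<in> VS" for v
  proof -
    have "\<sigma> v \<in> hom (vertex_group \<Lambda> v) Q" using rep v by (simp add: gog_rep_def)
    then have "\<sigma> v ` VG v \<subseteq> carrier Q" by (auto simp: hom_def)
    from conj_card[OF \<omega>[of v] this] show ?thesis using \<phi>v[OF v] by (simp cong: image_cong)
  qed
  have E: "card ((\<lambda>c. \<phi> (vcls (endp e True) (emap e True c))) ` EG e)
      = card (h e ` EG e)" if e: "e \<in> ES" for e
  proof -
    have he: "h e ` EG e \<subseteq> carrier Q" using rep e by (auto simp: gog_rep_def)
    obtain y where y: "y \<in> carrier Q" "\<And>c. c \<in> EG e \<Longrightarrow>
        \<sigma> (endp e True) (emap e True c) = y \<otimes> h e c \<otimes> inv y"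
      using rep e unfolding gog_rep_def by blast
    let ?a = "\<omega> (endp e True) \<otimes> y"
    have "\<phi> (vcls (endp e True) (emap e True c)) = ?a \<otimes> h e c \<otimes> inv ?a"
      if c: "c \<in> EG e" for c
    proof -
      have "h e c \<in> carrier Q" using he c by blast
      then show ?thesis
        using \<phi>v[OF endpoint_in_verts[OF e] edge_map_closed[OF e c]] y \<omega> c
        by (simp add: Q.m_assoc Q.inv_mult_group)
    qed
    then show ?thesis using conj_card[OF _ he, of ?a] y(1) \<omega> by (simp cong: image_cong)
  qed
  show ?thesis
    using orbit_count_inequality[OF Q \<phi> X] V E by (simp cong: sum.cong)
qed

end

section \<open>Reductions and splittings\<close>

definition faithful_rep :: "('k, 'm) monoid_scheme \<Rightarrow> ('v, 'e, 'g) graph_of_groups \<Rightarrow>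
    ('v \<Rightarrow> 'g \<Rightarrow> 'k) \<Rightarrow> ('e \<Rightarrow> 'g \<Rightarrow> 'k) \<Rightarrow> bool" where
  "faithful_rep K \<Lambda> \<sigma> h \<longleftrightarrow> gog_rep K \<Lambda> \<sigma> h \<and>
    (\<forall>v\<in>verts (graph \<Lambda>). inj_on (\<sigma> v) (carrier (vertex_group \<Lambda> v)))"

text \<open>Minus the Euler characteristic of the graph of groups with vertex and edge groups replaced
  by their images under \<open>\<rho>\<close>; infinite images contribute \<open>1 / 0 = 0\<close>.\<close>

definition rep_char :: "('k \<Rightarrow> 'q) \<Rightarrow> ('v, 'e, 'g) graph_of_groups \<Rightarrow>
    ('v \<Rightarrow> 'g \<Rightarrow> 'k) \<Rightarrow> ('e \<Rightarrow> 'g \<Rightarrow> 'k) \<Rightarrow> real" where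
  "rep_char \<rho> \<Lambda> \<sigma> h =
    (\<Sum>e\<in>arcs (graph \<Lambda>). 1 / real (card (\<rho> ` h e ` carrier (edge_group \<Lambda> e)))) -
    (\<Sum>v\<in>verts (graph \<Lambda>). 1 / real (card (\<rho> ` \<sigma> v ` carrier (vertex_group \<Lambda> v))))"

definition infinite_vertices :: "('v, 'e, 'g) graph_of_groups \<Rightarrow> 'v set" where
  "infinite_vertices \<Lambda> = {v \<in> verts (graph \<Lambda>). infinite (carrier (vertex_group \<Lambda> v))}"

definition gain :: "('k \<Rightarrow> 'q) \<Rightarrow> 'k set \<Rightarrow> 'k set \<Rightarrow> 'k set \<Rightarrow> 'k set \<Rightarrow> real" where
  "gain \<rho> V A B C = 1 / real (card (\<rho> ` C)) - 1 / real (card (\<rho> ` A))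
    - 1 / real (card (\<rho> ` B)) + 1 / real (card (\<rho> ` V))"

text \<open>V, A, B, C stand for the images in K of the split vertex group and of the three new
  groups. The type of \<rho> is that of a projection to cosets; the formula for
  \<open>rep_char\<close> is a matter of cardinalities of images and holds for every such
  function.\<close>

definition splitting_data where
  "splitting_data K \<Lambda> \<sigma> h \<Lambda>' \<sigma>' h' V A B C \<longleftrightarrow>
    subgroup V K \<and> subgroup A K \<and> subgroup B K \<and> subgroup C K \<and>
    C \<subset> A \<and> C \<subset> B \<and> A \<subseteq> V \<and> B \<subseteq> V \<and> finite C \<and>
    (\<forall>\<rho> :: 'k \<Rightarrow> 'k set. rep_char \<rho> \<Lambda>' \<sigma>' h' = rep_char \<rho> \<Lambda> \<sigma> h + gain \<rho> V A B C) \<and>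
    (infinite V \<and> finite A \<and> finite B \<longrightarrow> card (infinite_vertices \<Lambda>') < card (infinite_vertices \<Lambda>))"

context finite_gog begin

lemma gog_rep_comp:
  assumes "group K" "group Q" "gog_rep K \<Lambda> \<sigma> h" "\<rho> \<in> hom K Q"
  shows "gog_rep Q \<Lambda> (\<lambda>v x. \<rho> (\<sigma> v x)) (\<lambda>e c. \<rho> (h e c))"
proof -
  interpret \<rho>: group_hom K Q \<rho> using assms by (simp add: group_hom_def group_hom_axioms_def)
  show ?thesis
    unfolding gog_rep_def
  proof (intro conjI ballI allI)
    fix v assume "v \<in> VS"
    then have "\<sigma> v \<in> hom (vertex_group \<Lambda> v) K" using assms(3) by (simp add: gog_rep_def)
    then show "(\<lambda>x. \<rho> (\<sigma> v x)) \<in> hom (vertex_group \<Lambda> v) Q"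
      by (intro homI) (simp_all add: hom_mult[of "\<sigma> v" "vertex_group \<Lambda> v" K]
        hom_in_carrier[of "\<sigma> v" "vertex_group \<Lambda> v" K])
  next
    fix e assume e: "e \<in> ES"
    have he: "h e \<in> EG e \<rightarrow> carrier K" using assms(3) e by (simp add: gog_rep_def)
    then show "(\<lambda>c. \<rho> (h e c)) \<in> EG e \<rightarrow> carrier Q"
      using \<rho>.hom_closed unfolding Pi_iff by blast
    fix d
    obtain y where y: "y \<in> carrier K" "\<And>c. c \<in> EG e \<Longrightarrow>
      \<sigma> (endp e d) (emap e d c) = y \<otimes>\<^bsub>K\<^esub> h e c \<otimes>\<^bsub>K\<^esub> inv\<^bsub>K\<^esub> y"
      using assms(3) e unfolding gog_rep_def by blast
    then show "\<exists>y\<in>carrier Q. \<forall>c\<in>EG e.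
        \<rho> (\<sigma> (endp e d) (emap e d c)) = y \<otimes>\<^bsub>Q\<^esub> \<rho> (h e c) \<otimes>\<^bsub>Q\<^esub> inv\<^bsub>Q\<^esub> y"
      using he by (intro bexI[of _ "\<rho> y"]) (auto simp: Pi_iff)
  qed
qed

lemma reduction_basic:
  assumes "reduction \<Lambda> \<Lambda>'"
  shows "\<exists>e d. e \<in> ES \<and>
    emap e d ` EG e = VG (endp e d) \<and>
    verts (graph \<Lambda>') = VS - {endp e d} \<and> arcs (graph \<Lambda>') = ES - {e} \<and>
    (\<forall>w\<in>verts (graph \<Lambda>'). vertex_group \<Lambda>' w = vertex_group \<Lambda> w) \<and>
    (\<forall>f\<in>arcs (graph \<Lambda>'). edge_group \<Lambda>' f = edge_group \<Lambda> f)"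
  using assms unfolding reduction_def by (elim bexE exE conjE) (intro exI conjI; blast)

text \<open>An edge end moved from u to v is compared with its old position through e. If y1 and y2
  are the conjugators of e at u and v, the conjugator y of the moved end becomes y2 y1^-1 y, with
  \<sigma> and h unchanged.\<close>

lemma reduction_rep:
  fixes K (structure)
  assumes "group K" and red: "reduction \<Lambda> \<Lambda>'" and rep: "gog_rep K \<Lambda> \<sigma> h"
  shows "gog_rep K \<Lambda>' \<sigma> h"
proof -
  interpret group K by fact
  from red obtain e d u v where s: "e \<in> ES" "u = endp e d" "v = endp e (\<not> d)" "u \<noteq> v"
    "emap e d ` EG e = VG u"
    "verts (graph \<Lambda>') = VS - {u}" "arcs (graph \<Lambda>') = ES - {e}"
    "\<forall>w\<in>verts (graph \<Lambda>'). vertex_group \<Lambda>' w = vertex_group \<Lambda> w"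
    and raw: "\<forall>f\<in>arcs (graph \<Lambda>'). edge_group \<Lambda>' f = edge_group \<Lambda> f \<and>
        (\<forall>d'. if endp f d' = u
          then endpoint \<Lambda>' f d' = v \<and>
            (\<forall>c\<in>EG f. edge_map \<Lambda>' f d' c =
              emap e (\<not> d)
                (inv_into (EG e) (emap e d) (emap f d' c)))
          else endpoint \<Lambda>' f d' = endp f d' \<and>
            (\<forall>c\<in>EG f. edge_map \<Lambda>' f d' c = emap f d' c))"
    unfolding reduction_def by (elim bexE exE conjE) (rule that; assumption)
  have 1: "edge_group \<Lambda>' f = edge_group \<Lambda> f" if "f \<in> arcs (graph \<Lambda>')" for f
    using raw that by blast
  have 2: "endpoint \<Lambda>' f d' = v \<and> (\<forall>c\<in>EG f. edge_map \<Lambda>' f d' c =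
      emap e (\<not> d)
        (inv_into (EG e) (emap e d) (emap f d' c)))"
    if "f \<in> arcs (graph \<Lambda>')" "endp f d' = u" for f d'
    using bspec[OF raw that(1)] that(2) by (metis (no_types, lifting))
  have 3: "endpoint \<Lambda>' f d' = endp f d' \<and>
      (\<forall>c\<in>EG f. edge_map \<Lambda>' f d' c = emap f d' c)"
    if "f \<in> arcs (graph \<Lambda>')" "endp f d' \<noteq> u" for f d'
    using bspec[OF raw that(1)] that(2) by (metis (no_types, lifting))
  note r = s(1-3) s(5-8)
  have ends: "\<exists>y\<in>carrier K. \<forall>c\<in>EG f.
      \<sigma> (endp f d') (emap f d' c) = y \<otimes> h f c \<otimes> inv y" if "f \<in> ES" for f d'
    using rep that unfolding gog_rep_def by blast
  have hc: "h f c \<in> carrier K" if "f \<in> ES" "c \<in> EG f" for f c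
    using rep that unfolding gog_rep_def by blast
  obtain y1 where y1: "y1 \<in> carrier K" "\<And>c. c \<in> EG e \<Longrightarrow>
      \<sigma> u (emap e d c) = y1 \<otimes> h e c \<otimes> inv y1"
    using ends[OF r(1), of d] r(2) by blast
  obtain y2 where y2: "y2 \<in> carrier K" "\<And>c. c \<in> EG e \<Longrightarrow>
      \<sigma> v (emap e (\<not> d) c) = y2 \<otimes> h e c \<otimes> inv y2"
    using ends[OF r(1), of "\<not> d"] r(3) by blast
  show ?thesis
    unfolding gog_rep_def
  proof (intro conjI ballI allI)
    fix w assume "w \<in> verts (graph \<Lambda>')"
    then show "\<sigma> w \<in> hom (vertex_group \<Lambda>' w) K" using rep r by (simp add: gog_rep_def)
  next
    fix f assume f: "f \<in> arcs (graph \<Lambda>')"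
    then have f\<Lambda>: "f \<in> ES" using r by simp
    show "h f \<in> carrier (edge_group \<Lambda>' f) \<rightarrow> carrier K" using hc[OF f\<Lambda>] 1[OF f] by simp
    fix d'
    obtain y where y: "y \<in> carrier K" "\<And>c. c \<in> EG f \<Longrightarrow>
      \<sigma> (endp f d') (emap f d' c) = y \<otimes> h f c \<otimes> inv y"
      using ends[OF f\<Lambda>, of d'] by blast
    show "\<exists>y\<in>carrier K. \<forall>c\<in>carrier (edge_group \<Lambda>' f).
        \<sigma> (endpoint \<Lambda>' f d') (edge_map \<Lambda>' f d' c) = y \<otimes> h f c \<otimes> inv y"
    proof (cases "endp f d' = u")
      case False
      then show ?thesis using y 3[OF f False] 1[OF f] by (intro bexI[of _ y]) auto
    next
      case True
      have "\<sigma> v (edge_map \<Lambda>' f d' c) = (y2 \<otimes> inv y1 \<otimes> y) \<otimes> h f c \<otimes> inv (y2 \<otimes> inv y1 \<otimes> y)"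
        if c: "c \<in> EG f" for c
      proof -
        have "emap f d' c \<in> emap e d ` EG e"
          using edge_map_closed[OF f\<Lambda> c, of d'] True r(4) by simp
        then obtain c1 where c1: "c1 \<in> EG e" "emap e d c1 = emap f d' c"
          "inv_into (EG e) (emap e d) (emap f d' c) = c1"
          by (metis f_inv_into_f inv_into_into)
        have "y1 \<otimes> h e c1 \<otimes> inv y1 = y \<otimes> h f c \<otimes> inv y"
          using y1(2)[OF c1(1)] y(2)[OF c] c1(2) True by simp
        moreover have "inv y1 \<otimes> (y1 \<otimes> h e c1 \<otimes> inv y1) \<otimes> y1 = h e c1"
          using y1(1) hc[OF r(1) c1(1)] by (simp add: m_assoc)
        ultimately have "h e c1 = inv y1 \<otimes> (y \<otimes> h f c \<otimes> inv y) \<otimes> y1" by simp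
        then have "\<sigma> v (edge_map \<Lambda>' f d' c) = y2 \<otimes> (inv y1 \<otimes> (y \<otimes> h f c \<otimes> inv y) \<otimes> y1) \<otimes> inv y2"
          using bspec[OF conjunct2[OF 2[OF f True]] c] c1 y2(2)[OF c1(1)] by simp
        then show ?thesis
          using y1(1) y2(1) y(1) hc[OF f\<Lambda> c] by (simp add: m_assoc inv_mult_group)
      qed
      then show ?thesis
        using conjunct1[OF 2[OF f True]] 1[OF f] y1(1) y2(1) y(1)
        by (intro bexI[of _ "y2 \<otimes> inv y1 \<otimes> y"]) auto
    qed
  qed
qed

text \<open>The collapsed edge group and the removed vertex group have conjugate images under
  \<rho>, so the two terms that disappear are equal and cancel.\<close>

lemma reduction_rep_char:
  assumes "group K" "group Q" and red: "reduction \<Lambda> \<Lambda>'" and rep: "gog_rep K \<Lambda> \<sigma> h"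
    and \<rho>: "\<rho> \<in> hom K Q"
  shows "rep_char \<rho> \<Lambda>' \<sigma> h = rep_char \<rho> \<Lambda> \<sigma> h"
proof -
  interpret Q: group Q by fact
  obtain e d where r0: "e \<in> ES"
    "emap e d ` EG e = VG (endp e d)"
    "verts (graph \<Lambda>') = VS - {endp e d}" "arcs (graph \<Lambda>') = ES - {e}"
    "\<forall>w\<in>verts (graph \<Lambda>'). vertex_group \<Lambda>' w = vertex_group \<Lambda> w"
    "\<forall>f\<in>arcs (graph \<Lambda>'). edge_group \<Lambda>' f = edge_group \<Lambda> f"
    using reduction_basic[OF red] by (elim exE conjE) (rule that; assumption)
  define u where "u = endp e d"
  note r = r0(1) u_def r0(2-6)[folded u_def]
  have u: "u \<in> VS" using endpoint_in_verts[OF r(1)] r(2) by simp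
  have rep': "gog_rep Q \<Lambda> (\<lambda>v x. \<rho> (\<sigma> v x)) (\<lambda>e c. \<rho> (h e c))"
    by (rule gog_rep_comp[OF assms(1,2) rep \<rho>])
  then have "\<exists>y\<in>carrier Q. \<forall>c\<in>EG e.
      \<rho> (\<sigma> u (emap e d c)) = y \<otimes>\<^bsub>Q\<^esub> \<rho> (h e c) \<otimes>\<^bsub>Q\<^esub> inv\<^bsub>Q\<^esub> y"
    using r(1) unfolding gog_rep_def u_def by blast
  then obtain y where y: "y \<in> carrier Q" "\<And>c. c \<in> EG e \<Longrightarrow>
      \<rho> (\<sigma> u (emap e d c)) = y \<otimes>\<^bsub>Q\<^esub> \<rho> (h e c) \<otimes>\<^bsub>Q\<^esub> inv\<^bsub>Q\<^esub> y"
    by blast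
  have hc: "\<rho> (h e c) \<in> carrier Q" if "c \<in> EG e" for c
    using rep' r(1) that unfolding gog_rep_def by blast
  have "\<rho> ` \<sigma> u ` VG u
    = (\<lambda>z. y \<otimes>\<^bsub>Q\<^esub> z \<otimes>\<^bsub>Q\<^esub> inv\<^bsub>Q\<^esub> y) ` \<rho> ` h e ` EG e"
    unfolding r(3)[symmetric] image_image using y(2) by (rule image_cong[OF HOL.refl])
  moreover have "inj_on (\<lambda>z. y \<otimes>\<^bsub>Q\<^esub> z \<otimes>\<^bsub>Q\<^esub> inv\<^bsub>Q\<^esub> y) (\<rho> ` h e ` EG e)"
    using y(1) hc by (intro inj_onI) auto
  ultimately have same: "card (\<rho> ` \<sigma> u ` VG u) = card (\<rho> ` h e ` EG e)"
    by (simp add: card_image)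
  have "(\<Sum>f\<in>ES. 1 / real (card (\<rho> ` h f ` EG f)))
    = 1 / real (card (\<rho> ` h e ` EG e))
      + (\<Sum>f\<in>arcs (graph \<Lambda>'). 1 / real (card (\<rho> ` h f ` carrier (edge_group \<Lambda>' f))))"
    unfolding sum.remove[OF finite_arcs r(1)] using r(5,7) by simp
  moreover have "(\<Sum>v\<in>VS. 1 / real (card (\<rho> ` \<sigma> v ` VG v)))
    = 1 / real (card (\<rho> ` \<sigma> u ` VG u))
      + (\<Sum>v\<in>verts (graph \<Lambda>'). 1 / real (card (\<rho> ` \<sigma> v ` carrier (vertex_group \<Lambda>' v))))"
    unfolding sum.remove[OF finite_verts u] using r(4,6) by simp
  ultimately show ?thesis by (simp add: rep_char_def same)
qed

lemma reduction_decreases: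
  assumes "reduction \<Lambda> \<Lambda>'"
  shows "card (arcs (graph \<Lambda>')) < card ES"
    and "card (infinite_vertices \<Lambda>') \<le> card (infinite_vertices \<Lambda>)"
proof -
  obtain e d where r: "e \<in> ES"
    "emap e d ` EG e = VG (endp e d)"
    "verts (graph \<Lambda>') = VS - {endp e d}" "arcs (graph \<Lambda>') = ES - {e}"
    "\<forall>w\<in>verts (graph \<Lambda>'). vertex_group \<Lambda>' w = vertex_group \<Lambda> w"
    "\<forall>f\<in>arcs (graph \<Lambda>'). edge_group \<Lambda>' f = edge_group \<Lambda> f"
    using reduction_basic[OF assms] by (elim exE conjE) (rule that; assumption)
  show "card (arcs (graph \<Lambda>')) < card (ES)"
    unfolding r(4) using r(1) by (intro psubset_card_mono) auto
  have "infinite_vertices \<Lambda>' \<subseteq> infinite_vertices \<Lambda>" using r(3,5) by (auto simp: infinite_vertices_def)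
  then show "card (infinite_vertices \<Lambda>') \<le> card (infinite_vertices \<Lambda>)"
    by (intro card_mono) (auto simp: infinite_vertices_def)
qed

text \<open>Both new vertices and the new edge inherit the map \<sigma> v. The conjugation by x that
  the splitting applies to an edge map becomes an additional factor \<sigma> v x in the conjugator,
  so h can be kept on the old edges.\<close>

lemma splitting_rep:
  fixes K (structure)
  assumes "group K" and split: "finite_splitting \<Lambda> \<Lambda>'" and faith: "faithful_rep K \<Lambda> \<sigma> h"
  shows "\<exists>\<sigma>' h'. faithful_rep K \<Lambda>' \<sigma>' h' \<and> (\<exists>V A B C. splitting_data K \<Lambda> \<sigma> h \<Lambda>' \<sigma>' h' V A B C)"
proof -
  interpret group K by fact
  have rep: "gog_rep K \<Lambda> \<sigma> h" using faith by (simp add: faithful_rep_def)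
  from split obtain v G A B C a b e where s: "v \<in> VS" "G = vertex_group \<Lambda> v"
    and am: "amalgamated_product G A B C" "A \<noteq> C" "B \<noteq> C" "finite C"
    and ab: "a \<noteq> b" "a \<notin> VS - {v}" "b \<notin> VS - {v}" "e \<notin> ES"
    and V': "verts (graph \<Lambda>') = VS - {v} \<union> {a, b}"
    and E': "arcs (graph \<Lambda>') = insert e (ES)"
    and vg: "vertex_group \<Lambda>' a = G\<lparr>carrier := A\<rparr>" "vertex_group \<Lambda>' b = G\<lparr>carrier := B\<rparr>"
    "\<forall>w\<in>VS - {v}. vertex_group \<Lambda>' w = vertex_group \<Lambda> w"
    and eg: "edge_group \<Lambda>' e = G\<lparr>carrier := C\<rparr>"
    "endpoint \<Lambda>' e False = a" "endpoint \<Lambda>' e True = b"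
    "\<forall>d. \<forall>c\<in>C. edge_map \<Lambda>' e d c = c"
    and ends: "\<forall>f\<in>ES. edge_group \<Lambda>' f = edge_group \<Lambda> f \<and>
        (\<forall>d. if endp f d = v
          then (\<exists>(w, H)\<in>{(a, A), (b, B)}. \<exists>x\<in>carrier G.
            endpoint \<Lambda>' f d = w \<and>
            (\<forall>c\<in>EG f.
              edge_map \<Lambda>' f d c = x \<otimes>\<^bsub>G\<^esub> emap f d c \<otimes>\<^bsub>G\<^esub> inv\<^bsub>G\<^esub> x \<and>
              edge_map \<Lambda>' f d c \<in> H))
          else endpoint \<Lambda>' f d = endp f d \<and>
            (\<forall>c\<in>EG f. edge_map \<Lambda>' f d c = emap f d c))"
    unfolding finite_splitting_def by (elim bexE exE conjE) (rule that; assumption)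
  have fg: "edge_group \<Lambda>' f = edge_group \<Lambda> f" if "f \<in> ES" for f
    using ends that by blast
  have fv: "\<exists>x\<in>carrier G. endpoint \<Lambda>' f d \<in> {a, b} \<and> (\<forall>c\<in>EG f.
        edge_map \<Lambda>' f d c = x \<otimes>\<^bsub>G\<^esub> emap f d c \<otimes>\<^bsub>G\<^esub> inv\<^bsub>G\<^esub> x)"
    if "f \<in> ES" "endp f d = v" for f d
  proof -
    have "\<exists>(w, H)\<in>{(a, A), (b, B)}. \<exists>x\<in>carrier G. endpoint \<Lambda>' f d = w \<and>
            (\<forall>c\<in>EG f.
              edge_map \<Lambda>' f d c = x \<otimes>\<^bsub>G\<^esub> emap f d c \<otimes>\<^bsub>G\<^esub> inv\<^bsub>G\<^esub> x \<and>
              edge_map \<Lambda>' f d c \<in> H)"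
      using bspec[OF ends that(1)] that(2) by (metis (no_types, lifting))
    then show ?thesis by auto
  qed
  have fn: "endpoint \<Lambda>' f d = endp f d \<and> (\<forall>c\<in>EG f. edge_map \<Lambda>' f d c = emap f d c)"
    if "f \<in> ES" "endp f d \<noteq> v" for f d
    using bspec[OF ends that(1)] that(2) by (metis (no_types, lifting))
  interpret G: group G using group_vertex[OF s(1)] s(2) by simp
  have sv: "\<sigma> v \<in> hom G K" using rep s by (simp add: gog_rep_def)
  interpret \<sigma>: group_hom G K "\<sigma> v" using sv by (simp add: group_hom_def group_hom_axioms_def G.is_group assms(1))
  have inj: "inj_on (\<sigma> v) (carrier G)" using faith s by (simp add: faithful_rep_def)
  have sub: "subgroup A G" "subgroup B G" "subgroup C G" "C \<subseteq> A" "C \<subseteq> B"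
    using am(1) by (auto simp: amalgamated_product_def)
  note subc = subgroup.subset[OF sub(1)] subgroup.subset[OF sub(2)] subgroup.subset[OF sub(3)]
  \<comment> \<open>One of a and b may be v itself; the update is harmless then, since it assigns
    the old map.\<close>
  define \<sigma>' where "\<sigma>' = \<sigma>(a := \<sigma> v, b := \<sigma> v)"
  define h' where "h' = h(e := \<sigma> v)"
  have \<sigma>'ab: "\<sigma>' a = \<sigma> v" "\<sigma>' b = \<sigma> v" by (simp_all add: \<sigma>'_def)
  have \<sigma>'w: "\<sigma>' w = \<sigma> w" if "w \<in> VS - {v}" for w using that ab by (auto simp: \<sigma>'_def)
  have h'f: "h' f = h f" if "f \<in> ES" for f using that ab(4) by (auto simp: h'_def)
  have h'e: "h' e = \<sigma> v" by (simp add: h'_def)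
  have homsub: "\<sigma> v \<in> hom (G\<lparr>carrier := H\<rparr>) K" if "H \<subseteq> carrier G" for H
    using sv that by (auto simp: hom_def Pi_iff subset_iff)
  have rep': "gog_rep K \<Lambda>' \<sigma>' h'"
    unfolding gog_rep_def
  proof (intro conjI ballI allI)
    fix w assume w: "w \<in> verts (graph \<Lambda>')"
    consider "w = a" | "w = b" | "w \<in> VS - {v}" using w V' by blast
    then show "\<sigma>' w \<in> hom (vertex_group \<Lambda>' w) K"
    proof cases
      case 3
      then show ?thesis using rep \<sigma>'w vg(3) by (simp add: gog_rep_def)
    qed (use vg homsub subc \<sigma>'ab in auto)
  next
    fix f assume f: "f \<in> arcs (graph \<Lambda>')"
    show "h' f \<in> carrier (edge_group \<Lambda>' f) \<rightarrow> carrier K"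
    proof (cases "f = e")
      case True
      then show ?thesis using h'e eg(1) subc by (auto simp: subset_iff)
    next
      case False
      then have "f \<in> ES" using f E' by simp
      then show ?thesis using rep h'f fg by (simp add: gog_rep_def)
    qed
    fix d
    show "\<exists>y\<in>carrier K. \<forall>c\<in>carrier (edge_group \<Lambda>' f).
        \<sigma>' (endpoint \<Lambda>' f d) (edge_map \<Lambda>' f d c) = y \<otimes> h' f c \<otimes> inv y"
    proof (cases "f = e")
      case True
      have "\<sigma>' (endpoint \<Lambda>' e d) = \<sigma> v" using eg(2,3) \<sigma>'ab by (cases d) auto
      then show ?thesis
        using True eg h'e subc by (intro bexI[of _ \<one>]) (auto simp: subset_iff)
    next
      case False
      then have f\<Lambda>: "f \<in> ES" using f E' by simp
      obtain y where y: "y \<in> carrier K" "\<And>c. c \<in> EG f \<Longrightarrow>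
        \<sigma> (endp f d) (emap f d c) = y \<otimes> h f c \<otimes> inv y"
        using rep f\<Lambda> unfolding gog_rep_def by blast
      show ?thesis
      proof (cases "endp f d = v")
        case True
        obtain x where x: "x \<in> carrier G" "endpoint \<Lambda>' f d \<in> {a, b}" "\<And>c. c \<in> EG f \<Longrightarrow>
          edge_map \<Lambda>' f d c = x \<otimes>\<^bsub>G\<^esub> emap f d c \<otimes>\<^bsub>G\<^esub> inv\<^bsub>G\<^esub> x"
          using fv[OF f\<Lambda> True] by blast
        have "\<sigma>' (endpoint \<Lambda>' f d) = \<sigma> v" using x(2) \<sigma>'ab by auto
        moreover have "\<sigma> v (edge_map \<Lambda>' f d c) = (\<sigma> v x \<otimes> y) \<otimes> h f c \<otimes> inv (\<sigma> v x \<otimes> y)"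
          if c: "c \<in> EG f" for c
        proof -
          have "emap f d c \<in> carrier G" using edge_map_closed[OF f\<Lambda> c, of d] True s(2) by simp
          moreover have "h f c \<in> carrier K" using rep f\<Lambda> c unfolding gog_rep_def by blast
          ultimately show ?thesis
            using x(1) x(3)[OF c] y(1) y(2)[OF c] True by (simp add: m_assoc inv_mult_group)
        qed
        ultimately show ?thesis
          using fg[OF f\<Lambda>] h'f[OF f\<Lambda>] x(1) y(1) by (intro bexI[of _ "\<sigma> v x \<otimes> y"]) auto
      next
        case False
        then have "\<sigma>' (endpoint \<Lambda>' f d) = \<sigma> (endp f d)"
          using conjunct1[OF fn[OF f\<Lambda> False]] \<sigma>'w endpoint_in_verts[OF f\<Lambda>] by simp
        then show ?thesis
          using conjunct2[OF fn[OF f\<Lambda> False]] fg[OF f\<Lambda>] h'f[OF f\<Lambda>] y by (intro bexI[of _ y]) auto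
      qed
    qed
  qed
  have "inj_on (\<sigma>' w) (carrier (vertex_group \<Lambda>' w))" if w: "w \<in> verts (graph \<Lambda>')" for w
  proof -
    consider "w = a" | "w = b" | "w \<in> VS - {v}" using w V' by blast
    then show ?thesis
    proof cases
      case 3
      then show ?thesis using faith \<sigma>'w vg(3) by (simp add: faithful_rep_def)
    qed (use vg subc \<sigma>'ab inj_on_subset[OF inj] in auto)
  qed
  then have faith': "faithful_rep K \<Lambda>' \<sigma>' h'" using rep' by (simp add: faithful_rep_def)
  have char: "rep_char \<rho> \<Lambda>' \<sigma>' h' = rep_char \<rho> \<Lambda> \<sigma> h
      + gain \<rho> (\<sigma> v ` carrier G) (\<sigma> v ` A) (\<sigma> v ` B) (\<sigma> v ` C)" for \<rho> :: "'a \<Rightarrow> 'a set"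
  proof -
    have "(\<Sum>f\<in>arcs (graph \<Lambda>'). 1 / real (card (\<rho> ` h' f ` carrier (edge_group \<Lambda>' f))))
      = 1 / real (card (\<rho> ` \<sigma> v ` C))
        + (\<Sum>f\<in>ES. 1 / real (card (\<rho> ` h f ` EG f)))"
      unfolding E' sum.insert[OF finite_arcs ab(4)] using h'f fg h'e eg(1) by simp
    moreover have "(\<Sum>w\<in>verts (graph \<Lambda>'). 1 / real (card (\<rho> ` \<sigma>' w ` carrier (vertex_group \<Lambda>' w))))
      = 1 / real (card (\<rho> ` \<sigma> v ` A)) + 1 / real (card (\<rho> ` \<sigma> v ` B))
        + (\<Sum>w\<in>VS - {v}. 1 / real (card (\<rho> ` \<sigma> w ` VG w)))"
    proof -
      have eq: "verts (graph \<Lambda>') = insert a (insert b (VS - {v}))" using V' by auto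
      show ?thesis unfolding eq using ab finite_verts vg \<sigma>'w \<sigma>'ab by simp
    qed
    moreover have "(\<Sum>w\<in>VS. 1 / real (card (\<rho> ` \<sigma> w ` VG w)))
      = 1 / real (card (\<rho> ` \<sigma> v ` carrier G))
        + (\<Sum>w\<in>VS - {v}. 1 / real (card (\<rho> ` \<sigma> w ` VG w)))"
      unfolding sum.remove[OF finite_verts s(1)] using s(2) by simp
    ultimately show ?thesis by (simp add: rep_char_def gain_def)
  qed
  have dec: "card (infinite_vertices \<Lambda>') < card (infinite_vertices \<Lambda>)"
    if fin: "infinite (\<sigma> v ` carrier G)" "finite (\<sigma> v ` A)" "finite (\<sigma> v ` B)"
  proof (rule psubset_card_mono)
    show "finite (infinite_vertices \<Lambda>)" by (simp add: infinite_vertices_def)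
    have "finite A" "finite B" using fin finite_imageD inj_on_subset[OF inj] subc by blast+
    moreover have "infinite (carrier G)" using fin by blast
    ultimately have "infinite_vertices \<Lambda>' \<subseteq> infinite_vertices \<Lambda> - {v}" "v \<in> infinite_vertices \<Lambda>"
      using V' vg s by (auto simp: infinite_vertices_def)
    then show "infinite_vertices \<Lambda>' \<subset> infinite_vertices \<Lambda>" by blast
  qed
  have subK: "subgroup (\<sigma> v ` H) K" if "subgroup H G" for H
    using \<sigma>.subgroup_img_is_subgroup[OF that] .
  have "splitting_data K \<Lambda> \<sigma> h \<Lambda>' \<sigma>' h' (\<sigma> v ` carrier G) (\<sigma> v ` A) (\<sigma> v ` B) (\<sigma> v ` C)"
    unfolding splitting_data_def
    using subK[OF sub(1)] subK[OF sub(2)] subK[OF sub(3)] subK[OF G.subgroup_self] char dec am sub(4,5) subc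
      inj_on_image_eq_iff[OF inj]
    by (auto simp: psubset_eq)
  then show ?thesis using faith' by blast
qed

end

section \<open>Termination\<close>

context group begin

lemma torsion_free_of_prime:
  assumes N: "subgroup N G" and tf: "\<And>y q. y \<in> N \<Longrightarrow> prime (q::nat) \<Longrightarrow> y [^] q = \<one> \<Longrightarrow> y = \<one>"
    and x: "x \<in> N" "x [^] n = \<one>" "0 < (n::nat)"
  shows "x = \<one>"
  using x
proof (induction n rule: less_induct)
  case (less n)
  have xc: "x \<in> carrier G" using less.prems(1) subgroup.mem_carrier[OF N] by blast
  show ?case
  proof (cases "n = 1")
    case True
    then show ?thesis using less.prems xc by simp
  next
    case False
    then obtain p where p: "prime p" "p dvd n" using prime_factor_nat by blast
    then obtain m where m: "n = m * p" by (metis dvd_div_mult_self)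
    have "(x [^] m) [^] p = \<one>" using less.prems(2) xc by (simp add: nat_pow_pow m)
    moreover have "x [^] m \<in> N" using less.prems(1) subgroup.m_closed[OF N] subgroup.one_closed[OF N]
      by (induction m) auto
    ultimately have "x [^] m = \<one>" using tf p(1) by blast
    moreover have "0 < m" "m < n" using less.prems(3) m prime_gt_1_nat[OF p(1)] by auto
    ultimately show ?thesis using less.IH less.prems(1) by blast
  qed
qed

lemma coset_eq_imp:
  assumes "subgroup N G" "x \<in> carrier G" "y \<in> carrier G" "N #> x = N #> y"
  shows "x \<otimes> inv y \<in> N"
  using subgroup.rcos_module_imp[OF assms(1) is_group assms(3)] rcos_self[OF assms(2,1)] assms(4) by simp

text \<open>Elements of C in the same coset have a quotient in both C and N. It has finite order by
  Lagrange and is trivial because N is torsion-free.\<close>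

lemma finite_subgroup_inj_coset:
  assumes N: "subgroup N G" and tf: "\<And>y q. y \<in> N \<Longrightarrow> prime (q::nat) \<Longrightarrow> y [^] q = \<one> \<Longrightarrow> y = \<one>"
    and C: "subgroup C G" "finite C"
  shows "inj_on (\<lambda>x. N #> x) C"
proof (rule inj_onI)
  fix x y assume x: "x \<in> C" and y: "y \<in> C" and eq: "N #> x = N #> y"
  interpret C: subgroup C G by fact
  interpret CG: group "G\<lparr>carrier := C\<rparr>" by (rule subgroup_imp_group[OF C(1)])
  let ?z = "x \<otimes> inv y"
  have zN: "?z \<in> N" using coset_eq_imp[OF N _ _ eq] x y by simp
  have zC: "?z \<in> C" using x y by simp
  have "?z [^]\<^bsub>G\<lparr>carrier := C\<rparr>\<^esub> order (G\<lparr>carrier := C\<rparr>) = \<one>"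
    using CG.pow_order_eq_1[of ?z] zC by simp
  then have "?z [^] card C = \<one>" by (simp add: order_def nat_pow_consistent[symmetric])
  moreover have "0 < card C" using C(2) zC by (auto simp: card_gt_0_iff)
  ultimately have "?z = \<one>" using torsion_free_of_prime[of N ?z "card C"] N tf zN by blast
  then show "x = y" using x y by (metis C.mem_carrier inv_closed inv_equality inv_inv)
qed

lemma proper_subgroup_card:
  assumes A: "subgroup A G" "finite A" and C: "subgroup C G" "C \<subset> A"
  shows "card A = 2 * card C \<or> 3 * card C \<le> card A"
proof -
  interpret AG: group "G\<lparr>carrier := A\<rparr>" by (rule subgroup_imp_group[OF A(1)])
  have "subgroup C (G\<lparr>carrier := A\<rparr>)" using subgroup_incl[OF C(1) A(1)] C(2) by blast
  then have *: "card (rcosets\<^bsub>G\<lparr>carrier := A\<rparr>\<^esub> C) * card C = card A"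
    using AG.lagrange by (simp add: order_def)
  have "card C < card A" by (rule psubset_card_mono[OF A(2) C(2)])
  then have "card (rcosets\<^bsub>G\<lparr>carrier := A\<rparr>\<^esub> C) \<noteq> 0" "card (rcosets\<^bsub>G\<lparr>carrier := A\<rparr>\<^esub> C) \<noteq> 1"
    using * by (metis less_nat_zero_code mult_0, metis less_irrefl mult_1)
  then have "card (rcosets\<^bsub>G\<lparr>carrier := A\<rparr>\<^esub> C) = 2 \<or> 3 \<le> card (rcosets\<^bsub>G\<lparr>carrier := A\<rparr>\<^esub> C)" by linarith
  then show ?thesis using * by (metis mult_le_mono1)
qed

end

text \<open>For finite D the set is D itself, for infinite D any n of its elements. The image has to
  be finite because \<open>card\<close> of an infinite set is 0.\<close>

lemma detecting_set:
  obtains F where "finite F" "F \<subseteq> D"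
    "\<And>\<rho> :: 'a \<Rightarrow> 'b. inj_on \<rho> F \<Longrightarrow> finite (\<rho> ` D) \<Longrightarrow>
      (finite D \<longrightarrow> card (\<rho> ` D) = card D) \<and> (infinite D \<longrightarrow> n \<le> card (\<rho> ` D))"
proof (cases "finite D")
  case True
  then show ?thesis using that[of D] by (simp add: card_image)
next
  case False
  then obtain F where F: "finite F" "card F = n" "F \<subseteq> D" using infinite_arbitrarily_large by blast
  have "n \<le> card (\<rho> ` D)" if "inj_on \<rho> F" "finite (\<rho> ` D)" for \<rho> :: "'a \<Rightarrow> 'b"
    using card_mono[OF that(2) image_mono[OF F(3)]] card_image[OF that(1)] F(2) by simp
  then show ?thesis using that[of F] F False by simp
qed

text \<open>The gain can only vanish when \<open>A\<close> and \<open>B\<close> are finite and contain \<open>C\<close> with index two, and then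
  the vertex group, if infinite, has been replaced by two finite ones.\<close>

lemma splitting_gain:
  fixes G (structure)
  assumes "group G" and sub: "subgroup V G" "subgroup A G" "subgroup B G" "subgroup C G"
    and CA: "C \<subset> A" "C \<subset> B" "finite C"
    and L: "\<And>H. subgroup H G \<Longrightarrow> finite H \<Longrightarrow> card H \<le> L"
  obtains F where "finite F" "F \<subseteq> carrier G"
    "\<And>\<rho> :: 'a \<Rightarrow> 'a set. inj_on \<rho> F \<Longrightarrow> finite (\<rho> ` carrier G) \<Longrightarrow>
      (if infinite V \<and> finite A \<and> finite B then 0 else 1 / (6 * real L))
        \<le> gain \<rho> V A B C"
proof -
  interpret group G by fact
  note subc = subgroup.subset[OF sub(1)] subgroup.subset[OF sub(2)] subgroup.subset[OF sub(3)] subgroup.subset[OF sub(4)]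
  define c where "c = card C"
  have cpos: "0 < c" using CA(3) subgroup.one_closed[OF sub(4)] by (auto simp: c_def card_gt_0_iff)
  have cL: "c \<le> L" using L[OF sub(4) CA(3)] by (simp add: c_def)
  \<comment> \<open>An infinite factor is made to look at least as large as a finite one of index
    three over C.\<close>
  obtain FA where FA: "finite FA" "FA \<subseteq> A" and detA: "\<And>\<rho> :: 'a \<Rightarrow> 'a set. inj_on \<rho> FA \<Longrightarrow> finite (\<rho> ` A) \<Longrightarrow>
      (finite A \<longrightarrow> card (\<rho> ` A) = card A) \<and> (infinite A \<longrightarrow> 3 * c \<le> card (\<rho> ` A))"
    using detecting_set[of A "3 * c"] by metis
  obtain FB where FB: "finite FB" "FB \<subseteq> B" and detB: "\<And>\<rho> :: 'a \<Rightarrow> 'a set. inj_on \<rho> FB \<Longrightarrow> finite (\<rho> ` B) \<Longrightarrow>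
      (finite B \<longrightarrow> card (\<rho> ` B) = card B) \<and> (infinite B \<longrightarrow> 3 * c \<le> card (\<rho> ` B))"
    using detecting_set[of B "3 * c"] by metis
  \<comment> \<open>An infinite V only contributes a nonnegative term, so the trivial bound 0 is
    enough; for a finite V the exact order is needed.\<close>
  obtain FV where FV: "finite FV" "FV \<subseteq> V" and detV: "\<And>\<rho> :: 'a \<Rightarrow> 'a set. inj_on \<rho> FV \<Longrightarrow> finite (\<rho> ` V) \<Longrightarrow>
      (finite V \<longrightarrow> card (\<rho> ` V) = card V) \<and> (infinite V \<longrightarrow> 0 \<le> card (\<rho> ` V))"
    using detecting_set[of V 0] by metis
  show ?thesis
  proof (rule that[of "C \<union> FA \<union> FB \<union> FV"])
    show "finite (C \<union> FA \<union> FB \<union> FV)" using FA FB FV CA by simp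
    show "C \<union> FA \<union> FB \<union> FV \<subseteq> carrier G" using FA FB FV subc by blast
    fix \<rho> :: "'a \<Rightarrow> 'a set" assume inj: "inj_on \<rho> (C \<union> FA \<union> FB \<union> FV)" and fin: "finite (\<rho> ` carrier G)"
    have finD: "finite (\<rho> ` D)" if "D \<subseteq> carrier G" for D
      using finite_subset[OF image_mono[OF that] fin] .
    define a where "a = card (\<rho> ` A)"
    define b where "b = card (\<rho> ` B)"
    define v where "v = card (\<rho> ` V)"
    have C: "card (\<rho> ` C) = c" using card_image[OF inj_on_subset[OF inj]] by (auto simp: c_def)
    have A: "(finite A \<longrightarrow> a = card A) \<and> (infinite A \<longrightarrow> 3 * c \<le> a)"
      using detA[OF inj_on_subset[OF inj] finD[OF subc(2)]] by (auto simp: a_def)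
    have B: "(finite B \<longrightarrow> b = card B) \<and> (infinite B \<longrightarrow> 3 * c \<le> b)"
      using detB[OF inj_on_subset[OF inj] finD[OF subc(3)]] by (auto simp: b_def)
    have V: "finite V \<longrightarrow> v = card V"
      using detV[OF inj_on_subset[OF inj] finD[OF subc(1)]] by (auto simp: v_def)
    have a: "(finite A \<and> a = 2 * c) \<or> 3 * c \<le> a"
      using A proper_subgroup_card[OF sub(2) _ sub(4) CA(1)] by (auto simp: c_def)
    have b: "(finite B \<and> b = 2 * c) \<or> 3 * c \<le> b"
      using B proper_subgroup_card[OF sub(3) _ sub(4) CA(2)] by (auto simp: c_def)
    have le: "1 / real n \<le> 1 / (real k * real c)" if "k * c \<le> n" "0 < k" for k n
    proof -
      have "real k * real c \<le> real n" using that(1) by (metis of_nat_le_iff of_nat_mult)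
      moreover have "0 < real k * real c" using that(2) cpos by simp
      ultimately show ?thesis by (intro divide_left_mono) auto
    qed
    have a2: "1 / real a \<le> 1 / (2 * real c)" using le[of 2 a] a by auto
    have b2: "1 / real b \<le> 1 / (2 * real c)" using le[of 2 b] b by auto
    have sixth: "1 / (6 * real L) \<le> 1 / (6 * real c)"
      using cpos cL by (intro divide_left_mono) auto
    \<comment> \<open>Indices 2 and 2 cancel exactly. The next possibility, 2 and 3, leaves 1/c -
      1/(2c) - 1/(3c) = 1/(6c), which is the origin of the constant 6.\<close>
    have half: "1 / real c - 1 / (2 * real c) - 1 / (2 * real c) = 0"
      and third: "1 / real c - 1 / (2 * real c) - 1 / (3 * real c) = 1 / (6 * real c)"
      using cpos by (simp_all add: field_simps)
    have vnn: "0 \<le> 1 / real v" by simp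
    have "(if infinite V \<and> finite A \<and> finite B then 0 else 1 / (6 * real L))
        \<le> 1 / real c - 1 / real a - 1 / real b + 1 / real v"
    proof (cases "3 * c \<le> a \<or> 3 * c \<le> b")
      case True
      then have "1 / (6 * real c) \<le> 1 / real c - 1 / real a - 1 / real b"
        using le[of 3 a] le[of 3 b] a2 b2 third by auto
      moreover have "0 \<le> 1 / (6 * real L)" by simp
      ultimately have "1 / (6 * real L) \<le> 1 / real c - 1 / real a - 1 / real b + 1 / real v"
        "0 \<le> 1 / real c - 1 / real a - 1 / real b + 1 / real v" using sixth vnn by linarith+
      then show ?thesis by (auto simp only: split: if_split)
    next
      case False
      \<comment> \<open>Both indices are two here, so only the term 1 / v of V can contribute; it is
        at least 1 / L when V is finite.\<close>
      then have fins: "finite A" "finite B" using a b by auto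
      show ?thesis
      proof (cases "finite V")
        case True
        then have "v \<le> L" "0 < v" using V L[OF sub(1)] subgroup.one_closed[OF sub(1)]
          by (auto simp: card_gt_0_iff)
        then have "1 / (6 * real L) \<le> 1 / real v" by (intro divide_left_mono) auto
        then show ?thesis using True half a2 b2 by auto
      next
        case False
        then show ?thesis using fins half a2 b2 vnn by (simp only: if_True if_False simp_thms)
      qed
    qed
    then show "(if infinite V \<and> finite A \<and> finite B then 0 else 1 / (6 * real L))
        \<le> gain \<rho> V A B C"
      by (simp add: gain_def C a_def b_def v_def)
  qed
qed

lemma iso_generators:
  assumes "group G" "group H" "H \<cong> G" and X: "finite X" "X \<subseteq> carrier G" "generate G X = carrier G"
  obtains Y where "finite Y" "Y \<subseteq> carrier H" "generate H Y = carrier H" "card Y \<le> card X"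
proof -
  obtain \<psi> where \<psi>: "\<psi> \<in> iso G H" using group.iso_sym[OF assms(2,3)] by (auto simp: is_iso_def)
  interpret \<psi>: group_hom G H \<psi>
    using \<psi> assms(1,2) by (simp add: group_hom_def group_hom_axioms_def iso_def)
  have "generate H (\<psi> ` X) = \<psi> ` carrier G" using \<psi>.generate_img[OF X(2)] X(3) by simp
  also have "\<dots> = carrier H" using \<psi> by (simp add: iso_def bij_betw_def)
  finally have gen: "generate H (\<psi> ` X) = carrier H" .
  have "\<psi> ` X \<subseteq> carrier H" using X(2) \<psi>.hom_closed by blast
  then show ?thesis using that[of "\<psi> ` X"] X(1) card_image_le[OF X(1), of \<psi>] gen by simp
qed

theorem no_infinite_sequence:
  fixes G :: "('a, 'm) monoid_scheme" (structure) and \<Lambda> :: "nat \<Rightarrow> ('v, 'e, 'g) graph_of_groups"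
  assumes G: "group G" and X: "finite X" "X \<subseteq> carrier G" "generate G X = carrier G"
    and res: "residual_data G N"
    and dec: "\<And>i. graph_of_groups_decomposition G (\<Lambda> i)"
    and step: "\<And>i. reduction (\<Lambda> i) (\<Lambda> (Suc i)) \<or> finite_splitting (\<Lambda> i) (\<Lambda> (Suc i))"
  shows False
proof -
  interpret group G by fact
  have gog: "finite_gog (\<Lambda> i)" for i
    using dec by (simp add: finite_gog_def graph_of_groups_decomposition_def)
  obtain T where T: "\<And>i. maximal_tree (graph (\<Lambda> i)) (T i)" "\<And>i. fundamental_group (\<Lambda> i) (T i) \<cong> G"
    using dec unfolding graph_of_groups_decomposition_def by metis
  have tree: "finite_gog_tree (\<Lambda> i) (T i)" for i
    using gog T(1) by (simp add: finite_gog_tree_def finite_gog_tree_axioms_def)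
  have N: "N k \<lhd> G" "finite (rcosets (N k))"
    and tf: "\<And>x q. x \<in> N k \<Longrightarrow> prime (q::nat) \<Longrightarrow> x [^] q = \<one> \<Longrightarrow> x = \<one>" for k
    using res unfolding residual_data_def by blast+
  have sep: "\<exists>k. N k \<inter> F \<subseteq> {\<one>}" if "finite F" "F \<subseteq> carrier G" for F
    using res that unfolding residual_data_def by blast
  have Nsub: "subgroup (N k) G" for k using N(1) normal_imp_subgroup by blast
  define \<rho> where "\<rho> k = (\<lambda>x. N k #> x)" for k
  define Q where "Q k = G Mod N k" for k
  have Q: "group (Q k)" "finite (carrier (Q k))" "\<rho> k \<in> hom G (Q k)" for k
    using normal.factorgroup_is_group[OF N(1)] N(2) normal.r_coset_hom_Mod[OF N(1)]
    by (auto simp: Q_def \<rho>_def FactGroup_def)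
  have fin_img: "finite (\<rho> k ` carrier G)" for k
    using hom_in_carrier[OF Q(3)] Q(2)[of k] by (meson finite_subset image_subsetI)
  have inj_\<rho>: "\<exists>k. inj_on (\<rho> k) F" if F: "finite F" "F \<subseteq> carrier G" for F
  proof -
    \<comment> \<open>The projection is injective on F as soon as \<open>N k\<close> contains no
      nontrivial quotient of two elements of F.\<close>
    have "finite ((\<lambda>(x, y). x \<otimes> inv y) ` (F \<times> F))" "(\<lambda>(x, y). x \<otimes> inv y) ` (F \<times> F) \<subseteq> carrier G"
      using F by auto
    then obtain k where k: "N k \<inter> (\<lambda>(x, y). x \<otimes> inv y) ` (F \<times> F) \<subseteq> {\<one>}" using sep by blast
    have "inj_on (\<rho> k) F"
    proof (rule inj_onI)
      fix x y assume xy: "x \<in> F" "y \<in> F" "\<rho> k x = \<rho> k y"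
      then have c: "x \<in> carrier G" "y \<in> carrier G" using F by auto
      then have "x \<otimes> inv y \<in> N k" using coset_eq_imp[OF Nsub] xy(3) by (simp add: \<rho>_def)
      then have "x \<otimes> inv y = \<one>" using k xy(1,2) by auto
      then show "x = y" using c by (metis inv_closed inv_equality inv_inv)
    qed
    then show ?thesis by blast
  qed
  \<comment> \<open>Finite subgroups embed in the quotient by the torsion-free subgroup
    \<open>N 0\<close>, so its index bounds their orders.\<close>
  define L where "L = card (rcosets (N 0))"
  have L: "card H \<le> L" if H: "subgroup H G" "finite H" for H
  proof -
    have "inj_on (\<rho> 0) H" unfolding \<rho>_def using finite_subgroup_inj_coset[OF Nsub tf H] .
    moreover have "\<rho> 0 ` H \<subseteq> rcosets (N 0)"
      using subgroup.subset[OF H(1)] by (auto simp: \<rho>_def RCOSETS_def)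
    ultimately show ?thesis unfolding L_def using card_inj_on_le N(2) by blast
  qed
  have Lpos: "0 < L" using L[OF triv_subgroup] by simp
  have faith0: "\<exists>\<sigma> h. faithful_rep G (\<Lambda> 0) \<sigma> h"
  proof -
    interpret L: finite_gog_tree "\<Lambda> 0" "T 0" by (rule tree)
    obtain \<psi> where \<psi>: "\<psi> \<in> iso L.pi1 G" using T(2) by (auto simp: is_iso_def)
    then have hom: "\<psi> \<in> hom L.pi1 G"
      and inj: "inj_on \<psi> (carrier L.pi1)"
      by (auto simp: iso_def bij_betw_def)
    have "inj_on (\<lambda>x. \<psi> (L.vcls v x)) (L.VG v)"
      if v: "v \<in> L.VS" for v
    proof -
      have "L.vcls v ` L.VG v \<subseteq> carrier L.pi1"
        using L.vcls_closed[OF v] by blast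
      then have "inj_on (\<psi> \<circ> L.vcls v) (L.VG v)"
        using L.inj_vcls[OF v] inj_on_subset[OF inj] by (intro comp_inj_on)
      then show ?thesis by (simp add: comp_def)
    qed
    then show ?thesis using L.rep_of_pi1_hom[OF G hom] unfolding faithful_rep_def by blast
  qed
  \<comment> \<open>The pairs (\<sigma>, h) are propagated by dependent choice: kept by a reduction,
    extended by a splitting. They do not depend on k, so \<open>\<chi> k\<close> can later be
    followed along the sequence for any k.\<close>
  define P where "P n s \<longleftrightarrow> faithful_rep G (\<Lambda> n) (fst s) (snd s)"
    for n and s :: "('v \<Rightarrow> 'g \<Rightarrow> 'a) \<times> ('e \<Rightarrow> 'g \<Rightarrow> 'a)"
  define R where "R n s s' \<longleftrightarrow> (reduction (\<Lambda> n) (\<Lambda> (Suc n)) \<and> s' = s) \<or>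
      (\<exists>V A B C. splitting_data G (\<Lambda> n) (fst s) (snd s) (\<Lambda> (Suc n)) (fst s') (snd s') V A B C)"
    for n and s s' :: "('v \<Rightarrow> 'g \<Rightarrow> 'a) \<times> ('e \<Rightarrow> 'g \<Rightarrow> 'a)"
  have "\<exists>s. \<forall>n. P n (s n) \<and> R n (s n) (s (Suc n))"
  proof (rule dependent_nat_choice)
    show "\<exists>s. P 0 s" using faith0 by (auto simp: P_def)
    fix s n assume s: "P n s"
    show "\<exists>s'. P (Suc n) s' \<and> R n s s'"
    proof (cases "reduction (\<Lambda> n) (\<Lambda> (Suc n))")
      case True
      obtain e d where r: "verts (graph (\<Lambda> (Suc n))) = verts (graph (\<Lambda> n)) - {endpoint (\<Lambda> n) e d}"
        "\<forall>w\<in>verts (graph (\<Lambda> (Suc n))). vertex_group (\<Lambda> (Suc n)) w = vertex_group (\<Lambda> n) w"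
        using finite_gog.reduction_basic[OF gog True] by (elim exE conjE) (rule that; assumption)
      have "P (Suc n) s"
        using s finite_gog.reduction_rep[OF gog G True] r unfolding P_def faithful_rep_def by auto
      then show ?thesis using True by (intro exI[of _ s]) (simp add: R_def)
    next
      case False
      then have "finite_splitting (\<Lambda> n) (\<Lambda> (Suc n))" using step by blast
      from finite_gog.splitting_rep[OF gog G this s[unfolded P_def]] obtain \<sigma>' h' where
        "faithful_rep G (\<Lambda> (Suc n)) \<sigma>' h'"
        "\<exists>V A B C. splitting_data G (\<Lambda> n) (fst s) (snd s) (\<Lambda> (Suc n)) \<sigma>' h' V A B C" by blast
      then show ?thesis by (intro exI[of _ "(\<sigma>', h')"]) (simp add: P_def R_def)
    qed
  qed
  then obtain s where s: "\<And>n. P n (s n)" "\<And>n. R n (s n) (s (Suc n))" by blast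
  define \<chi> where "\<chi> k n = rep_char (\<rho> k) (\<Lambda> n) (fst (s n)) (snd (s n))" for k n
  have rep: "gog_rep G (\<Lambda> n) (fst (s n)) (snd (s n))" for n
    using s(1) by (simp add: P_def faithful_rep_def)
  \<comment> \<open>This bound, like the next one, is the same for all k, so that k may be chosen
    after the number of steps is fixed.\<close>
  have upper: "\<chi> k n \<le> 2 * real (card X)" for k n
  proof -
    obtain Y where Y: "finite Y" "Y \<subseteq> carrier (fundamental_group (\<Lambda> n) (T n))"
      "generate (fundamental_group (\<Lambda> n) (T n)) Y = carrier (fundamental_group (\<Lambda> n) (T n))" "card Y \<le> card X"
      using iso_generators[OF G _ T(2) X] finite_gog_tree.group_pi1[OF tree] by metis
    have "gog_rep (Q k) (\<Lambda> n) (\<lambda>v x. \<rho> k (fst (s n) v x)) (\<lambda>e c. \<rho> k (snd (s n) e c))"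
      by (rule finite_gog.gog_rep_comp[OF gog G Q(1) rep Q(3)])
    from finite_gog_tree.rep_inequality[OF tree Q(1,2) Y(1-3) this] Y(4)
    show ?thesis by (simp add: \<chi>_def rep_char_def image_image)
  qed
  have lower: "- real (card (verts (graph (\<Lambda> 0)))) \<le> \<chi> k 0" for k
  proof -
    have "(\<Sum>v\<in>verts (graph (\<Lambda> 0)). 1 / real (card (\<rho> k ` fst (s 0) v ` carrier (vertex_group (\<Lambda> 0) v))))
      \<le> real (card (verts (graph (\<Lambda> 0)))) * 1"
      by (rule sum_bounded_above) (simp add: divide_le_eq)
    moreover have "0 \<le> (\<Sum>e\<in>arcs (graph (\<Lambda> 0)). 1 / real (card (\<rho> k ` snd (s 0) e ` carrier (edge_group (\<Lambda> 0) e))))"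
      by (rule sum_nonneg) simp
    ultimately show ?thesis by (simp add: \<chi>_def rep_char_def)
  qed
  \<comment> \<open>A reduction removes an edge and creates no infinite vertex group. Replacing an
    infinite vertex group by two finite ones adds an edge but lowers the first component.\<close>
  define measure_pair where "measure_pair n = (card (infinite_vertices (\<Lambda> n)), card (arcs (graph (\<Lambda> n))))" for n
  define decreasing where "decreasing n \<longleftrightarrow> (measure_pair (Suc n), measure_pair n) \<in> less_than <*lex*> less_than" for n
  have stepF: "\<exists>F. finite F \<and> F \<subseteq> carrier G \<and> (\<forall>k. inj_on (\<rho> k) F \<longrightarrow>
      \<chi> k n + (if decreasing n then 0 else 1 / (6 * real L)) \<le> \<chi> k (Suc n))" for n
  proof (cases "reduction (\<Lambda> n) (\<Lambda> (Suc n)) \<and> s (Suc n) = s n")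
    case True
    then have red: "reduction (\<Lambda> n) (\<Lambda> (Suc n))" and same: "s (Suc n) = s n" by auto
    have "decreasing n" using finite_gog.reduction_decreases[OF gog red] by (auto simp: decreasing_def measure_pair_def)
    moreover have "\<chi> k (Suc n) = \<chi> k n" for k
      unfolding \<chi>_def same by (rule finite_gog.reduction_rep_char[OF gog G Q(1) red rep Q(3)])
    ultimately show ?thesis by (intro exI[of _ "{}"]) simp
  next
    case False
    then obtain V A B C where "splitting_data G (\<Lambda> n) (fst (s n)) (snd (s n)) (\<Lambda> (Suc n)) (fst (s (Suc n))) (snd (s (Suc n))) V A B C"
      using s(2)[of n] unfolding R_def by blast
    then have sub: "subgroup V G" "subgroup A G" "subgroup B G" "subgroup C G" and CA: "C \<subset> A" "C \<subset> B" "finite C"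
      and char: "\<And>\<rho> :: 'a \<Rightarrow> 'a set. rep_char \<rho> (\<Lambda> (Suc n)) (fst (s (Suc n))) (snd (s (Suc n)))
        = rep_char \<rho> (\<Lambda> n) (fst (s n)) (snd (s n)) + gain \<rho> V A B C"
      and decr: "infinite V \<and> finite A \<and> finite B \<longrightarrow>
        card (infinite_vertices (\<Lambda> (Suc n))) < card (infinite_vertices (\<Lambda> n))"
      unfolding splitting_data_def by blast+
    obtain F where F: "finite F" "F \<subseteq> carrier G" and gain:
      "\<And>\<rho> :: 'a \<Rightarrow> 'a set. inj_on \<rho> F \<Longrightarrow> finite (\<rho> ` carrier G) \<Longrightarrow>
        (if infinite V \<and> finite A \<and> finite B then 0 else 1 / (6 * real L))
        \<le> gain \<rho> V A B C"
      using splitting_gain[OF G sub CA L] by metis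
    have "decreasing n" if "infinite V \<and> finite A \<and> finite B"
      using decr that by (simp add: decreasing_def measure_pair_def)
    then have le: "(if decreasing n then 0 else 1 / (6 * real L))
      \<le> (if infinite V \<and> finite A \<and> finite B then 0 else 1 / (6 * real L))" by simp
    have "\<chi> k n + (if decreasing n then 0 else 1 / (6 * real L)) \<le> \<chi> k (Suc n)" if "inj_on (\<rho> k) F" for k
      using gain[OF that fin_img] le char[of "\<rho> k"] unfolding \<chi>_def by linarith
    then show ?thesis using F by blast
  qed
  then obtain F where F: "\<And>n. finite (F n)" "\<And>n. F n \<subseteq> carrier G"
    "\<And>n k. inj_on (\<rho> k) (F n) \<Longrightarrow> \<chi> k n + (if decreasing n then 0 else 1 / (6 * real L)) \<le> \<chi> k (Suc n)"
    by metis
  \<comment> \<open>The total growth of \<chi> permitted by \<open>upper\<close> and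
    \<open>lower\<close>, divided by the least gain \<open>1 / (6 * L)\<close>.\<close>
  define M where "M = 6 * real L * (2 * real (card X) + real (card (verts (graph (\<Lambda> 0)))))"
  have bound: "real (card {i. i < n \<and> \<not> decreasing i}) \<le> M" for n
  proof -
    \<comment> \<open>The quotient depends on n, since it must be injective on the detecting sets of
      the first n steps; M does not depend on n.\<close>
    obtain k where k: "inj_on (\<rho> k) (\<Union>i<n. F i)" using inj_\<rho>[of "\<Union>i<n. F i"] F(1,2) by auto
    have "\<chi> k 0 + real (card {i. i < j \<and> \<not> decreasing i}) / (6 * real L) \<le> \<chi> k j" if "j \<le> n" for j
      using that
    proof (induction j)
      case (Suc j)
      have "F j \<subseteq> (\<Union>i<n. F i)" by (rule UN_upper) (use Suc.prems in simp)
      then have "inj_on (\<rho> k) (F j)" by (rule inj_on_subset[OF k])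
      then have *: "\<chi> k j + (if decreasing j then 0 else 1 / (6 * real L)) \<le> \<chi> k (Suc j)" by (rule F(3))
      have "{i. i < Suc j \<and> \<not> decreasing i} = (if decreasing j then {i. i < j \<and> \<not> decreasing i} else insert j {i. i < j \<and> \<not> decreasing i})"
        by (auto simp: less_Suc_eq)
      then have "real (card {i. i < Suc j \<and> \<not> decreasing i})
        = real (card {i. i < j \<and> \<not> decreasing i}) + (if decreasing j then 0 else 1)" by simp
      then show ?case using * Suc by (auto simp: add_divide_distrib split: if_splits)
    qed simp
    from this[of n] have "real (card {i. i < n \<and> \<not> decreasing i}) / (6 * real L)
        \<le> 2 * real (card X) + real (card (verts (graph (\<Lambda> 0))))"
      using upper[of k n] lower[of k] by simp
    then show ?thesis using Lpos by (simp add: M_def divide_le_eq mult.commute)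
  qed
  have "finite {i. \<not> decreasing i}"
  proof (rule ccontr)
    assume "infinite {i. \<not> decreasing i}"
    then obtain D where D: "finite D" "card D = Suc (nat \<lceil>M\<rceil>)" "D \<subseteq> {i. \<not> decreasing i}"
      using infinite_arbitrarily_large by blast
    have "D \<subseteq> {i. i < Suc (Max D) \<and> \<not> decreasing i}" using D(1,3) Max_ge[OF D(1)] by (auto simp: less_Suc_eq_le)
    then have "card D \<le> card {i. i < Suc (Max D) \<and> \<not> decreasing i}" by (intro card_mono) auto
    then have "real (Suc (nat \<lceil>M\<rceil>)) \<le> M" using bound[of "Suc (Max D)"] D(2) by linarith
    then show False by linarith
  qed
  then obtain i0 where "\<forall>i\<in>{i. \<not> decreasing i}. i < i0" unfolding finite_nat_set_iff_bounded ..
  then have i0: "decreasing i" if "i \<ge> i0" for i using that by (metis mem_Collect_eq not_le)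
  have "wf (less_than <*lex*> less_than)" by (intro wf_lex_prod wf_less_than)
  then have "\<not> (\<exists>f. \<forall>i. (f (Suc i), f i) \<in> less_than <*lex*> less_than)"
    using wf_iff_no_infinite_down_chain by blast
  moreover have "\<exists>f. \<forall>i. (f (Suc i), f i) \<in> less_than <*lex*> less_than"
    by (rule exI[of _ "\<lambda>i. measure_pair (i0 + i)"]) (use i0 in \<open>simp add: decreasing_def\<close>)
  ultimately show False by blast
qed

theorem theorem21:
  fixes W :: "('a, 'm) monoid_scheme"
    and S :: "'s set"
    and m :: "'s \<Rightarrow> 's \<Rightarrow> enat"
  assumes "group W"
    and "coxeter_presentation W S m"
    and "finitely_generated_group W"
  shows "accessible TYPE('v \<times> 'e \<times> 'g) W"
  unfolding accessible_def
proof (intro notI, elim exE conjE)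
  fix \<Lambda> :: "nat \<Rightarrow> ('v, 'e, 'g) graph_of_groups"
  assume dec: "\<forall>i. graph_of_groups_decomposition W (\<Lambda> i) \<and>
      (\<forall>e\<in>arcs (graph (\<Lambda> i)). finite (carrier (edge_group (\<Lambda> i) e)))"
    and step: "\<forall>i. reduction (\<Lambda> i) (\<Lambda> (Suc i)) \<or> finite_splitting (\<Lambda> i) (\<Lambda> (Suc i))"
  let ?P = "presented_group S (coxeter_relators S m)"
  have cm: "coxeter_matrix S m" and iso: "?P \<cong> W"
    using assms(2) by (auto simp: coxeter_presentation_def)
  interpret coxeter S m by unfold_locales (rule cm)
  have iso': "W \<cong> ?P" by (rule P.iso_sym[OF iso])
  obtain X0 where X0: "finite X0" "X0 \<subseteq> carrier W" "generate W X0 = carrier W"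
    using assms(3) by (auto simp: finitely_generated_group_def)
  obtain X where X: "finite X" "X \<subseteq> carrier ?P" "generate ?P X = carrier ?P"
    using iso_generators[OF assms(1) P.is_group iso X0] by metis
  interpret finite_coxeter S m by unfold_locales (rule finite_generators[OF X])
  \<comment> \<open>Decompositions are specified up to isomorphism of the fundamental group, so the
    sequence is transported to the presented group, where the congruence subgroups live.\<close>
  have "graph_of_groups_decomposition ?P (\<Lambda> i)" for i
    using dec iso_trans[OF _ iso'] unfolding graph_of_groups_decomposition_def by blast
  then show False
    using no_infinite_sequence[OF P.is_group X residual_data_congruence] step by blast
qed

end
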